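(* Suppose that $S$ is an $F$-finite regular ring and that $R=S/I$. Further suppose that $\mathfrak a_\bullet$ is a graded system of ideals of $S$ such that $(S,\mathfrak a_\bullet)$ and $(R,\overline{\mathfrak a_\bullet})$ are pairs, where $\overline{\mathfrak a_i}=\mathfrak a_iR$. Let $J$ be another ideal of $S$ containing $I$ and let $\overline J=J/I$. Then $\overline J\subseteq R$ is uniformly $(\overline{\mathfrak a_\bullet},F)$-compatible if and only if for all $e\ge0$ and all $a\in\mathfrak a_{p^e-1}$ we have $$a\,(I^{[p^e]}:I)\subseteq(J^{[p^e]}:J).$$ In other words, $\overline J$ is uniformly $(\overline{\mathfrak a_\bullet},F)$-compatible if and only if $\mathfrak a_{p^e-1}(I^{[p^e]}:I)\subseteq(J^{[p^e]}:J)$ for all $e\ge0$.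
   Context: All rings are commutative, noetherian, excellent, of prime characteristic $p>0$ and $F$-finite. $F^e_*M$ denotes $M$ viewed as an $R$-module via the $e$-iterated Frobenius. A graded system of ideals $\mathfrak a_\bullet=\{\mathfrak a_i\}_{i\ge0}$ satisfies $\mathfrak a_i\mathfrak a_j\subseteq\mathfrak a_{i+j}$. A pair $(R,\mathfrak a_\bullet)$ consists of a reduced ring $R$ and a graded system of ideals of $R$ with $\mathfrak a_0=R$ and such that each $\mathfrak a_i$ contains an element of $R^\circ$ (the set of elements in no minimal prime of $R$). An ideal $K\subseteq R$ is uniformly $(\mathfrak a_\bullet,F)$-compatible if for every $e>0$, every $a\in\mathfrak a_{p^e-1}$ and every $R$-linear map $\phi:F^e_*R\to R$ one has $\phi(F^e_*(aK))\subseteq K$. $I^{[p^e]}$ is the ideal generated by $p^e$-th powers of elements of $I$; colons are taken in $S$. *)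

theory Defs
  imports
    "HOL-Algebra.Module"
    "HOL-Algebra.QuotRing"
    "HOL-Algebra.Ring_Divisibility"
    "HOL-Algebra.Ideal_Product"
    "HOL-Computational_Algebra.Primes"
    "HOL-Library.Extended_Nat"
begin

section \<open>Regular rings\<close>

text \<open>
  Localization \<open>M\<^sup>-\<^sup>1R\<close> at a multiplicative set \<open>M\<close>. Fractions are equivalence classes of
  pairs (numerator, denominator). The operations take the union of the result classes over
  all representatives; as the result does not depend on the representatives, this union is
  a single class (the same encoding as in the definition of multiplication in the quotient ring).
\<close>

definition fraction_rel :: "('a, 'm) ring_scheme \<Rightarrow> 'a set \<Rightarrow> (('a \<times> 'a) \<times> ('a \<times> 'a)) set"
  where "fraction_rel R M =
    {((a, s), (b, t)). a \<in> carrier R \<and> s \<in> M \<and> b \<in> carrier R \<and> t \<in> M \<and>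
       (\<exists>u\<in>M. u \<otimes>\<^bsub>R\<^esub> (a \<otimes>\<^bsub>R\<^esub> t \<ominus>\<^bsub>R\<^esub> b \<otimes>\<^bsub>R\<^esub> s) = \<zero>\<^bsub>R\<^esub>)}"

definition fraction :: "('a, 'm) ring_scheme \<Rightarrow> 'a set \<Rightarrow> 'a \<Rightarrow> 'a \<Rightarrow> ('a \<times> 'a) set"
  where "fraction R M a s = fraction_rel R M `` {(a, s)}"

definition localization :: "('a, 'm) ring_scheme \<Rightarrow> 'a set \<Rightarrow> ('a \<times> 'a) set ring"
  where "localization R M =
    \<lparr>carrier = (carrier R \<times> M) // fraction_rel R M,
     mult = (\<lambda>U V. \<Union>(a, s)\<in>U. \<Union>(b, t)\<in>V. fraction R M (a \<otimes>\<^bsub>R\<^esub> b) (s \<otimes>\<^bsub>R\<^esub> t)),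
     one = fraction R M \<one>\<^bsub>R\<^esub> \<one>\<^bsub>R\<^esub>,
     zero = fraction R M \<zero>\<^bsub>R\<^esub> \<one>\<^bsub>R\<^esub>,
     add = (\<lambda>U V. \<Union>(a, s)\<in>U. \<Union>(b, t)\<in>V.
              fraction R M (a \<otimes>\<^bsub>R\<^esub> t \<oplus>\<^bsub>R\<^esub> b \<otimes>\<^bsub>R\<^esub> s) (s \<otimes>\<^bsub>R\<^esub> t))\<rparr>"

text \<open>
  Supremum of the lengths \<open>n\<close> of chains of primes \<open>P\<^sub>0 \<subset> \<dots> \<subset> P\<^sub>n\<close>. The zero ring gets
  the value 0, but only local rings are considered below.
\<close>

definition krull_dim :: "('a, 'm) ring_scheme \<Rightarrow> enat"
  where "krull_dim R =
    Sup {enat n | n. \<exists>P :: nat \<Rightarrow> 'a set.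
           (\<forall>i\<le>n. primeideal (P i) R) \<and> (\<forall>i<n. P i \<subset> P (Suc i))}"

text \<open>A noetherian local ring whose maximal ideal is generated by \<open>dim R\<close> elements.\<close>

definition regular_local_ring :: "('a, 'm) ring_scheme \<Rightarrow> bool"
  where "regular_local_ring R \<longleftrightarrow>
    cring R \<and> noetherian_ring R \<and> (\<exists>!\<mm>. maximalideal \<mm> R) \<and>
    (\<forall>\<mm>. maximalideal \<mm> R \<longrightarrow>
       (\<exists>U. U \<subseteq> carrier R \<and> finite U \<and> enat (card U) = krull_dim R \<and> \<mm> = Idl\<^bsub>R\<^esub> U))"

definition regular_ring :: "('a, 'm) ring_scheme \<Rightarrow> bool"
  where "regular_ring R \<longleftrightarrow>
    cring R \<and> noetherian_ring R \<and>
    (\<forall>P. primeideal P R \<longrightarrow> regular_local_ring (localization R (carrier R - P)))"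


section \<open>Frobenius\<close>

definition has_characteristic :: "('a, 'm) ring_scheme \<Rightarrow> nat \<Rightarrow> bool"
  where "has_characteristic R p \<longleftrightarrow> (\<forall>n::nat. [n] \<cdot>\<^bsub>R\<^esub> \<one>\<^bsub>R\<^esub> = \<zero>\<^bsub>R\<^esub> \<longleftrightarrow> p dvd n)"

definition self_module :: "('a, 'm) ring_scheme \<Rightarrow> ('a, 'a) module"
  where "self_module R =
    \<lparr>carrier = carrier R, mult = mult R, one = one R, zero = zero R, add = add R,
     smult = mult R\<rparr>"

text \<open>\<open>F\<^sup>e\<^sub>*M\<close> has the same elements as \<open>M\<close>, and \<open>r \<in> R\<close> acts on it as \<open>r\<close> to the power \<open>p\<^sup>e\<close>.\<close>

definition frobenius_pushforward ::
    "nat \<Rightarrow> nat \<Rightarrow> ('a, 'm) ring_scheme \<Rightarrow> ('a, 'b) module \<Rightarrow> ('a, 'b) module"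
  where "frobenius_pushforward p e R M =
    M\<lparr>smult := (\<lambda>r x. (r [^]\<^bsub>R\<^esub> (p ^ e)) \<odot>\<^bsub>M\<^esub> x)\<rparr>"

definition finitely_generated_module :: "('a, 'm) ring_scheme \<Rightarrow> ('a, 'b) module \<Rightarrow> bool"
  where "finitely_generated_module R M \<longleftrightarrow>
    (\<exists>U. finite U \<and> U \<subseteq> carrier M \<and>
       (\<forall>y\<in>carrier M. \<exists>c\<in>U \<rightarrow> carrier R. y = (\<Oplus>\<^bsub>M\<^esub>x\<in>U. c x \<odot>\<^bsub>M\<^esub> x)))"

definition F_finite :: "nat \<Rightarrow> ('a, 'm) ring_scheme \<Rightarrow> bool"
  where "F_finite p R \<longleftrightarrow>
    finitely_generated_module R (frobenius_pushforward p 1 R (self_module R))"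

text \<open>Only the values on the carrier of \<open>M\<close> matter.\<close>

definition linear_maps ::
    "('a, 'm) ring_scheme \<Rightarrow> ('a, 'b) module \<Rightarrow> ('a, 'c) module \<Rightarrow> ('b \<Rightarrow> 'c) set"
  where "linear_maps R M N =
    {\<phi> \<in> carrier M \<rightarrow> carrier N.
       (\<forall>x\<in>carrier M. \<forall>y\<in>carrier M. \<phi> (x \<oplus>\<^bsub>M\<^esub> y) = \<phi> x \<oplus>\<^bsub>N\<^esub> \<phi> y) \<and>
       (\<forall>r\<in>carrier R. \<forall>x\<in>carrier M. \<phi> (r \<odot>\<^bsub>M\<^esub> x) = r \<odot>\<^bsub>N\<^esub> \<phi> x)}"

definition frobenius_power :: "nat \<Rightarrow> nat \<Rightarrow> ('a, 'm) ring_scheme \<Rightarrow> 'a set \<Rightarrow> 'a set"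
  where "frobenius_power p e R I = Idl\<^bsub>R\<^esub> ((\<lambda>x. x [^]\<^bsub>R\<^esub> (p ^ e)) ` I)"

definition ideal_colon :: "('a, 'm) ring_scheme \<Rightarrow> 'a set \<Rightarrow> 'a set \<Rightarrow> 'a set"
  where "ideal_colon R A B = {r \<in> carrier R. \<forall>b\<in>B. r \<otimes>\<^bsub>R\<^esub> b \<in> A}"


section \<open>Pairs and compatible ideals\<close>

definition reduced_ring :: "('a, 'm) ring_scheme \<Rightarrow> bool"
  where "reduced_ring R \<longleftrightarrow>
    cring R \<and> (\<forall>x\<in>carrier R. \<forall>n::nat. x [^]\<^bsub>R\<^esub> n = \<zero>\<^bsub>R\<^esub> \<longrightarrow> x = \<zero>\<^bsub>R\<^esub>)"

definition minimal_prime :: "('a, 'm) ring_scheme \<Rightarrow> 'a set \<Rightarrow> bool"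
  where "minimal_prime R P \<longleftrightarrow>
    primeideal P R \<and> (\<forall>Q. primeideal Q R \<and> Q \<subseteq> P \<longrightarrow> Q = P)"

text \<open>The set \<open>R\<^sup>\<circ>\<close> of elements in no minimal prime.\<close>

definition ring_circ :: "('a, 'm) ring_scheme \<Rightarrow> 'a set"
  where "ring_circ R = {x \<in> carrier R. \<forall>P. minimal_prime R P \<longrightarrow> x \<notin> P}"

definition graded_system :: "('a, 'm) ring_scheme \<Rightarrow> (nat \<Rightarrow> 'a set) \<Rightarrow> bool"
  where "graded_system R \<aa> \<longleftrightarrow>
    (\<forall>i. ideal (\<aa> i) R) \<and> (\<forall>i j. \<aa> i \<cdot>\<^bsub>R\<^esub> \<aa> j \<subseteq> \<aa> (i + j))"

definition is_pair :: "('a, 'm) ring_scheme \<Rightarrow> (nat \<Rightarrow> 'a set) \<Rightarrow> bool"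
  where "is_pair R \<aa> \<longleftrightarrow>
    reduced_ring R \<and> graded_system R \<aa> \<and> \<aa> 0 = carrier R \<and> (\<forall>i. \<aa> i \<inter> ring_circ R \<noteq> {})"

definition uniformly_compatible ::
    "nat \<Rightarrow> ('a, 'm) ring_scheme \<Rightarrow> (nat \<Rightarrow> 'a set) \<Rightarrow> 'a set \<Rightarrow> bool"
  where "uniformly_compatible p R \<aa> K \<longleftrightarrow>
    ideal K R \<and>
    (\<forall>e>0. \<forall>a\<in>\<aa> (p ^ e - 1).
       \<forall>\<phi>\<in>linear_maps R (frobenius_pushforward p e R (self_module R)) (self_module R).
         \<phi> ` ((\<lambda>x. a \<otimes>\<^bsub>R\<^esub> x) ` K) \<subseteq> K)"

text \<open>For ideals \<open>I \<subseteq> J\<close>, the ideal \<open>J/I\<close> of \<open>R Quot I\<close>.\<close>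

definition quotient_ideal :: "('a, 'm) ring_scheme \<Rightarrow> 'a set \<Rightarrow> 'a set \<Rightarrow> 'a set set"
  where "quotient_ideal R I J = (\<lambda>x. I +>\<^bsub>R\<^esub> x) ` J"

text \<open>The extension of an ideal \<open>A\<close> of \<open>R\<close> to \<open>R Quot I\<close>.\<close>

definition extend_ideal :: "('a, 'm) ring_scheme \<Rightarrow> 'a set \<Rightarrow> 'a set \<Rightarrow> 'a set set"
  where "extend_ideal R I A = Idl\<^bsub>R Quot I\<^esub> ((\<lambda>x. I +>\<^bsub>R\<^esub> x) ` A)"

end

theory Submission
  imports Defs
begin

text \<open>
  Write \<open>R = S/I\<close>, \<open>q = p\<^sup>e\<close>, and call an additive map \<open>\<phi>\<close> on \<open>S\<close> with
  \<open>\<phi>(r\<^sup>q x) = r \<phi>(x)\<close> a Cartier map; these are the linear maps \<open>F\<^sup>e\<^sub>*S \<rightarrow> S\<close>. The proof is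
  Fedder's: everything about \<open>R\<close> is read off from Cartier maps on \<open>S\<close>, and these are controlled by a
  single map locally on \<open>S\<close>.

  Precisely, let \<open>P\<close> be a prime of \<open>S\<close>. The main point (\<open>exists_trace_basis\<close> for \<open>e = 1\<close>,
  \<open>trace_basis_iterate\<close> for all \<open>e\<close>) is that there are \<open>s \<notin> P\<close>, a Cartier map \<open>\<Phi>\<close> and
  elements \<open>c\<^sub>i, x\<^sub>i\<close> of \<open>S\<close> with
  \<open>s\<^sup>q y = \<Sum>\<^sub>i \<Phi>(c\<^sub>i y)\<^sup>q x\<^sub>i\<close> for all \<open>y\<close>. This one identity says both that \<open>F\<^sup>e\<^sub>*S\<close> is
  projective at \<open>P\<close> and that \<open>\<Phi>\<close> generates the Cartier maps at \<open>P\<close>, and it has three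
  consequences, all up to a factor outside \<open>P\<close>:
  \<^item> if \<open>\<Phi>(c y) \<in> K\<close> for all \<open>c\<close>, then \<open>y\<close> lies in the Frobenius power of the ideal \<open>K\<close>;
  \<^item> every Cartier map has the form \<open>\<Phi>(w \<cdot>)\<close>;
  \<^item> every linear map \<open>F\<^sup>e\<^sub>*R \<rightarrow> R\<close> lifts to a Cartier map on \<open>S\<close>, which then preserves \<open>I\<close>.

  By the third point, \<open>J/I\<close> is compatible exactly if every Cartier map \<open>\<phi>\<close> on \<open>S\<close> with
  \<open>\<phi>(I) \<subseteq> I\<close> satisfies \<open>\<phi>(a J) \<subseteq> J\<close> (\<open>quotient_compatible_iff\<close>). By the first two points,
  \<open>\<phi> = \<Phi>(w \<cdot>)\<close> preserves \<open>I\<close> iff \<open>w \<in> (I\<^sup>[\<^sup>q\<^sup>] : I)\<close> and maps \<open>a J\<close> into \<open>J\<close> iff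
  \<open>a w \<in> (J\<^sup>[\<^sup>q\<^sup>] : J)\<close>, locally at each prime; since containment of ideals is a local
  property, this gives the equivalence for every \<open>e > 0\<close> (\<open>fedder_criterion\<close>). For \<open>e = 0\<close> the
  condition on colon ideals is vacuous.

  It remains to produce \<open>\<Phi>\<close> from regularity. The maximal ideal at \<open>P\<close> is generated by \<open>d\<close> elements,
  where \<open>d\<close> is the length of a chain of primes ending in \<open>P\<close>. Krull's principal ideal theorem
  shows that such generators form a regular sequence in every order
  (\<open>regular_seq_if_chain\<close>), and then so do their powers (\<open>regular_seq_powers\<close>). Regularity of
  the sequence of \<open>p\<close>-th powers makes a minimal generating set of \<open>F\<^sub>*S\<close> at \<open>P\<close> a basis
  (\<open>independent_mod_descend\<close>), which is the direction of Kunz's theorem that is used here. Finally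
  \<open>S/P\<^sup>[\<^sup>p\<^sup>]\<close> has a one-dimensional socle at \<open>P\<close> (\<open>socle_generated\<close>), so a coordinate function
  \<open>\<Phi>\<close> that is a unit on the socle generator vanishes on no nonzero ideal of this ring; its bilinear form
  \<open>(x, y) \<mapsto> \<Phi>(x y)\<close> is therefore perfect, and the dual basis provides the \<open>c\<^sub>i\<close>.

  Statements about the local ring at \<open>P\<close> are made in \<open>S\<close> itself: an ideal of the local ring is
  replaced by its contraction, and equality of elements is replaced by equality after
  multiplication by an element outside \<open>P\<close>. The localization as a ring enters only where its
  regularity is translated into these terms (\<open>exists_regular_parameters\<close>).
\<close>

section \<open>Ideals and their saturation at a prime\<close>

context cring
begin

lemma ideal_add_closed: "ideal K R \<Longrightarrow> a \<in> K \<Longrightarrow> b \<in> K \<Longrightarrow> a \<oplus> b \<in> K"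
  by (simp add: additive_subgroup.a_closed ideal.axioms(1))

lemma ideal_minus_closed: "ideal K R \<Longrightarrow> a \<in> K \<Longrightarrow> b \<in> K \<Longrightarrow> a \<ominus> b \<in> K"
  by (simp add: a_minus_def additive_subgroup.a_inv_closed additive_subgroup.a_closed ideal.axioms(1))

lemma ideal_zero_closed: "ideal K R \<Longrightarrow> \<zero> \<in> K"
  by (simp add: additive_subgroup.zero_closed ideal.axioms(1))

lemma idealI_closed:
  assumes "K \<subseteq> carrier R" "\<zero> \<in> K" "\<And>a b. a \<in> K \<Longrightarrow> b \<in> K \<Longrightarrow> a \<oplus> b \<in> K"
    "\<And>a r. a \<in> K \<Longrightarrow> r \<in> carrier R \<Longrightarrow> r \<otimes> a \<in> K"
  shows "ideal K R"
proof (rule idealI)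
  show "subgroup K (add_monoid R)"
  proof (rule add.subgroupI)
    fix a assume a: "a \<in> K"
    then have "\<ominus> a = (\<ominus> \<one>) \<otimes> a" using assms(1) by (auto simp: l_minus)
    then show "\<ominus> a \<in> K" using assms(4)[OF a, of "\<ominus> \<one>"] by simp
  qed (use assms in auto)
  fix a r assume a: "a \<in> K" "r \<in> carrier R"
  then show "r \<otimes> a \<in> K" using assms(4) by auto
  then show "a \<otimes> r \<in> K" using m_comm[of a r] a assms(1) by auto
qed (rule ring_axioms)

text \<open>
  The ideal \<open>K + (x)\<close>. The explicit form of its elements is used more often than its
  minimality.
\<close>

definition adjoin :: "'a set \<Rightarrow> 'a \<Rightarrow> 'a set"
  where "adjoin K x = {k \<oplus> a \<otimes> x | k a. k \<in> K \<and> a \<in> carrier R}"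

text \<open>
  The contraction to \<open>R\<close> of the ideal that \<open>K\<close> generates in the local ring at \<open>P\<close>. The ideals
  fixed by \<open>loc P\<close> correspond to the ideals of the local ring.
\<close>

definition loc :: "'a set \<Rightarrow> 'a set \<Rightarrow> 'a set"
  where "loc P K = {x \<in> carrier R. \<exists>s\<in>carrier R - P. s \<otimes> x \<in> K}"

text \<open>
  Besides \<open>K + (x)\<close> this covers \<open>K + A x\<close> for an ideal \<open>A\<close>, as needed for Nakayama's lemma.
\<close>

lemma scaled_adjoin_ideal:
  assumes "ideal K R" "ideal A R" "x \<in> carrier R"
  shows "ideal {k \<oplus> a \<otimes> x | k a. k \<in> K \<and> a \<in> A} R"
proof (rule idealI_closed)
  note c = ideal.Icarr[OF assms(1)] ideal.Icarr[OF assms(2)]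
  show "{k \<oplus> a \<otimes> x | k a. k \<in> K \<and> a \<in> A} \<subseteq> carrier R"
    using c assms(3) by auto
  show "\<zero> \<in> {k \<oplus> a \<otimes> x | k a. k \<in> K \<and> a \<in> A}"
    using ideal_zero_closed[OF assms(1)] ideal_zero_closed[OF assms(2)] assms(3)
    by (intro CollectI exI[of _ "\<zero>"]) simp
next
  fix u v assume "u \<in> {k \<oplus> a \<otimes> x | k a. k \<in> K \<and> a \<in> A}" "v \<in> {k \<oplus> a \<otimes> x | k a. k \<in> K \<and> a \<in> A}"
  then obtain k a k' a' where u: "u = k \<oplus> a \<otimes> x" "v = k' \<oplus> a' \<otimes> x" and
    m: "k \<in> K" "a \<in> A" "k' \<in> K" "a' \<in> A" by blast
  have cc: "k \<in> carrier R" "a \<in> carrier R" "k' \<in> carrier R" "a' \<in> carrier R"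
    using m ideal.Icarr[OF assms(1)] ideal.Icarr[OF assms(2)] by auto
  have "u \<oplus> v = (k \<oplus> k') \<oplus> (a \<oplus> a') \<otimes> x"
    unfolding u using cc assms(3) by algebra
  then show "u \<oplus> v \<in> {k \<oplus> a \<otimes> x | k a. k \<in> K \<and> a \<in> A}"
    using ideal_add_closed[OF assms(1) m(1,3)] ideal_add_closed[OF assms(2) m(2,4)] by blast
next
  fix u r assume "u \<in> {k \<oplus> a \<otimes> x | k a. k \<in> K \<and> a \<in> A}" and r: "r \<in> carrier R"
  then obtain k a where u: "u = k \<oplus> a \<otimes> x" and m: "k \<in> K" "a \<in> A" by blast
  have cc: "k \<in> carrier R" "a \<in> carrier R"
    using m ideal.Icarr[OF assms(1)] ideal.Icarr[OF assms(2)] by auto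
  have "r \<otimes> u = (r \<otimes> k) \<oplus> (r \<otimes> a) \<otimes> x"
    unfolding u using cc r assms(3) by algebra
  then show "r \<otimes> u \<in> {k \<oplus> a \<otimes> x | k a. k \<in> K \<and> a \<in> A}"
    using ideal.I_l_closed[OF assms(1) m(1) r] ideal.I_l_closed[OF assms(2) m(2) r] by blast
qed

lemma adjoin_ideal: "ideal K R \<Longrightarrow> x \<in> carrier R \<Longrightarrow> ideal (adjoin K x) R"
  unfolding adjoin_def by (rule scaled_adjoin_ideal[OF _ oneideal])

lemma adjoin_incl: assumes "ideal K R" "x \<in> carrier R" shows "K \<subseteq> adjoin K x"
proof
  fix k assume k: "k \<in> K"
  then have "k = k \<oplus> \<zero> \<otimes> x" using assms ideal.Icarr[OF assms(1)] by simp
  then show "k \<in> adjoin K x" unfolding adjoin_def using k by blast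
qed

lemma adjoin_mem: assumes "ideal K R" "x \<in> carrier R" shows "x \<in> adjoin K x"
proof -
  have "x = \<zero> \<oplus> \<one> \<otimes> x" using assms by simp
  then show "x \<in> adjoin K x" unfolding adjoin_def using ideal_zero_closed[OF assms(1)] by blast
qed

lemma adjoin_least: assumes "ideal L R" "K \<subseteq> L" "x \<in> L" shows "adjoin K x \<subseteq> L"
  unfolding adjoin_def using assms ideal_add_closed[OF assms(1)] ideal.I_l_closed[OF assms(1)] by blast

lemma adjoinE:
  assumes "y \<in> adjoin K x"
  obtains k a where "k \<in> K" "a \<in> carrier R" "y = k \<oplus> a \<otimes> x"
  using assms unfolding adjoin_def by blast

lemma adjoinI: "k \<in> K \<Longrightarrow> a \<in> carrier R \<Longrightarrow> k \<oplus> a \<otimes> x \<in> adjoin K x"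
  unfolding adjoin_def by blast

lemma adjoin_eq_Idl:
  assumes "G \<subseteq> carrier R" "x \<in> carrier R" shows "adjoin (Idl G) x = Idl (insert x G)"
proof
  have i: "ideal (Idl G) R" "ideal (Idl (insert x G)) R" using assms by (auto intro: genideal_ideal)
  show "adjoin (Idl G) x \<subseteq> Idl (insert x G)"
    using assms genideal_self[of "insert x G"]
    by (intro adjoin_least i subset_Idl_subset) auto
  show "Idl (insert x G) \<subseteq> adjoin (Idl G) x"
    using adjoin_ideal[OF i(1) assms(2)] adjoin_incl[OF i(1) assms(2)] adjoin_mem[OF i(1) assms(2)]
       genideal_self[OF assms(1)] by (intro genideal_minimal) auto
qed

lemma prime_compl_mult:
  assumes "primeideal P R" "s \<in> carrier R - P" "t \<in> carrier R - P"
  shows "s \<otimes> t \<in> carrier R - P"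
  using assms primeideal.I_prime[OF assms(1), of s t] by auto

lemma prime_compl_one: assumes "primeideal P R" shows "\<one> \<in> carrier R - P"
  using ideal.one_imp_carrier primeideal.I_notcarr[OF assms] primeideal.axioms(1)[OF assms] by blast

lemma prime_compl_pow:
  assumes "primeideal P R" "s \<in> carrier R - P"
  shows "s [^] (n::nat) \<in> carrier R - P"
proof (induction n)
  case (Suc n) then show ?case using prime_compl_mult[OF assms(1) Suc assms(2)] by simp
qed (use prime_compl_one[OF assms(1)] in simp)

lemma loc_ideal: assumes "primeideal P R" "ideal K R" shows "ideal (loc P K) R"
proof (rule idealI_closed)
  show "\<zero> \<in> loc P K" using prime_compl_one[OF assms(1)] ideal_zero_closed[OF assms(2)]
    by (auto simp: loc_def)
next
  fix a b assume "a \<in> loc P K" "b \<in> loc P K"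
  then obtain s t where ab: "a \<in> carrier R" "b \<in> carrier R" and
    st: "s \<in> carrier R - P" "t \<in> carrier R - P" "s \<otimes> a \<in> K" "t \<otimes> b \<in> K" by (auto simp: loc_def)
  have c: "s \<in> carrier R" "t \<in> carrier R" using st by auto
  have "(s \<otimes> t) \<otimes> (a \<oplus> b) = t \<otimes> (s \<otimes> a) \<oplus> s \<otimes> (t \<otimes> b)" using ab c by algebra
  also have "\<dots> \<in> K"
    using ideal_add_closed[OF assms(2) ideal.I_l_closed[OF assms(2) st(3) c(2)] ideal.I_l_closed[OF assms(2) st(4) c(1)]] .
  finally show "a \<oplus> b \<in> loc P K" using prime_compl_mult[OF assms(1) st(1,2)] ab by (auto simp: loc_def)
next
  fix a r assume "a \<in> loc P K" and r: "r \<in> carrier R"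
  then obtain s where ab: "a \<in> carrier R" and
    st: "s \<in> carrier R - P" "s \<otimes> a \<in> K" by (auto simp: loc_def)
  have c: "s \<in> carrier R" using st by auto
  have "s \<otimes> (r \<otimes> a) = r \<otimes> (s \<otimes> a)" using r ab c by algebra
  also have "\<dots> \<in> K" using ideal.I_l_closed[OF assms(2) st(2) r] .
  finally show "r \<otimes> a \<in> loc P K" using st(1) ab r by (auto simp: loc_def)
qed (auto simp: loc_def)

lemma loc_carrier: "loc P K \<subseteq> carrier R" by (auto simp: loc_def)

lemma locI: "s \<in> carrier R - P \<Longrightarrow> x \<in> carrier R \<Longrightarrow> s \<otimes> x \<in> K \<Longrightarrow> x \<in> loc P K"
  by (auto simp: loc_def)

lemma locE: assumes "x \<in> loc P K" obtains s where "s \<in> carrier R - P" "x \<in> carrier R" "s \<otimes> x \<in> K"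
  using assms by (auto simp: loc_def)

lemma loc_incl: assumes "primeideal P R" "ideal K R" shows "K \<subseteq> loc P K"
  using prime_compl_one[OF assms(1)] ideal.Icarr[OF assms(2)]
  by (auto simp: loc_def intro!: bexI[of _ \<one>])

lemma loc_mono: "K \<subseteq> L \<Longrightarrow> loc P K \<subseteq> loc P L" by (auto simp: loc_def)

lemma loc_cancel:
  assumes "primeideal P R" "s \<in> carrier R - P" "x \<in> carrier R" "s \<otimes> x \<in> loc P K"
  shows "x \<in> loc P K"
proof -
  obtain t where t: "t \<in> carrier R - P" "t \<otimes> (s \<otimes> x) \<in> K" using assms(4) by (auto simp: loc_def)
  have "t \<otimes> (s \<otimes> x) = (t \<otimes> s) \<otimes> x" using t assms by (simp add: m_assoc)
  then show ?thesis using t prime_compl_mult[OF assms(1) t(1) assms(2)] assms(3) by (auto simp: loc_def)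
qed

lemma loc_le: assumes "primeideal P R" "K \<subseteq> loc P L" shows "loc P K \<subseteq> loc P L"
proof
  fix x assume "x \<in> loc P K"
  then obtain s where "s \<in> carrier R - P" "x \<in> carrier R" "s \<otimes> x \<in> K" by (rule locE)
  then show "x \<in> loc P L" using loc_cancel[OF assms(1)] assms(2) by blast
qed

lemma loc_loc: assumes "primeideal P R" "ideal K R" shows "loc P (loc P K) = loc P K"
  using loc_le[OF assms(1), of "loc P K" K] loc_incl[OF assms(1) loc_ideal[OF assms]] by auto

lemma loc_adjoin_le:
  assumes "primeideal P R" "ideal L R" "K \<subseteq> loc P L" "x \<in> loc P L"
  shows "loc P (adjoin K x) \<subseteq> loc P L"
  using assms by (intro loc_le adjoin_least loc_ideal)

lemma loc_prime:
  assumes "Q \<subseteq> P" "primeideal P R" "primeideal Q R" shows "loc P Q = Q"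
proof
  show "Q \<subseteq> loc P Q" using loc_incl assms primeideal.axioms(1) by blast
  show "loc P Q \<subseteq> Q" using primeideal.I_prime[OF assms(3)] assms(1) by (auto elim!: locE)
qed

end

section \<open>Nakayama's lemma and existence of primes\<close>

locale noetherian_cring = cring R + noetherian_ring R for R (structure)
begin

text \<open>
  Nakayama's lemma in the local ring at \<open>P\<close>, for a finitely generated ideal \<open>K\<close>: if \<open>K\<close> is
  contained in \<open>L + P K\<close> locally, then it is contained in \<open>L\<close> locally. The generators of \<open>K\<close> are
  discarded one at a time. If \<open>K\<close> lies in \<open>N + (g)\<close> and \<open>g \<in> K\<close>, then the hypothesis puts \<open>g\<close>
  into \<open>N + P g\<close>, hence a multiple of \<open>g\<close> by an element outside \<open>P\<close> into \<open>N\<close>.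
\<close>

lemma nakayama:
  assumes P: "primeideal P R" and K: "ideal K R" and L: "ideal L R"
    and sub: "\<And>k. k \<in> K \<Longrightarrow> \<exists>l\<in>L. \<exists>w\<in>P \<cdot> K. \<exists>s\<in>carrier R - P. s \<otimes> k = l \<oplus> w"
  shows "K \<subseteq> loc P L"
proof -
  have Pi: "ideal P R" using P primeideal.axioms(1) by blast
  have step: "finite G \<Longrightarrow> G \<subseteq> K \<Longrightarrow> K \<subseteq> loc P (Idl (L \<union> G)) \<Longrightarrow> K \<subseteq> loc P L" for G
  proof (induction G rule: finite_induct)
    case empty
    have "Idl L \<subseteq> L" using L by (intro genideal_minimal) auto
    then show ?case using empty loc_mono[of "Idl L" L P] by auto
  next
    case (insert g G)
    define N where "N = Idl (L \<union> G)"
    have LG: "L \<union> G \<subseteq> carrier R" using ideal.Icarr[OF L] ideal.Icarr[OF K] insert by auto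
    have N: "ideal N R" unfolding N_def using LG by (rule genideal_ideal)
    have LN: "L \<subseteq> N" using genideal_self[OF LG] N_def by auto
    have g: "g \<in> K" "g \<in> carrier R" using insert ideal.Icarr[OF K] by auto
    have Kadj: "K \<subseteq> loc P (adjoin N g)"
      using insert.prems(2) adjoin_eq_Idl[OF LG g(2)] by (simp add: N_def)
    \<comment> \<open>\<open>P K\<close> lies locally in \<open>W = N + P g\<close>\<close>
    define W where "W = {n \<oplus> p \<otimes> g | n p. n \<in> N \<and> p \<in> P}"
    have W: "ideal W R" unfolding W_def using scaled_adjoin_ideal[OF N Pi g(2)] .
    have NW: "N \<subseteq> W"
    proof
      fix n assume n: "n \<in> N"
      have "n = n \<oplus> \<zero> \<otimes> g" using n g ideal.Icarr[OF N] by simp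
      then show "n \<in> W" unfolding W_def using n ideal_zero_closed[OF Pi] by blast
    qed
    have PK: "w \<in> P \<cdot> K \<Longrightarrow> w \<in> loc P W" for w
    proof (induction w rule: ideal_prod.induct)
      case (prod p k)
      obtain s where s: "s \<in> carrier R - P" "s \<otimes> k \<in> adjoin N g" and k: "k \<in> carrier R"
        using Kadj prod by (auto elim!: locE)
      then obtain n a where na: "n \<in> N" "a \<in> carrier R" "s \<otimes> k = n \<oplus> a \<otimes> g" by (auto elim!: adjoinE)
      have c: "n \<in> carrier R" "p \<in> carrier R" "s \<in> carrier R" using na prod s ideal.Icarr[OF N] ideal.Icarr[OF Pi] by auto
      have "s \<otimes> (p \<otimes> k) = p \<otimes> (s \<otimes> k)" using c k by algebra
      also have "\<dots> = (p \<otimes> n) \<oplus> (p \<otimes> a) \<otimes> g" unfolding na using c k na(2) g(2) by algebra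
      also have "\<dots> \<in> W" unfolding W_def using ideal.I_l_closed[OF N na(1) c(2)] ideal.I_r_closed[OF Pi prod(1) na(2)]
        by blast
      finally show ?case using s c k by (intro locI[of s]) auto
    next
      case (sum a b) then show ?case using ideal_add_closed[OF loc_ideal[OF P W]] by blast
    qed
    obtain l w s where lw: "l \<in> L" "w \<in> P \<cdot> K" "s \<in> carrier R - P" "s \<otimes> g = l \<oplus> w"
      using sub[OF g(1)] by blast
    have "s \<otimes> g \<in> loc P W" unfolding lw(4)
      using PK[OF lw(2)] lw(1) LN NW loc_incl[OF P W] ideal_add_closed[OF loc_ideal[OF P W]] by blast
    then have "g \<in> loc P W" using loc_cancel[OF P lw(3) g(2)] by blast
    then obtain t where t: "t \<in> carrier R - P" "t \<otimes> g \<in> W" by (auto elim!: locE)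
    then obtain n p where np: "n \<in> N" "p \<in> P" "t \<otimes> g = n \<oplus> p \<otimes> g" unfolding W_def by blast
    have c: "t \<in> carrier R" "n \<in> carrier R" "p \<in> carrier R" using t np ideal.Icarr[OF N] ideal.Icarr[OF Pi] by auto
    have "(t \<ominus> p) \<otimes> g = t \<otimes> g \<ominus> p \<otimes> g" using c g(2) by algebra
    also have "\<dots> = n" unfolding np(3) using c g(2) by algebra
    finally have e: "(t \<ominus> p) \<otimes> g = n" .
    have "t \<ominus> p \<notin> P"
    proof
      assume "t \<ominus> p \<in> P"
      then have "(t \<ominus> p) \<oplus> p \<in> P" using np ideal_add_closed[OF Pi] by blast
      moreover have "(t \<ominus> p) \<oplus> p = t" using c by algebra
      ultimately show False using t by simp
    qed
    then have "g \<in> loc P N" using e np c g by (intro locI[of "t \<ominus> p"]) auto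
    then have "loc P (adjoin N g) \<subseteq> loc P N" using loc_incl[OF P N] by (intro loc_adjoin_le[OF P N])
    then show ?case using insert Kadj unfolding N_def by blast
  qed
  obtain G where G: "G \<subseteq> carrier R" "finite G" "K = Idl G" using finetely_gen[OF K] by blast
  have GK: "G \<subseteq> K" using genideal_self[OF G(1)] G by simp
  have LG: "L \<union> G \<subseteq> carrier R" using ideal.Icarr[OF L] G by auto
  have "K \<subseteq> Idl (L \<union> G)" unfolding G(3) using LG by (intro subset_Idl_subset) auto
  also have "\<dots> \<subseteq> loc P (Idl (L \<union> G))" using loc_incl[OF P genideal_ideal[OF LG]] .
  finally show ?thesis using step[OF G(2) GK] by blast
qed

lemma exists_maximal_ideal_in:
  assumes "\<C> \<noteq> {}" "\<And>K. K \<in> \<C> \<Longrightarrow> ideal K R"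
  shows "\<exists>M\<in>\<C>. \<forall>K\<in>\<C>. M \<subseteq> K \<longrightarrow> K = M"
proof -
  have "\<exists>M\<in>\<C>. \<forall>X\<in>\<C>. M \<subseteq> X \<longrightarrow> X = M"
  proof (rule subset_Zorn)
    fix C assume C: "subset.chain \<C> C"
    show "\<exists>U\<in>\<C>. \<forall>X\<in>C. X \<subseteq> U"
    proof (cases "C = {}")
      case False
      have "subset.chain {I. ideal I R} C" using C assms(2) by (auto simp: subset.chain_def)
      then have "\<Union> C \<in> C" using ideal_chain_is_trivial[OF False] by blast
      then show ?thesis using C by (auto simp: subset.chain_def)
    qed (use assms(1) in auto)
  qed
  then show ?thesis .
qed

lemma exists_prime_avoiding:
  assumes K: "ideal K R" and M: "M \<subseteq> carrier R" "M \<noteq> {}" "\<And>a b. a \<in> M \<Longrightarrow> b \<in> M \<Longrightarrow> a \<otimes> b \<in> M"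
    and disj: "K \<inter> M = {}"
  shows "\<exists>Q. primeideal Q R \<and> K \<subseteq> Q \<and> Q \<inter> M = {}"
proof -
  define \<C> where "\<C> = {X. ideal X R \<and> K \<subseteq> X \<and> X \<inter> M = {}}"
  have "K \<in> \<C>" using K disj by (simp add: \<C>_def)
  moreover have ideals: "\<And>X. X \<in> \<C> \<Longrightarrow> ideal X R" by (simp add: \<C>_def)
  ultimately obtain Q where QC: "Q \<in> \<C>" and Qmax: "\<forall>X\<in>\<C>. Q \<subseteq> X \<longrightarrow> X = Q"
    using exists_maximal_ideal_in[of \<C>, OF _ ideals] by blast
  have Q: "ideal Q R" "K \<subseteq> Q" "Q \<inter> M = {}" using QC by (simp_all add: \<C>_def)
  have max: "X = Q" if "ideal X R" "K \<subseteq> X" "X \<inter> M = {}" "Q \<subseteq> X" for X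
    using Qmax that by (simp add: \<C>_def)
  have key: "\<exists>m\<in>M. \<exists>q\<in>Q. \<exists>r\<in>carrier R. m = q \<oplus> r \<otimes> a" if a: "a \<in> carrier R" "a \<notin> Q" for a
  proof -
    have "adjoin Q a \<inter> M \<noteq> {}"
    proof
      assume "adjoin Q a \<inter> M = {}"
      then have "adjoin Q a = Q"
        using max[OF adjoin_ideal[OF Q(1) a(1)]] adjoin_incl[OF Q(1) a(1)] Q by blast
      then show False using adjoin_mem[OF Q(1) a(1)] a by simp
    qed
    then show ?thesis by (auto elim!: adjoinE)
  qed
  have "primeideal Q R"
  proof (rule primeidealI[OF Q(1) cring_axioms])
    show "carrier R \<noteq> Q" using Q(3) M by auto
    fix a b assume ab: "a \<in> carrier R" "b \<in> carrier R" "a \<otimes> b \<in> Q"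
    show "a \<in> Q \<or> b \<in> Q"
    proof (rule ccontr)
      assume "\<not> (a \<in> Q \<or> b \<in> Q)"
      then obtain m q r m' q' r' where m: "m \<in> M" "q \<in> Q" "r \<in> carrier R" "m = q \<oplus> r \<otimes> a"
        and m': "m' \<in> M" "q' \<in> Q" "r' \<in> carrier R" "m' = q' \<oplus> r' \<otimes> b"
        using key[of a] key[of b] ab by blast
      have c: "q \<in> carrier R" "q' \<in> carrier R" using m m' ideal.Icarr[OF Q(1)] by auto
      have "m \<otimes> m' = (m' \<otimes> q \<oplus> (r \<otimes> a) \<otimes> q') \<oplus> (r \<otimes> r') \<otimes> (a \<otimes> b)"
        unfolding m(4) m'(4) using c m(3) m'(3) ab(1,2) by algebra
      also have "\<dots> \<in> Q"
      proof -
        have "m' \<in> carrier R" "r \<otimes> a \<in> carrier R" "r \<otimes> r' \<in> carrier R"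
          using m'(1) M(1) m(3) m'(3) ab by auto
        then show ?thesis
          using m(2) m'(2) ab(3) by (simp add: ideal_add_closed[OF Q(1)] ideal.I_l_closed[OF Q(1)])
      qed
      finally show False using M(3)[OF m(1) m'(1)] Q(3) by auto
    qed
  qed
  then show ?thesis using Q by blast
qed

lemma exists_prime_above:
  assumes "ideal K R" "K \<noteq> carrier R" shows "\<exists>Q. primeideal Q R \<and> K \<subseteq> Q"
proof -
  have "\<one> \<notin> K" using ideal.one_imp_carrier assms by blast
  then show ?thesis using exists_prime_avoiding[OF assms(1), of "{\<one>}"] by auto
qed

text \<open>
  Otherwise the colon ideal \<open>(K : x)\<close> is proper and lies in some prime \<open>P\<close>, where membership
  fails.
\<close>

lemma mem_ideal_if_locally:
  assumes K: "ideal K R" and x: "x \<in> carrier R"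
    and loc: "\<And>P. primeideal P R \<Longrightarrow> x \<in> loc P K"
  shows "x \<in> K"
proof (rule ccontr)
  assume nx: "x \<notin> K"
  let ?C = "{r \<in> carrier R. x \<otimes> r \<in> K}"
  have C: "ideal ?C R" using ideal.helper_max_prime[OF K cring_axioms x] .
  have "\<one> \<notin> ?C" using nx x by simp
  then have "?C \<noteq> carrier R" using one_closed by blast
  then obtain P where P: "primeideal P R" "?C \<subseteq> P" using exists_prime_above[OF C] by blast
  obtain s where "s \<in> carrier R - P" "s \<otimes> x \<in> K" using loc[OF P(1)] by (auto elim!: locE)
  then show False using P(2) x m_comm[of s x] by auto
qed

section \<open>Krull's principal ideal theorem\<close>

text \<open>
  The descending chain condition in the local ring at \<open>P\<close> for the ideals between \<open>Y\<close> and \<open>X\<close>. It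
  plays the role of finite length of \<open>X/Y\<close>.
\<close>

definition dcc_between :: "'a set \<Rightarrow> 'a set \<Rightarrow> 'a set \<Rightarrow> bool"
  where "dcc_between P Y X \<longleftrightarrow>
    (\<forall>K :: nat \<Rightarrow> 'a set. (\<forall>n. ideal (K n) R \<and> Y \<subseteq> K n \<and> K n \<subseteq> X \<and> loc P (K n) = K n) \<and> decseq K
       \<longrightarrow> (\<exists>N. \<forall>n\<ge>N. K n = K N))"

text \<open>
  The usual argument for extensions of artinian modules: a chain \<open>K n\<close> between \<open>Z\<close> and \<open>X\<close> is
  determined by \<open>K n \<inter> Y\<close> and \<open>K n + Y\<close>, by the modular law.
\<close>

lemma dcc_between_trans:
  assumes P: "primeideal P R" and Y: "ideal Y R" "loc P Y = Y" and ZY: "Z \<subseteq> Y" and YX: "Y \<subseteq> X"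
    and X: "ideal X R" "loc P X = X"
    and dY: "dcc_between P Z Y" and dX: "dcc_between P Y X"
  shows "dcc_between P Z X"
  unfolding dcc_between_def
proof (intro allI impI, elim conjE)
  fix K :: "nat \<Rightarrow> 'a set"
  assume K: "\<forall>n. ideal (K n) R \<and> Z \<subseteq> K n \<and> K n \<subseteq> X \<and> loc P (K n) = K n" and dec: "decseq K"
  define A where "A n = K n \<inter> Y" for n
  define B where "B n = loc P (K n <+>\<^bsub>R\<^esub> Y)" for n
  have Ki: "ideal (K n) R" and KZ: "Z \<subseteq> K n" and KX: "K n \<subseteq> X" and Ks: "loc P (K n) = K n" for n
    using K by simp_all
  have KC: "x \<in> K n \<Longrightarrow> x \<in> carrier R" for x n using ideal.Icarr[OF Ki] .
  have decm: "m \<le> n \<Longrightarrow> K n \<subseteq> K m" for m n using dec by (simp add: decseq_def)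
  have sumi: "ideal (K n <+> Y) R" for n using add_ideals[OF Ki Y(1)] .
  have "\<exists>N. \<forall>n\<ge>N. A n = A N"
  proof -
    have "loc P (A n) = A n" for n
    proof
      have "loc P (A n) \<subseteq> loc P (K n)" "loc P (A n) \<subseteq> loc P Y" by (intro loc_mono, simp add: A_def)+
      then show "loc P (A n) \<subseteq> A n" using Ks[of n] Y(2) by (simp add: A_def)
      show "A n \<subseteq> loc P (A n)" using loc_incl[OF P i_intersect[OF Ki Y(1)]] by (simp add: A_def)
    qed
    moreover have "decseq A" unfolding decseq_def A_def using decm by blast
    moreover have "ideal (A n) R" "Z \<subseteq> A n" "A n \<subseteq> Y" for n
      using i_intersect[OF Ki Y(1)] KZ ZY by (auto simp: A_def)
    ultimately show ?thesis by (intro dY[unfolded dcc_between_def, rule_format]) simp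
  qed
  then obtain N1 where N1: "\<And>n. n \<ge> N1 \<Longrightarrow> A n = A N1" by blast
  have Ksub: "K n \<subseteq> K n <+> Y" and Ysub: "Y \<subseteq> K n <+> Y" for n
  proof -
    show "K n \<subseteq> K n <+> Y"
      using ideal_zero_closed[OF Y(1)] KC by (force simp: set_add_def')
    show "Y \<subseteq> K n <+> Y"
      using ideal_zero_closed[OF Ki[of n]] ideal.Icarr[OF Y(1)] by (force simp: set_add_def')
  qed
  have "\<exists>N. \<forall>n\<ge>N. B n = B N"
  proof (intro dX[unfolded dcc_between_def, rule_format] conjI allI)
    fix n
    show "ideal (B n) R" unfolding B_def using loc_ideal[OF P sumi] .
    show "Y \<subseteq> B n" unfolding B_def using Ysub loc_incl[OF P sumi] by blast
    have "K n <+> Y \<subseteq> X" using KX[of n] YX ideal_add_closed[OF X(1)] by (fastforce simp: set_add_def')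
    from loc_mono[OF this, of P] show "B n \<subseteq> X" unfolding B_def X(2) .
    show "loc P (B n) = B n" unfolding B_def using loc_loc[OF P sumi] .
  next
    show "decseq B" unfolding decseq_def B_def
    proof (intro allI impI loc_mono)
      fix m n :: nat assume "m \<le> n"
      then show "K n <+>\<^bsub>R\<^esub> Y \<subseteq> K m <+>\<^bsub>R\<^esub> Y" using decm[of m n] unfolding set_add_def' by blast
    qed
  qed
  then obtain N2 where N2: "\<And>n. n \<ge> N2 \<Longrightarrow> B n = B N2" by blast
  define N where "N = max N1 N2"
  show "\<exists>N. \<forall>n\<ge>N. K n = K N"
  proof (intro exI allI impI)
    fix n assume n: "n \<ge> N"
    have AB: "A n = A N" "B n = B N" using N1[of n] N1[of N] N2[of n] N2[of N] n by (auto simp: N_def)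
    show "K n = K N"
    proof
      show "K n \<subseteq> K N" using decm n .
      show "K N \<subseteq> K n"
      proof
        fix k assume k: "k \<in> K N"
        then have "k \<in> B N" using Ksub[of N] loc_incl[OF P sumi[of N]] unfolding B_def by blast
        then have "k \<in> B n" using AB(2) by simp
        then obtain s where s: "s \<in> carrier R - P" "s \<otimes> k \<in> K n <+> Y" unfolding B_def by (rule locE)
        then obtain k' y where ky: "k' \<in> K n" "y \<in> Y" "s \<otimes> k = k' \<oplus> y" by (auto simp: set_add_def')
        have c: "k \<in> carrier R" "k' \<in> carrier R" "y \<in> carrier R" "s \<in> carrier R"
          using k ky KC s ideal.Icarr[OF Y(1)] by auto
        have "y = s \<otimes> k \<ominus> k'" unfolding ky(3) using c by algebra
        moreover have "s \<otimes> k \<in> K N" using ideal.I_l_closed[OF Ki k c(4)] .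
        moreover have "k' \<in> K N" using ky(1) decm[OF n] by blast
        ultimately have "y \<in> K N" using ideal_minus_closed[OF Ki] by simp
        then have "y \<in> A N" using ky(2) by (simp add: A_def)
        then have "y \<in> A n" using AB(1) by simp
        then have "y \<in> K n" by (simp add: A_def)
        then have "s \<otimes> k \<in> K n" unfolding ky(3) using ideal_add_closed[OF Ki ky(1)] by blast
        then have "k \<in> loc P (K n)" using locI[OF s(1) c(1)] by blast
        then show "k \<in> K n" using Ks[of n] by simp
      qed
    qed
  qed
qed

text \<open>
  Here \<open>(Y + (z))/Y\<close> is locally a quotient of the residue field, so nothing lies strictly
  between.
\<close>

lemma dcc_between_simple:
  assumes P: "primeideal P R" and Y: "ideal Y R" "loc P Y = Y" and z: "z \<in> carrier R"
    and Pz: "\<And>p. p \<in> P \<Longrightarrow> p \<otimes> z \<in> Y"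
  shows "dcc_between P Y (loc P (adjoin Y z))"
  unfolding dcc_between_def
proof (intro allI impI, elim conjE)
  fix K :: "nat \<Rightarrow> 'a set"
  assume K: "\<forall>n. ideal (K n) R \<and> Y \<subseteq> K n \<and> K n \<subseteq> loc P (adjoin Y z) \<and> loc P (K n) = K n" and dec: "decseq K"
  have Ki: "ideal (K n) R" and KY: "Y \<subseteq> K n" and KX: "K n \<subseteq> loc P (adjoin Y z)" and Ks: "loc P (K n) = K n" for n
    using K by simp_all
  have decm: "m \<le> n \<Longrightarrow> K n \<subseteq> K m" for m n using dec by (simp add: decseq_def)
  have dich: "K n = Y \<or> K n = loc P (adjoin Y z)" for n
  proof (rule disjCI)
    assume "K n \<noteq> loc P (adjoin Y z)"
    moreover have "loc P (adjoin Y z) \<subseteq> K n" if "z \<in> K n"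
      using loc_mono[OF adjoin_least[OF Ki KY that], of P] Ks[of n] by simp
    ultimately have nz: "z \<notin> K n" using KX[of n] by blast
    have "K n \<subseteq> Y"
    proof
      fix k assume k: "k \<in> K n"
      then obtain s where s: "s \<in> carrier R - P" "s \<otimes> k \<in> adjoin Y z" and kc: "k \<in> carrier R"
        using KX[of n] by (blast elim: locE)
      then obtain y a where ya: "y \<in> Y" "a \<in> carrier R" "s \<otimes> k = y \<oplus> a \<otimes> z" by (auto elim!: adjoinE)
      have c: "y \<in> carrier R" "s \<in> carrier R" using ya s ideal.Icarr[OF Y(1)] by auto
      have "a \<otimes> z = s \<otimes> k \<ominus> y" unfolding ya(3) using c ya(2) z by algebra
      also have "\<dots> \<in> K n" using ideal_minus_closed[OF Ki ideal.I_l_closed[OF Ki k c(2)]] ya(1) KY[of n] by blast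
      finally have "a \<otimes> z \<in> K n" .
      then have "a \<in> P" using nz locI[of a P z "K n"] ya(2) z Ks[of n] by blast
      then have "s \<otimes> k \<in> Y" unfolding ya(3) using Pz ya(1) ideal_add_closed[OF Y(1)] by blast
      then show "k \<in> Y" using locI[OF s(1) kc] Y(2) by blast
    qed
    then show "K n = Y" using KY[of n] by blast
  qed
  show "\<exists>N. \<forall>n\<ge>N. K n = K N"
  proof (cases "\<exists>N. K N = Y")
    case True
    then obtain N where "K N = Y" by blast
    then have "\<forall>n\<ge>N. K n = K N" using KY decm[of N] by blast
    then show ?thesis by blast
  next
    case False
    then show ?thesis using dich by metis
  qed
qed

text \<open>
  If \<open>P\<close> is minimal over \<open>Y\<close>, then the submodule that \<open>z0\<close> generates modulo \<open>Y\<close> meets the socle.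
  Among the multiples of \<open>z0\<close> outside \<open>Y\<close> choose one whose annihilator modulo \<open>Y\<close> is maximal;
  such an annihilator is prime, and minimality forces it to be \<open>P\<close>.
\<close>

lemma exists_socle_multiple:
  assumes P: "primeideal P R" and Y: "ideal Y R" "loc P Y = Y" and z0: "z0 \<in> carrier R" "z0 \<notin> Y"
    and min: "\<And>Q. primeideal Q R \<Longrightarrow> Y \<subseteq> Q \<Longrightarrow> Q \<subseteq> P \<Longrightarrow> Q = P"
  shows "\<exists>c\<in>carrier R. c \<otimes> z0 \<notin> Y \<and> (\<forall>p\<in>P. p \<otimes> (c \<otimes> z0) \<in> Y)"
proof -
  define A where "A = {c \<otimes> z0 | c. c \<in> carrier R} - Y"
  have Ac: "A \<subseteq> carrier R" using z0 by (auto simp: A_def)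
  have "\<one> \<otimes> z0 \<in> A" unfolding A_def using z0 by (intro DiffI CollectI exI[of _ "\<one>"]) simp_all
  then have Ane: "A \<noteq> {}" by blast
  have Amult: "a \<otimes> b \<in> A" if ab: "a \<in> A" "b \<in> carrier R" "a \<otimes> b \<notin> Y" for a b
  proof -
    obtain c where c: "c \<in> carrier R" "a = c \<otimes> z0" using ab(1) unfolding A_def by blast
    then have "a \<otimes> b = (c \<otimes> b) \<otimes> z0" using ab(2) z0(1) by (simp add: m_ac)
    then show ?thesis using ab c unfolding A_def by blast
  qed
  define C where "C z = {r \<in> carrier R. z \<otimes> r \<in> Y}" for z
  have Ci: "z \<in> carrier R \<Longrightarrow> ideal (C z) R" for z
    unfolding C_def using ideal.helper_max_prime[OF Y(1) cring_axioms] .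
  obtain M where M: "M \<in> C ` A"
    and Mmax: "\<forall>K\<in>C ` A. M \<subseteq> K \<longrightarrow> K = M"
  proof (rule bexE)
    show "\<exists>M\<in>C ` A. \<forall>K\<in>C ` A. M \<subseteq> K \<longrightarrow> K = M"
    proof (rule exists_maximal_ideal_in)
    show "C ` A \<noteq> {}" using Ane by blast
    qed (use Ci Ac in blast)
  qed blast
  obtain z where zA: "z \<in> A" and Mz: "M = C z" using M by blast
  then have z: "z \<in> carrier R" "z \<notin> Y" using Ac by (auto simp: A_def)
  have max: "C w = C z" if "w \<in> A" "C z \<subseteq> C w" for w
    using Mmax that unfolding Mz by simp
  have "primeideal (C z) R"
  proof (rule primeidealI[OF Ci[OF z(1)] cring_axioms])
    have "\<one> \<notin> C z" using z by (simp add: C_def)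
    then show "carrier R \<noteq> C z" using one_closed by blast
    fix a b assume ab: "a \<in> carrier R" "b \<in> carrier R" "a \<otimes> b \<in> C z"
    show "a \<in> C z \<or> b \<in> C z"
    proof (rule disjCI)
      assume "b \<notin> C z"
      then have zb: "z \<otimes> b \<notin> Y" using ab by (auto simp: C_def)
      have "C z \<subseteq> C (z \<otimes> b)"
      proof
        fix r assume r: "r \<in> C z"
        then have "b \<otimes> (z \<otimes> r) \<in> Y" using ideal.I_l_closed[OF Y(1) _ ab(2)] by (simp add: C_def)
        moreover have "b \<otimes> (z \<otimes> r) = z \<otimes> b \<otimes> r"
        proof -
          have "r \<in> carrier R" using r by (auto simp: C_def)
          then show ?thesis using ab(2) z(1) by algebra
        qed
        ultimately show "r \<in> C (z \<otimes> b)" using r by (auto simp: C_def)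
      qed
      then have "C (z \<otimes> b) = C z" using max[OF Amult[OF zA ab(2) zb]] by blast
      moreover have "a \<in> C (z \<otimes> b)"
      proof -
        have "z \<otimes> b \<otimes> a = z \<otimes> (a \<otimes> b)" using ab(1,2) z(1) by algebra
        then show ?thesis using ab by (auto simp: C_def)
      qed
      ultimately show "a \<in> C z" by simp
    qed
  qed
  moreover have "Y \<subseteq> C z" using ideal.I_l_closed[OF Y(1)] ideal.Icarr[OF Y(1)] z by (auto simp: C_def)
  moreover have "C z \<subseteq> P"
  proof
    fix s assume s: "s \<in> C z"
    show "s \<in> P"
    proof (rule ccontr)
      assume "s \<notin> P"
      then have "z \<in> loc P Y" using s z m_comm[of s z] by (intro locI[of s]) (auto simp: C_def)
      then show False using Y z by simp
    qed
  qed
  ultimately have CP: "C z = P" using min by blast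
  obtain c where c: "c \<in> carrier R" "z = c \<otimes> z0" using zA by (auto simp: A_def)
  have "q \<otimes> z \<in> Y" if "q \<in> P" for q
    using that z(1) m_comm[of q z] unfolding CP[symmetric] C_def by simp
  then show ?thesis using c z(2) by blast
qed

text \<open>
  The local ring modulo \<open>Y0\<close> has a single prime and is therefore artinian. Take a largest \<open>Y\<close> such
  that the chain condition holds between \<open>Y0\<close> and \<open>Y\<close>; if \<open>Y\<close> were proper, a socle element modulo
  \<open>Y\<close> would enlarge it.
\<close>

lemma dcc_if_minimal_over:
  assumes P: "primeideal P R" and Y0: "ideal Y0 R" "loc P Y0 = Y0"
    and min: "\<And>Q. primeideal Q R \<Longrightarrow> Y0 \<subseteq> Q \<Longrightarrow> Q \<subseteq> P \<Longrightarrow> Q = P"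
  shows "dcc_between P Y0 (carrier R)"
proof -
  let ?A = "{Y. ideal Y R \<and> loc P Y = Y \<and> Y0 \<subseteq> Y \<and> dcc_between P Y0 Y}"
  have "K n = K 0" if "\<And>n. Y0 \<subseteq> K n \<and> K n \<subseteq> Y0" for K :: "nat \<Rightarrow> 'a set" and n
    using that[of n] that[of 0] by blast
  then have "dcc_between P Y0 Y0" unfolding dcc_between_def by (intro allI impI exI[of _ 0]) metis
  then have "Y0 \<in> ?A" using Y0 by simp
  then have ne: "?A \<noteq> {}" by (metis empty_iff)
  obtain Y where YA: "Y \<in> ?A" and max: "\<forall>X\<in>?A. Y \<subseteq> X \<longrightarrow> X = Y"
  proof (rule bexE[OF exists_maximal_ideal_in[OF ne]])
    show "ideal X R" if "X \<in> ?A" for X using that by simp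
  qed (rule that)
  have Y: "ideal Y R" "loc P Y = Y" "Y0 \<subseteq> Y" "dcc_between P Y0 Y" using YA by simp_all
  have "Y = carrier R"
  proof (rule ccontr)
    assume "Y \<noteq> carrier R"
    then have one: "\<one> \<notin> Y" using ideal.one_imp_carrier[OF Y(1)] by blast
    obtain c where c: "c \<in> carrier R" "c \<otimes> \<one> \<notin> Y" "\<forall>p\<in>P. p \<otimes> (c \<otimes> \<one>) \<in> Y"
      using exists_socle_multiple[OF P Y(1,2) one_closed one] min Y(3) by blast
    define z where "z = c \<otimes> \<one>"
    have z: "z \<in> carrier R - Y" "\<And>p. p \<in> P \<Longrightarrow> p \<otimes> z \<in> Y"
      using c by (auto simp: z_def simp del: r_one)
    have zc: "z \<in> carrier R" using z by auto
    let ?X = "loc P (adjoin Y z)"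
    have adj: "ideal (adjoin Y z) R" using adjoin_ideal[OF Y(1) zc] .
    have X: "ideal ?X R" "loc P ?X = ?X" "Y \<subseteq> ?X" "z \<in> ?X"
      using loc_ideal[OF P adj] loc_loc[OF P adj] loc_incl[OF P adj] adjoin_incl[OF Y(1) zc] adjoin_mem[OF Y(1) zc]
      by auto
    have "dcc_between P Y0 ?X"
      using dcc_between_trans[OF P Y(1,2,3) X(3,1,2) Y(4)] dcc_between_simple[OF P Y(1,2) zc z(2)] by blast
    moreover have "Y0 \<subseteq> ?X" using Y(3) X(3) by (rule order_trans)
    ultimately have "?X \<in> ?A" using X(1,2) by simp
    then have "?X = Y" using max X(3) by simp
    then show False using X(4) z(1) by simp
  qed
  then show ?thesis using Y by simp
qed

lemma ideal_prod_l: "ideal A R \<Longrightarrow> ideal B R \<Longrightarrow> A \<cdot> B \<subseteq> B"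
  using ideal_prod_inter by blast

text \<open>
  This form says that in a chain of primes any intermediate prime can be exchanged for one that
  contains a prescribed element \<open>x\<close> of the top prime. It is the principal ideal theorem in
  \<open>R/Q\<close>: a prime minimal over \<open>x\<close> has height at most one, so it cannot be \<open>P\<close>.

  If there were no such \<open>P'\<close>, then \<open>P\<close> would be minimal over \<open>Q + (x)\<close>, and the chain condition
  would hold modulo \<open>x\<close>. The ideals \<open>T n\<close> below are the symbolic powers of \<open>Q'\<close> modulo \<open>Q\<close>, and
  \<open>T n + (x)\<close> becomes stationary. As \<open>x \<notin> Q'\<close>, this gives \<open>T n \<subseteq> T (n + 1) + x T n\<close>, so
  \<open>T n = T (n + 1)\<close> by Nakayama's lemma at \<open>P\<close> and \<open>T n = Q\<close> by Nakayama's lemma at \<open>Q'\<close>. But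
  \<open>T n\<close> contains the \<open>n\<close>-th powers of the elements of \<open>Q'\<close>.
\<close>

theorem krull_principal_ideal:
  assumes Q: "primeideal Q R" and Q': "primeideal Q' R" and P: "primeideal P R"
    and QQ': "Q \<subset> Q'" and Q'P: "Q' \<subset> P" and x: "x \<in> P"
  shows "\<exists>P'. primeideal P' R \<and> Q \<subset> P' \<and> P' \<subset> P \<and> x \<in> P'"
proof (rule ccontr)
  assume neg: "\<not> ?thesis"
  have Qi: "ideal Q R" and Q'i: "ideal Q' R" and Pi: "ideal P R"
    using Q Q' P primeideal.axioms(1) by auto
  have xc: "x \<in> carrier R" using x ideal.Icarr[OF Pi] by blast
  have xQ': "x \<notin> Q'" using neg Q' QQ' Q'P by blast
  have Qx: "ideal (adjoin Q x) R" using adjoin_ideal[OF Qi xc] .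
  define Y where "Y = loc P (adjoin Q x)"
  have Y: "ideal Y R" "loc P Y = Y" "adjoin Q x \<subseteq> Y"
    unfolding Y_def using loc_ideal[OF P Qx] loc_loc[OF P Qx] loc_incl[OF P Qx] by auto
  have QY: "Q \<subseteq> Y" "x \<in> Y" using Y(3) adjoin_incl[OF Qi xc] adjoin_mem[OF Qi xc] by auto
  have dcc: "dcc_between P Y (carrier R)"
  proof (rule dcc_if_minimal_over[OF P Y(1,2)])
    fix P' assume "primeideal P' R" "Y \<subseteq> P'" "P' \<subseteq> P"
    then show "P' = P" using neg QY xQ' QQ' by blast
  qed
  define T where "T = rec_nat (carrier R) (\<lambda>_ X. loc Q' (Q <+> (Q' \<cdot> X)))"
  have T0: "T 0 = carrier R" and TS: "T (Suc n) = loc Q' (Q <+> (Q' \<cdot> T n))" for n by (simp_all add: T_def)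
  have Ti: "ideal (T n) R" for n
  proof (induction n)
    case (Suc n) then show ?case unfolding TS
      by (intro loc_ideal Q' add_ideals Qi ideal_prod_is_ideal Q'i)
  qed (simp add: T0 oneideal)
  have Si: "ideal (Q <+> (Q' \<cdot> T n)) R" for n by (intro add_ideals Qi ideal_prod_is_ideal Q'i Ti)
  have Tsat: "loc Q' (T n) = T n" for n
  proof (cases n)
    case 0 then show ?thesis using loc_incl[OF Q' oneideal] loc_carrier by (auto simp: T0)
  next
    case (Suc m) then show ?thesis unfolding Suc TS using loc_loc[OF Q' Si] by simp
  qed
  have QT: "Q \<subseteq> T n" for n
  proof (cases n)
    case 0 then show ?thesis using ideal.Icarr[OF Qi] by (auto simp: T0)
  next
    case (Suc m)
    have "Q \<subseteq> Q <+> (Q' \<cdot> T m)"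
      using ideal_zero_closed[OF ideal_prod_is_ideal[OF Q'i Ti[of m]]] ideal.Icarr[OF Qi] by (force simp: set_add_def')
    then show ?thesis unfolding Suc TS using loc_incl[OF Q' Si] by blast
  qed
  have Tdec1: "T (Suc n) \<subseteq> T n" for n
  proof -
    have "Q <+> (Q' \<cdot> T n) \<subseteq> T n"
      using QT[of n] ideal_prod_l[OF Q'i Ti[of n]] ideal_add_closed[OF Ti[of n]] by (fastforce simp: set_add_def')
    then show ?thesis unfolding TS using loc_mono[of _ "T n" Q'] Tsat by blast
  qed
  define K where "K n = loc P (adjoin (T n) x)" for n
  have Ai: "ideal (adjoin (T n) x) R" for n using adjoin_ideal[OF Ti xc] .
  have "\<exists>N. \<forall>n\<ge>N. K n = K N"
  proof (intro dcc[unfolded dcc_between_def, rule_format] conjI allI)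
    fix n
    show "ideal (K n) R" "loc P (K n) = K n" "K n \<subseteq> carrier R"
      unfolding K_def using loc_ideal[OF P Ai] loc_loc[OF P Ai] loc_carrier by auto
    show "Y \<subseteq> K n" unfolding Y_def K_def using QT[of n] by (intro loc_mono) (auto simp: adjoin_def)
  next
    show "decseq K" unfolding decseq_Suc_iff K_def
      using Tdec1 by (intro allI loc_mono) (auto simp: adjoin_def)
  qed
  then obtain N where N: "K (Suc N) = K N" by (metis Suc_n_not_le_n nle_le)
  have TP: "loc P (T n) = T n" for n
  proof -
    have "loc P (T n) \<subseteq> loc Q' (T n)" using Q'P by (auto simp: loc_def)
    then show ?thesis using Tsat loc_incl[OF P Ti] by blast
  qed
  have "T N \<subseteq> loc P (T (Suc N))"
  proof (rule nakayama[OF P Ti Ti])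
    fix y assume y: "y \<in> T N"
    then have "y \<in> K (Suc N)" using N adjoin_incl[OF Ti xc] loc_incl[OF P Ai] by (fastforce simp: K_def)
    then obtain s where s: "s \<in> carrier R - P" "s \<otimes> y \<in> adjoin (T (Suc N)) x" by (auto simp: K_def elim!: locE)
    then obtain t b where tb: "t \<in> T (Suc N)" "b \<in> carrier R" "s \<otimes> y = t \<oplus> b \<otimes> x" by (auto elim!: adjoinE)
    have c: "s \<in> carrier R" "y \<in> carrier R" "t \<in> carrier R" using s y tb ideal.Icarr[OF Ti] by auto
    have "x \<otimes> b = s \<otimes> y \<ominus> t" unfolding tb(3) using c tb(2) xc by algebra
    also have "\<dots> \<in> T N" using y tb(1) Tdec1 c ideal.I_l_closed[OF Ti] ideal_minus_closed[OF Ti] by blast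
    finally have "b \<in> T N" using locI[of x Q' b "T N"] xc xQ' tb Tsat by blast
    then have "x \<otimes> b \<in> P \<cdot> T N" using x ideal_prod.prod by metis
    then have "s \<otimes> y = t \<oplus> x \<otimes> b" "x \<otimes> b \<in> P \<cdot> T N" using tb xc by (simp_all add: m_comm)
    then show "\<exists>l\<in>T (Suc N). \<exists>w\<in>P \<cdot> T N. \<exists>s\<in>carrier R - P. s \<otimes> y = l \<oplus> w" using tb s by blast
  qed
  then have "T N \<subseteq> T (Suc N)" using TP by simp
  have "T N \<subseteq> loc Q' Q"
  proof (rule nakayama[OF Q' Ti Qi])
    fix y assume "y \<in> T N"
    then have "y \<in> T (Suc N)" using \<open>T N \<subseteq> T (Suc N)\<close> by blast
    then show "\<exists>l\<in>Q. \<exists>w\<in>Q' \<cdot> T N. \<exists>s\<in>carrier R - Q'. s \<otimes> y = l \<oplus> w"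
      unfolding TS by (auto simp: set_add_def' elim!: locE)
  qed
  then have TQ: "T N \<subseteq> Q" using loc_prime[OF _ Q' Q] QQ' by blast
  obtain y where y: "y \<in> Q'" "y \<notin> Q" using QQ' by blast
  have yc: "y \<in> carrier R" using y ideal.Icarr[OF Q'i] by blast
  have "y [^] n \<in> T n" for n :: nat
  proof (induction n)
    case (Suc n)
    have "y \<otimes> y [^] n \<in> Q' \<cdot> T n" using y Suc ideal_prod.prod by metis
    then have "\<zero> \<oplus> y \<otimes> y [^] n \<in> Q <+> (Q' \<cdot> T n)"
      using ideal_zero_closed[OF Qi] unfolding set_add_def' by blast
    moreover have "\<zero> \<oplus> y \<otimes> y [^] n = y [^] Suc n" using yc by (simp add: m_comm)
    ultimately show ?case unfolding TS using loc_incl[OF Q' Si] by auto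
  qed (simp add: T0)
  then have "y [^] N \<in> Q" using TQ by blast
  then show False using prime_compl_pow[OF Q, of y N] y yc by simp
qed

section \<open>Chains of primes and regular sequences\<close>

primrec prime_chain :: "nat \<Rightarrow> 'a set \<Rightarrow> 'a set \<Rightarrow> bool" where
  "prime_chain 0 Q P \<longleftrightarrow> primeideal Q R \<and> Q = P"
| "prime_chain (Suc n) Q P \<longleftrightarrow> primeideal Q R \<and> (\<exists>Q'. Q \<subset> Q' \<and> prime_chain n Q' P)"

lemma prime_chain_prime: "prime_chain n Q P \<Longrightarrow> primeideal Q R \<and> primeideal P R"
  by (induction n arbitrary: Q) auto

lemma prime_chain_sub: "prime_chain n Q P \<Longrightarrow> Q \<subseteq> P"
  by (induction n arbitrary: Q) fastforce+

text \<open>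
  The element \<open>x\<close> is pushed down the chain one prime at a time by the principal ideal theorem.
\<close>

lemma prime_chain_through:
  "prime_chain (Suc n) Q P \<Longrightarrow> x \<in> P \<Longrightarrow> \<exists>Q'. Q \<subset> Q' \<and> x \<in> Q' \<and> prime_chain n Q' P"
proof (induction n arbitrary: Q)
  case (Suc n)
  then obtain Q1 where Q1: "primeideal Q R" "Q \<subset> Q1" "prime_chain (Suc n) Q1 P" by auto
  then obtain Q2 where Q2: "Q1 \<subset> Q2" "x \<in> Q2" "prime_chain n Q2 P" using Suc.IH[OF Q1(3) Suc.prems(2)] by blast
  have "primeideal Q1 R" "primeideal Q2 R"
    using prime_chain_prime[OF Q1(3)] prime_chain_prime[OF Q2(3)] by simp_all
  then obtain P' where "primeideal P' R" "Q \<subset> P'" "P' \<subset> Q2" "x \<in> P'"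
    using krull_principal_ideal[OF Q1(1) _ _ Q1(2) Q2(1,2)] by blast
  then show ?case using Q2(3) by (intro exI[of _ P']) auto
qed auto

primrec adjoins :: "'a set \<Rightarrow> 'a list \<Rightarrow> 'a set" where
  "adjoins K [] = K"
| "adjoins K (x # xs) = adjoins (adjoin K x) xs"

text \<open>
  A regular sequence on the local ring at \<open>P\<close> modulo \<open>K\<close>, in the weak sense: each member is a
  nonzerodivisor modulo the previous ones, and the quotients may be zero.
\<close>

primrec regular_seq :: "'a set \<Rightarrow> 'a set \<Rightarrow> 'a list \<Rightarrow> bool" where
  "regular_seq P K [] \<longleftrightarrow> True"
| "regular_seq P K (x # xs) \<longleftrightarrow>
     (\<forall>a\<in>carrier R. x \<otimes> a \<in> loc P K \<longrightarrow> a \<in> loc P K) \<and> regular_seq P (adjoin K x) xs"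

text \<open>
  A local ring whose maximal ideal is generated by as many elements as the length of a chain of
  primes is a domain, and the generators form a regular sequence. The relative version modulo
  \<open>Q\<close> allows induction on the generators inside a single ring. For the first generator \<open>x\<close>, pass
  to a chain whose second prime \<open>P1\<close> contains \<open>x\<close>; by induction \<open>P1\<close> is locally \<open>Q + (x)\<close>. Hence
  \<open>x \<notin> P0\<close>, as \<open>P0\<close> is strictly smaller, and \<open>P0 \<subseteq> Q + (x)\<close> improves to \<open>P0 \<subseteq> Q + x P0\<close>, so
  that Nakayama's lemma applies.
\<close>

theorem regular_seq_if_chain:
  assumes "prime_chain (length xs) P0 P" "ideal Q R" "Q \<subseteq> P0" "set xs \<subseteq> P" "P \<subseteq> loc P (adjoins Q xs)"
  shows "loc P Q = P0 \<and> regular_seq P Q xs"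
  using assms
proof (induction xs arbitrary: Q P0)
  case Nil
  then show ?case using loc_mono[of Q P P] loc_prime[of P P] by auto
next
  case (Cons x xs)
  have P: "primeideal P R" and P0: "primeideal P0 R" using prime_chain_prime Cons.prems(1) by blast+
  have P0P: "P0 \<subseteq> P" using prime_chain_sub Cons.prems(1) by blast
  have P0i: "ideal P0 R" using P0 primeideal.axioms(1) by auto
  have x: "x \<in> P" "x \<in> carrier R" using Cons.prems ideal.Icarr[OF primeideal.axioms(1)[OF P]] by auto
  obtain P1 where P1: "P0 \<subset> P1" "x \<in> P1" "prime_chain (length xs) P1 P"
    using prime_chain_through[of "length xs" P0 P x] Cons.prems x by auto
  have P1i: "ideal P1 R" using prime_chain_prime[OF P1(3)] primeideal.axioms(1) by auto
  have Qx: "ideal (adjoin Q x) R" using adjoin_ideal Cons.prems x by blast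
  have "adjoin Q x \<subseteq> P1" using adjoin_least[OF P1i] P1 Cons.prems by blast
  then have IH: "loc P (adjoin Q x) = P1" "regular_seq P (adjoin Q x) xs"
    using Cons.IH[OF P1(3) Qx] Cons.prems by auto
  have xP0: "x \<notin> P0"
  proof
    assume "x \<in> P0"
    then have "loc P (adjoin Q x) \<subseteq> loc P P0" using Cons.prems by (intro loc_mono adjoin_least[OF P0i])
    then show False using IH(1) loc_prime[OF P0P P P0] P1(1) by blast
  qed
  have "P0 \<subseteq> loc P Q"
  proof (rule nakayama[OF P P0i Cons.prems(2)])
    fix y assume y: "y \<in> P0"
    then have "y \<in> loc P (adjoin Q x)" using IH P1 by blast
    then obtain s where s: "s \<in> carrier R - P" "s \<otimes> y \<in> adjoin Q x" by (auto elim!: locE)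
    then obtain q b where tb: "q \<in> Q" "b \<in> carrier R" "s \<otimes> y = q \<oplus> b \<otimes> x" by (auto elim!: adjoinE)
    have c: "s \<in> carrier R" "y \<in> carrier R" "q \<in> carrier R" using s y tb ideal.Icarr[OF P0i] Cons.prems by auto
    have "b \<otimes> x = s \<otimes> y \<ominus> q" unfolding tb(3) using c tb(2) x(2) by algebra
    also have "\<dots> \<in> P0" using y tb(1) Cons.prems c ideal.I_l_closed[OF P0i] ideal_minus_closed[OF P0i] by blast
    finally have "b \<in> P0" using primeideal.I_prime[OF P0 tb(2) x(2)] xP0 by blast
    then have "x \<otimes> b \<in> P \<cdot> P0" using x ideal_prod.prod by metis
    then have "s \<otimes> y = q \<oplus> x \<otimes> b" "x \<otimes> b \<in> P \<cdot> P0" using tb x by (simp_all add: m_comm)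
    then show "\<exists>l\<in>Q. \<exists>w\<in>P \<cdot> P0. \<exists>s\<in>carrier R - P. s \<otimes> y = l \<oplus> w" using tb s by blast
  qed
  moreover have "loc P Q \<subseteq> P0" using loc_mono[of Q P0 P] loc_prime[OF P0P P P0] Cons.prems by blast
  ultimately have eq: "loc P Q = P0" by blast
  have "\<forall>a\<in>carrier R. x \<otimes> a \<in> loc P Q \<longrightarrow> a \<in> loc P Q"
    unfolding eq using primeideal.I_prime[OF P0 x(2)] xP0 by blast
  then show ?case using eq IH by simp
qed

section \<open>Powers of a regular sequence\<close>

lemma adjoins_Idl:
  "G \<subseteq> carrier R \<Longrightarrow> set xs \<subseteq> carrier R \<Longrightarrow> adjoins (Idl G) xs = Idl (G \<union> set xs)"
proof (induction xs arbitrary: G)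
  case (Cons x xs)
  then have "adjoins (Idl (insert x G)) xs = Idl (insert x G \<union> set xs)" by auto
  then show ?case using Cons adjoin_eq_Idl[of G x] by simp
qed simp

lemma Idl_empty: "Idl {} = {\<zero>}"
  using genideal_minimal[OF zeroideal, of "{}"] ideal_zero_closed[OF genideal_ideal[of "{}"]] by auto

lemma adjoins_zero: "set xs \<subseteq> carrier R \<Longrightarrow> adjoins {\<zero>} xs = Idl (set xs)"
  using adjoins_Idl[of "{}" xs] by (simp add: Idl_empty)

lemma regular_seq_append:
  "regular_seq P K (xs @ ys) \<longleftrightarrow> regular_seq P K xs \<and> regular_seq P (adjoins K xs) ys"
  by (induction xs arbitrary: K) auto

lemma adjoin_commute:
  assumes "ideal K R" "x \<in> carrier R" "y \<in> carrier R"
  shows "adjoin (adjoin K x) y = adjoin (adjoin K y) x"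
proof -
  have "adjoin (adjoin K x) y \<subseteq> adjoin (adjoin K y) x" if xy: "x \<in> carrier R" "y \<in> carrier R" for x y
  proof -
    have i: "ideal (adjoin K y) R" using adjoin_ideal[OF assms(1) xy(2)] .
    have j: "ideal (adjoin (adjoin K y) x) R" using adjoin_ideal[OF i xy(1)] .
    have s: "adjoin K y \<subseteq> adjoin (adjoin K y) x" using adjoin_incl[OF i xy(1)] .
    have "adjoin K x \<subseteq> adjoin (adjoin K y) x"
      using adjoin_least[OF j order_trans[OF adjoin_incl[OF assms(1) xy(2)] s] adjoin_mem[OF i xy(1)]] .
    moreover have "y \<in> adjoin (adjoin K y) x" using adjoin_mem[OF assms(1) xy(2)] s by blast
    ultimately show ?thesis using adjoin_least[OF j] by blast
  qed
  then show ?thesis using assms by blast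
qed

text \<open>
  A sequence that is regular on the outer terms of
  \<open>0 \<rightarrow> R/N \<rightarrow> R/K \<rightarrow> R/(K + (u)) \<rightarrow> 0\<close>, with \<open>N = (K : u)\<close>, is regular on the middle term. Each
  step of the sequence keeps the shape: dividing by \<open>y\<close> replaces \<open>K\<close> and \<open>N\<close> by
  \<open>K + (y)\<close> and \<open>N + (y)\<close>, and regularity of \<open>y\<close> on the right-hand term yields
  \<open>(K + (y) : u) = N + (y)\<close>.
\<close>

lemma regular_seq_extension:
  assumes P: "primeideal P R"
  shows "ideal K R \<Longrightarrow> ideal N R \<Longrightarrow> u \<in> carrier R \<Longrightarrow> set xs \<subseteq> carrier R
    \<Longrightarrow> (\<And>a. a \<in> carrier R \<Longrightarrow> a \<in> loc P N \<longleftrightarrow> u \<otimes> a \<in> loc P K)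
    \<Longrightarrow> regular_seq P N xs \<Longrightarrow> regular_seq P (adjoin K u) xs \<Longrightarrow> regular_seq P K xs"
proof (induction xs arbitrary: K N)
  case (Cons y ys)
  note K = Cons.prems(1) and N = Cons.prems(2) and u = Cons.prems(3) and eq = Cons.prems(5)
  have y: "y \<in> carrier R" using Cons.prems by simp
  have Ku: "ideal (adjoin K u) R" using adjoin_ideal[OF K u] .
  have Ky: "ideal (adjoin K y) R" using adjoin_ideal[OF K y] .
  have Ny: "ideal (adjoin N y) R" using adjoin_ideal[OF N y] .
  have KuI: "a \<in> loc P K \<Longrightarrow> a \<in> loc P (adjoin K u)" for a using loc_mono[OF adjoin_incl[OF K u]] by blast
  have lK: "ideal (loc P K) R" and lN: "ideal (loc P N) R" using loc_ideal[OF P] K N by auto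
  have KlK: "k \<in> K \<Longrightarrow> k \<in> loc P K" for k using loc_incl[OF P K] by blast
  have regN: "\<And>a. a \<in> carrier R \<Longrightarrow> y \<otimes> a \<in> loc P N \<Longrightarrow> a \<in> loc P N"
    and regL: "\<And>a. a \<in> carrier R \<Longrightarrow> y \<otimes> a \<in> loc P (adjoin K u) \<Longrightarrow> a \<in> loc P (adjoin K u)"
    using Cons.prems(6,7) by simp_all
  have reg: "a \<in> loc P K" if a: "a \<in> carrier R" "y \<otimes> a \<in> loc P K" for a
  proof -
    have "a \<in> loc P (adjoin K u)" using regL[OF a(1) KuI[OF a(2)]] .
    then obtain s where s: "s \<in> carrier R - P" "s \<otimes> a \<in> adjoin K u" by (rule locE)
    from s(2) obtain k b where kb: "k \<in> K" "b \<in> carrier R" "s \<otimes> a = k \<oplus> b \<otimes> u" by (rule adjoinE)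
    have c: "k \<in> carrier R" "s \<in> carrier R" using kb(1) s(1) ideal.Icarr[OF K] by auto
    have "u \<otimes> (y \<otimes> b) = y \<otimes> (k \<oplus> b \<otimes> u) \<ominus> y \<otimes> k" using c kb(2) y u by algebra
    also have "\<dots> = s \<otimes> (y \<otimes> a) \<ominus> y \<otimes> k" unfolding kb(3)[symmetric] using c a(1) y by algebra
    also have "\<dots> \<in> loc P K"
      using ideal_minus_closed[OF lK ideal.I_l_closed[OF lK a(2) c(2)] ideal.I_l_closed[OF lK KlK[OF kb(1)] y]] .
    finally have "y \<otimes> b \<in> loc P N" using eq[of "y \<otimes> b"] kb(2) y by simp
    then have "u \<otimes> b \<in> loc P K" using eq[of b] regN[of b] kb(2) by simp
    then have "s \<otimes> a \<in> loc P K" unfolding kb(3)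
      using ideal_add_closed[OF lK KlK[OF kb(1)]] kb(2) u by (simp add: m_comm)
    then show ?thesis using loc_cancel[OF P s(1) a(1)] by simp
  qed
  have "regular_seq P (adjoin K y) ys"
  proof (rule Cons.IH[OF Ky Ny u])
    show "set ys \<subseteq> carrier R" "regular_seq P (adjoin N y) ys" using Cons.prems by auto
    show "regular_seq P (adjoin (adjoin K y) u) ys"
      using Cons.prems(7) unfolding adjoin_commute[OF K y u] by simp
    fix c assume c: "c \<in> carrier R"
    show "c \<in> loc P (adjoin N y) \<longleftrightarrow> u \<otimes> c \<in> loc P (adjoin K y)"
    proof
      assume "c \<in> loc P (adjoin N y)"
      then obtain s where s: "s \<in> carrier R - P" "s \<otimes> c \<in> adjoin N y" by (rule locE)
      from s(2) obtain n b where nb: "n \<in> N" "b \<in> carrier R" "s \<otimes> c = n \<oplus> b \<otimes> y" by (rule adjoinE)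
      have cc: "n \<in> carrier R" "s \<in> carrier R" using nb(1) s(1) ideal.Icarr[OF N] by auto
      have "u \<otimes> n \<in> loc P K" using eq[of n] nb(1) cc(1) loc_incl[OF P N] by blast
      then have "u \<otimes> n \<in> loc P (adjoin K y)" using loc_mono[OF adjoin_incl[OF K y]] by blast
      moreover have "(u \<otimes> b) \<otimes> y \<in> loc P (adjoin K y)"
        using ideal.I_l_closed[OF Ky adjoin_mem[OF K y], of "u \<otimes> b"] nb(2) u loc_incl[OF P Ky] by auto
      ultimately have "u \<otimes> n \<oplus> (u \<otimes> b) \<otimes> y \<in> loc P (adjoin K y)"
        using ideal_add_closed[OF loc_ideal[OF P Ky]] by blast
      moreover have "s \<otimes> (u \<otimes> c) = u \<otimes> (s \<otimes> c)" using cc c u by algebra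
      moreover have "u \<otimes> (n \<oplus> b \<otimes> y) = u \<otimes> n \<oplus> (u \<otimes> b) \<otimes> y" using cc nb(2) y u by algebra
      ultimately have "s \<otimes> (u \<otimes> c) \<in> loc P (adjoin K y)" using nb(3) by simp
      then show "u \<otimes> c \<in> loc P (adjoin K y)" using loc_cancel[OF P s(1)] c u by simp
    next
      assume "u \<otimes> c \<in> loc P (adjoin K y)"
      then obtain s where s: "s \<in> carrier R - P" "s \<otimes> (u \<otimes> c) \<in> adjoin K y" by (rule locE)
      from s(2) obtain k d where kd: "k \<in> K" "d \<in> carrier R" "s \<otimes> (u \<otimes> c) = k \<oplus> d \<otimes> y" by (rule adjoinE)
      have cc: "k \<in> carrier R" "s \<in> carrier R" using kd(1) s(1) ideal.Icarr[OF K] by auto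
      have "y \<otimes> d = (k \<oplus> d \<otimes> y) \<ominus> k" using cc kd(2) y by algebra
      also have "\<dots> = (s \<otimes> c) \<otimes> u \<ominus> k" unfolding kd(3)[symmetric] using cc c u by algebra
      also have "\<dots> \<in> adjoin K u"
        using ideal_minus_closed[OF Ku ideal.I_l_closed[OF Ku adjoin_mem[OF K u]]] adjoin_incl[OF K u] cc c kd(1) by blast
      finally have "y \<otimes> d \<in> loc P (adjoin K u)" using loc_incl[OF P Ku] by blast
      then have "d \<in> loc P (adjoin K u)" using regL[OF kd(2)] by blast
      then obtain t where t: "t \<in> carrier R - P" "t \<otimes> d \<in> adjoin K u" by (rule locE)
      from t(2) obtain k' b where kb: "k' \<in> K" "b \<in> carrier R" "t \<otimes> d = k' \<oplus> b \<otimes> u" by (rule adjoinE)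
      have c3: "t \<in> carrier R" "k' \<in> carrier R" using t(1) ideal.Icarr[OF K kb(1)] by auto
      have "u \<otimes> (t \<otimes> s \<otimes> c \<ominus> b \<otimes> y) = t \<otimes> (s \<otimes> (u \<otimes> c)) \<ominus> b \<otimes> (y \<otimes> u)"
        using cc c3 c kb(2) y u by algebra
      also have "\<dots> = t \<otimes> k \<oplus> (t \<otimes> d) \<otimes> y \<ominus> b \<otimes> (y \<otimes> u)"
        unfolding kd(3) using cc c3 kd(2) kb(2) y u by algebra
      also have "\<dots> = t \<otimes> k \<oplus> y \<otimes> k'"
        unfolding kb(3) using cc c3 kd(2) kb(2) y u by algebra
      also have "\<dots> \<in> K"
        using ideal_add_closed[OF K ideal.I_l_closed[OF K kd(1) c3(1)] ideal.I_l_closed[OF K kb(1) y]] .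
      finally have "t \<otimes> s \<otimes> c \<ominus> b \<otimes> y \<in> loc P N"
        using eq[of "t \<otimes> s \<otimes> c \<ominus> b \<otimes> y"] KlK c3 cc c kb(2) y by simp
      then have e1: "t \<otimes> s \<otimes> c \<ominus> b \<otimes> y \<in> loc P (adjoin N y)" using loc_mono[OF adjoin_incl[OF N y]] by blast
      have e2: "b \<otimes> y \<in> loc P (adjoin N y)"
        using ideal.I_l_closed[OF Ny adjoin_mem[OF N y] kb(2)] loc_incl[OF P Ny] by blast
      have "(t \<otimes> s \<otimes> c \<ominus> b \<otimes> y) \<oplus> b \<otimes> y = (t \<otimes> s) \<otimes> c" using cc c3 c kb(2) y by algebra
      then have "(t \<otimes> s) \<otimes> c \<in> loc P (adjoin N y)"
        using ideal_add_closed[OF loc_ideal[OF P Ny] e1 e2] by simp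
      then show "c \<in> loc P (adjoin N y)" using loc_cancel[OF P prime_compl_mult[OF P t(1) s(1)] c] by simp
    qed
  qed
  then show ?case using reg by simp
qed simp

lemma regular_power_cancel:
  assumes K: "ideal K R" and x: "x \<in> carrier R"
    and reg: "\<And>a. a \<in> carrier R \<Longrightarrow> x \<otimes> a \<in> K \<Longrightarrow> a \<in> K"
  shows "a \<in> carrier R \<Longrightarrow> x [^] (n::nat) \<otimes> a \<in> K \<Longrightarrow> a \<in> K"
proof (induction n arbitrary: a)
  case (Suc n)
  have "x [^] Suc n \<otimes> a = x [^] n \<otimes> (x \<otimes> a)" using x Suc.prems(1) by (simp add: m_assoc)
  then have "x [^] n \<otimes> (x \<otimes> a) \<in> K" using Suc.prems(2) by simp
  then have "x \<otimes> a \<in> K" using Suc.IH[of "x \<otimes> a"] Suc.prems(1) x by simp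
  then show ?case using reg Suc.prems(1) by blast
qed simp

text \<open>
  Multiplication by \<open>x\<^sup>m\<close> identifies \<open>R/(K + (x))\<close> with the kernel of
  \<open>R/(K + (x\<^sup>m\<^sup>+\<^sup>1)) \<rightarrow> R/(K + (x\<^sup>m))\<close>, which gives an induction on the exponent.
\<close>

lemma regular_seq_power_first:
  assumes P: "primeideal P R" and K: "ideal K R" and c: "x \<in> carrier R" "set xs \<subseteq> carrier R"
    and reg: "regular_seq P K (x # xs)" and n: "(n::nat) > 0"
  shows "regular_seq P K (x [^] n # xs)"
proof -
  have lK: "ideal (loc P K) R" using loc_ideal[OF P K] .
  have KlK: "k \<in> K \<Longrightarrow> k \<in> loc P K" for k using loc_incl[OF P K] by blast
  have regK: "\<And>a. a \<in> carrier R \<Longrightarrow> x \<otimes> a \<in> loc P K \<Longrightarrow> a \<in> loc P K" using reg by simp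
  have cancel: "a \<in> carrier R \<Longrightarrow> x [^] (m::nat) \<otimes> a \<in> loc P K \<Longrightarrow> a \<in> loc P K" for a m
    by (rule regular_power_cancel[OF lK c(1) regK])
  have Kx: "ideal (adjoin K x) R" using adjoin_ideal[OF K c(1)] .
  have Kp: "ideal (adjoin K (x [^] m)) R" for m :: nat using adjoin_ideal[OF K] c(1) by simp
  have "regular_seq P (adjoin K (x [^] Suc m)) xs" for m
  proof (induction m)
    case 0 then show ?case using reg c by simp
  next
    case (Suc m)
    let ?u = "x [^] Suc m" and ?K = "adjoin K (x [^] Suc (Suc m))"
    have u: "?u \<in> carrier R" using c by simp
    have ux: "x [^] Suc (Suc m) = x \<otimes> ?u" using c by (simp add: m_comm m_assoc m_lcomm)
    show ?case
    proof (rule regular_seq_extension[OF P Kp Kx u c(2)])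
      show "regular_seq P (adjoin K x) xs" using reg by simp
      have "adjoin ?K ?u = adjoin K ?u"
      proof
        have "x [^] Suc (Suc m) \<in> adjoin K ?u" unfolding ux
          using ideal.I_l_closed[OF Kp adjoin_mem[OF K u] c(1)] .
        then show "adjoin ?K ?u \<subseteq> adjoin K ?u"
          using adjoin_least[OF Kp adjoin_least[OF Kp adjoin_incl[OF K u]]] adjoin_mem[OF K u] by blast
        have uu: "x [^] Suc (Suc m) \<in> carrier R" using c by simp
        show "adjoin K ?u \<subseteq> adjoin ?K ?u"
          using adjoin_least[OF adjoin_ideal[OF Kp u] order_trans[OF adjoin_incl[OF K uu] adjoin_incl[OF Kp u]]
            adjoin_mem[OF Kp u]] .
      qed
      then show "regular_seq P (adjoin ?K ?u) xs" using Suc by simp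
      fix a assume a: "a \<in> carrier R"
      show "a \<in> loc P (adjoin K x) \<longleftrightarrow> ?u \<otimes> a \<in> loc P ?K"
      proof
        assume "a \<in> loc P (adjoin K x)"
        then obtain s where s: "s \<in> carrier R - P" "s \<otimes> a \<in> adjoin K x" by (rule locE)
        from s(2) obtain k b where kb: "k \<in> K" "b \<in> carrier R" "s \<otimes> a = k \<oplus> b \<otimes> x" by (rule adjoinE)
        have cc: "k \<in> carrier R" "s \<in> carrier R" using kb(1) s(1) ideal.Icarr[OF K] by auto
        have "s \<otimes> (?u \<otimes> a) = ?u \<otimes> (s \<otimes> a)" using cc a u by (simp add: m_lcomm)
        also have "\<dots> = ?u \<otimes> k \<oplus> b \<otimes> (x \<otimes> ?u)" unfolding kb(3) using cc kb(2) c(1) u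
          by (simp only: r_distr m_closed) (simp only: m_closed m_ac)
        also have "\<dots> \<in> ?K" unfolding ux[symmetric]
          using adjoinI[OF ideal.I_l_closed[OF K kb(1) u] kb(2)] .
        finally show "?u \<otimes> a \<in> loc P ?K" using locI[OF s(1)] a u by simp
      next
        assume "?u \<otimes> a \<in> loc P ?K"
        then obtain s where s: "s \<in> carrier R - P" "s \<otimes> (?u \<otimes> a) \<in> ?K" by (rule locE)
        from s(2) obtain k b where kb: "k \<in> K" "b \<in> carrier R" "s \<otimes> (?u \<otimes> a) = k \<oplus> b \<otimes> (x \<otimes> ?u)"
          unfolding ux by (rule adjoinE)
        have cc: "k \<in> carrier R" "s \<in> carrier R" using kb(1) s(1) ideal.Icarr[OF K] by auto
        have key: "v \<otimes> (s \<otimes> a \<ominus> b \<otimes> x) = s \<otimes> (v \<otimes> a) \<ominus> b \<otimes> (x \<otimes> v)" if "v \<in> carrier R" for v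
          using that cc a kb(2) c(1) by algebra
        have key2: "(k \<oplus> w) \<ominus> w = k" if "w \<in> carrier R" for w using that cc by algebra
        have "?u \<otimes> (s \<otimes> a \<ominus> b \<otimes> x) = k" unfolding key[OF u] kb(3) using key2[of "b \<otimes> (x \<otimes> ?u)"] kb(2) c(1) u
          by simp
        then have "s \<otimes> a \<ominus> b \<otimes> x \<in> loc P K"
          using cancel[of "s \<otimes> a \<ominus> b \<otimes> x" "Suc m"] KlK[OF kb(1)] cc a kb(2) c(1) by simp
        then have e1: "s \<otimes> a \<ominus> b \<otimes> x \<in> loc P (adjoin K x)" using loc_mono[OF adjoin_incl[OF K c(1)]] by blast
        have e2: "b \<otimes> x \<in> loc P (adjoin K x)"
          using ideal.I_l_closed[OF Kx adjoin_mem[OF K c(1)] kb(2)] loc_incl[OF P Kx] by blast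
        have "(s \<otimes> a \<ominus> b \<otimes> x) \<oplus> b \<otimes> x = s \<otimes> a" using cc a kb(2) c(1) by algebra
        then have "s \<otimes> a \<in> loc P (adjoin K x)" using ideal_add_closed[OF loc_ideal[OF P Kx] e1 e2] by simp
        then show "a \<in> loc P (adjoin K x)" using loc_cancel[OF P s(1) a] by simp
      qed
    qed
  qed
  from this[of "n - 1"] n have "regular_seq P (adjoin K (x [^] n)) xs" by simp
  then show ?thesis using cancel[of _ n] by simp
qed

lemma regular_seq_powers:
  assumes P: "primeideal P R"
  shows "ideal K R \<Longrightarrow> set xs \<subseteq> carrier R \<Longrightarrow> regular_seq P K xs \<Longrightarrow> (\<And>x. x \<in> set xs \<Longrightarrow> f x > (0::nat))
     \<Longrightarrow> regular_seq P K (map (\<lambda>x. x [^] f x) xs)"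
proof (induction xs arbitrary: K)
  case (Cons x xs)
  have x: "x \<in> carrier R" "x [^] f x \<in> carrier R" and xs: "set xs \<subseteq> carrier R"
    using Cons.prems(2) by auto
  have fx: "f x > 0" and fxs: "\<And>y. y \<in> set xs \<Longrightarrow> f y > 0" using Cons.prems(4) by simp_all
  have r: "regular_seq P K (x [^] f x # xs)"
    by (rule regular_seq_power_first[OF P Cons.prems(1) x(1) xs Cons.prems(3) fx])
  then have "regular_seq P (adjoin K (x [^] f x)) xs" by simp
  then have "regular_seq P (adjoin K (x [^] f x)) (map (\<lambda>x. x [^] f x) xs)"
    using Cons.IH[OF adjoin_ideal[OF Cons.prems(1) x(2)] xs _ fxs] by blast
  then show ?case using r by simp
qed simp

end

section \<open>Systems of parameters and the socle\<close>

text \<open>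
  A regular system of parameters of the local ring at \<open>P\<close>. Regularity is required in every order,
  so that any parameter can be treated as the last one.
\<close>

locale regular_at_prime = noetherian_cring +
  fixes P X
  assumes P: "primeideal P R" and finX: "finite X" and XP: "X \<subseteq> P"
    and generate: "P \<subseteq> loc P (Idl X)"
    and regular: "\<And>xs. set xs = X \<Longrightarrow> distinct xs \<Longrightarrow> regular_seq P {\<zero>} xs"
begin

lemma P_ideal: "ideal P R" using P primeideal.axioms(1) by blast

lemma Xcarr: "X \<subseteq> carrier R" using XP ideal.Icarr[OF P_ideal] by blast

definition powers :: "('a \<Rightarrow> nat) \<Rightarrow> 'a set \<Rightarrow> 'a set"
  where "powers f Y = Idl ((\<lambda>x. x [^] f x) ` Y)"

lemma powers_ideal: "Y \<subseteq> X \<Longrightarrow> ideal (powers f Y) R"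
  unfolding powers_def using Xcarr by (intro genideal_ideal) auto

lemma powers_remove:
  assumes "y \<in> X" shows "powers f X = adjoin (powers f (X - {y})) (y [^] f y)"
proof -
  have "(\<lambda>x. x [^] f x) ` X = insert (y [^] f y) ((\<lambda>x. x [^] f x) ` (X - {y}))" using assms by auto
  then show ?thesis unfolding powers_def using Xcarr assms
    by (subst adjoin_eq_Idl) auto
qed

lemma parameter_regular:
  assumes y: "y \<in> X" and f: "\<And>x. x \<in> X \<Longrightarrow> f x > 0"
    and a: "a \<in> carrier R" "y \<otimes> a \<in> loc P (powers f (X - {y}))"
  shows "a \<in> loc P (powers f (X - {y}))"
proof -
  obtain ys where ys: "set ys = X - {y}" "distinct ys" using finite_distinct_list[of "X - {y}"] finX by auto
  \<comment> \<open>treat \<open>y\<close> itself, to the first power, as the last parameter\<close>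
  define g where "g = f(y := 1)"
  have yc: "y \<in> carrier R" using y Xcarr by blast
  have "regular_seq P {\<zero>} (ys @ [y])" using regular[of "ys @ [y]"] ys y by auto
  then have "regular_seq P {\<zero>} (map (\<lambda>x. x [^] g x) (ys @ [y]))"
    using ys y Xcarr f by (intro regular_seq_powers[OF P zeroideal]) (auto simp: g_def)
  moreover have "map (\<lambda>x. x [^] g x) (ys @ [y]) = map (\<lambda>x. x [^] f x) ys @ [y]"
    using ys yc by (auto simp: g_def)
  ultimately have "regular_seq P {\<zero>} (map (\<lambda>x. x [^] f x) ys @ [y])" by metis
  then have "regular_seq P (adjoins {\<zero>} (map (\<lambda>x. x [^] f x) ys)) [y]" unfolding regular_seq_append by blast
  moreover have "adjoins {\<zero>} (map (\<lambda>x. x [^] f x) ys) = powers f (X - {y})"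
    unfolding powers_def using ys(1) Xcarr by (subst adjoins_zero) auto
  ultimately show ?thesis using a by simp
qed

text \<open>
  Lowering a single exponent amounts to dividing by that parameter. Both facts about the socle
  are proved by descending with this lemma to the case where all exponents are 1.
\<close>

lemma powers_cancel:
  assumes y: "y \<in> X" and f: "\<And>x. x \<in> X \<Longrightarrow> f x > 0" and fy: "f y = Suc m" and m: "m > 0"
    and b: "b \<in> carrier R"
  shows "y \<otimes> b \<in> loc P (powers f X) \<longleftrightarrow> b \<in> loc P (powers (f(y := m)) X)"
proof -
  define Z where "Z = powers f (X - {y})"
  have Z: "ideal Z R" unfolding Z_def using powers_ideal[of "X - {y}"] by blast
  have yc: "y \<in> carrier R" using y Xcarr by blast
  have e1: "powers f X = adjoin Z (y \<otimes> y [^] m)" unfolding Z_def using powers_remove[OF y, of f] fy yc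
    by (simp add: m_comm)
  have "(\<lambda>x. x [^] (f(y := m)) x) ` (X - {y}) = (\<lambda>x. x [^] f x) ` (X - {y})" by auto
  then have e2: "powers (f(y := m)) X = adjoin Z (y [^] m)" unfolding Z_def
    using powers_remove[OF y, of "f(y := m)"] by (simp add: powers_def)
  define v where "v = y [^] m"
  have v: "v \<in> carrier R" using yc v_def by simp
  have iv: "ideal (adjoin Z v) R" and iyv: "ideal (adjoin Z (y \<otimes> v)) R"
    using adjoin_ideal[OF Z] v yc by auto
  show ?thesis unfolding e1 e2 v_def[symmetric]
  proof
    assume "y \<otimes> b \<in> loc P (adjoin Z (y \<otimes> v))"
    then obtain s where s: "s \<in> carrier R - P" "s \<otimes> (y \<otimes> b) \<in> adjoin Z (y \<otimes> v)" by (rule locE)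
    from s(2) obtain z c where zc: "z \<in> Z" "c \<in> carrier R" "s \<otimes> (y \<otimes> b) = z \<oplus> c \<otimes> (y \<otimes> v)" by (rule adjoinE)
    have cc: "z \<in> carrier R" "s \<in> carrier R" using zc(1) s(1) ideal.Icarr[OF Z] by auto
    have "y \<otimes> (s \<otimes> b \<ominus> c \<otimes> v) = s \<otimes> (y \<otimes> b) \<ominus> c \<otimes> (y \<otimes> v)" using cc b zc(2) yc v by algebra
    also have "\<dots> = z" unfolding zc(3) using cc zc(2) yc v by algebra
    finally have "y \<otimes> (s \<otimes> b \<ominus> c \<otimes> v) \<in> loc P Z" using zc(1) loc_incl[OF P Z] by auto
    then have "s \<otimes> b \<ominus> c \<otimes> v \<in> loc P Z"
      using parameter_regular[OF y f, where a = "s \<otimes> b \<ominus> c \<otimes> v"] cc b zc(2) v by (simp add: Z_def)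
    then have "s \<otimes> b \<ominus> c \<otimes> v \<in> loc P (adjoin Z v)" using loc_mono[OF adjoin_incl[OF Z v]] by blast
    moreover have "c \<otimes> v \<in> loc P (adjoin Z v)"
      using ideal.I_l_closed[OF iv adjoin_mem[OF Z v] zc(2)] loc_incl[OF P iv] by blast
    moreover have "(s \<otimes> b \<ominus> c \<otimes> v) \<oplus> c \<otimes> v = s \<otimes> b" using cc b zc(2) v by algebra
    ultimately have "s \<otimes> b \<in> loc P (adjoin Z v)"
      using ideal_add_closed[OF loc_ideal[OF P iv]] by metis
    then show "b \<in> loc P (adjoin Z v)" using loc_cancel[OF P s(1) b] by simp
  next
    assume "b \<in> loc P (adjoin Z v)"
    then obtain s where s: "s \<in> carrier R - P" "s \<otimes> b \<in> adjoin Z v" by (rule locE)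
    from s(2) obtain z c where zc: "z \<in> Z" "c \<in> carrier R" "s \<otimes> b = z \<oplus> c \<otimes> v" by (rule adjoinE)
    have cc: "z \<in> carrier R" "s \<in> carrier R" using zc(1) s(1) ideal.Icarr[OF Z] by auto
    have "s \<otimes> (y \<otimes> b) = y \<otimes> (s \<otimes> b)" using cc b yc by algebra
    also have "\<dots> = y \<otimes> z \<oplus> c \<otimes> (y \<otimes> v)" unfolding zc(3) using cc zc(2) yc v by algebra
    also have "\<dots> \<in> adjoin Z (y \<otimes> v)" using adjoinI[OF ideal.I_l_closed[OF Z zc(1) yc] zc(2)] .
    finally show "y \<otimes> b \<in> loc P (adjoin Z (y \<otimes> v))" using locI[OF s(1)] b yc by simp
  qed
qed

text \<open>
  The generator of the socle modulo \<open>powers f X\<close>.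
\<close>

definition socle_gen :: "('a \<Rightarrow> nat) \<Rightarrow> 'a"
  where "socle_gen f = (\<Otimes>x\<in>X. x [^] (f x - 1))"

lemma socle_gen_closed: "socle_gen f \<in> carrier R"
  unfolding socle_gen_def using Xcarr by (intro finprod_closed) auto

lemma socle_gen_step:
  assumes y: "y \<in> X" and fy: "f y = Suc m" and m: "m > 0"
  shows "socle_gen f = y \<otimes> socle_gen (f(y := m))"
proof -
  have XX: "X = insert y (X - {y})" using y by blast
  have c: "y \<in> carrier R" "\<And>x. x \<in> X - {y} \<Longrightarrow> x \<in> carrier R" using Xcarr y by auto
  define w where "w = (\<Otimes>x\<in>X - {y}. x [^] (f x - 1))"
  have w: "w \<in> carrier R" unfolding w_def using c by (intro finprod_closed) auto
  have "socle_gen f = y [^] m \<otimes> w"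
    unfolding socle_gen_def w_def using finX c fy
    by (subst XX, subst finprod_insert) (auto)
  moreover have "socle_gen (f(y:=m)) = y [^] (m - 1) \<otimes> w"
  proof -
    have "(\<Otimes>x\<in>X - {y}. x [^] ((f(y:=m)) x - 1)) = w" unfolding w_def using c by (intro finprod_cong') auto
    then show ?thesis unfolding socle_gen_def using finX c
      by (subst XX, subst finprod_insert) (auto)
  qed
  moreover have "y [^] m = y \<otimes> y [^] (m - 1)" using m c(1) by (cases m) (auto simp: m_comm)
  ultimately show ?thesis using w c(1) by (simp add: m_assoc)
qed

lemma socle_gen_annihilated:
  assumes x: "x \<in> X" and f: "f x > 0" shows "x \<otimes> socle_gen f \<in> powers f X"
proof -
  have XX: "X = insert x (X - {x})" using x by blast
  have c: "x \<in> carrier R" "\<And>y. y \<in> X - {x} \<Longrightarrow> y \<in> carrier R" using Xcarr x by auto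
  define w where "w = (\<Otimes>y\<in>X - {x}. y [^] (f y - 1))"
  have w: "w \<in> carrier R" unfolding w_def using c by (intro finprod_closed) auto
  have "socle_gen f = x [^] (f x - 1) \<otimes> w"
    unfolding socle_gen_def w_def using finX c by (subst XX, subst finprod_insert) (auto)
  then have "x \<otimes> socle_gen f = w \<otimes> x [^] f x"
    using f c(1) w by (cases "f x") (auto simp: m_ac)
  moreover have "x [^] f x \<in> powers f X"
    unfolding powers_def using genideal_self[of "(\<lambda>x. x [^] f x) ` X"] Xcarr x by blast
  ultimately show ?thesis using ideal.I_l_closed[OF powers_ideal[of X f] _ w] by simp
qed

lemma powers_one:
  assumes "\<forall>x\<in>X. f x = 1" shows "powers f X = Idl X" "socle_gen f = \<one>"
proof -
  have "(\<lambda>x. x [^] f x) ` X = X" using assms Xcarr by force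
  then show "powers f X = Idl X" by (simp add: powers_def)
  show "socle_gen f = \<one>" unfolding socle_gen_def using assms by (intro finprod_one_eqI) simp
qed

lemma loc_IdlX: "loc P (Idl X) = P"
proof -
  have "loc P (Idl X) \<subseteq> loc P P" using XP by (intro loc_mono genideal_minimal P_ideal)
  then show ?thesis using loc_prime[OF _ P P] generate by auto
qed

lemma exponent_cases:
  assumes f: "\<forall>x\<in>X. f x > (0::nat)"
  obtains "\<forall>x\<in>X. f x = 1"
  | y m where "y \<in> X" "f y = Suc m" "m > 0" "sum (f(y := m)) X < sum f X" "\<forall>x\<in>X. (f(y := m)) x > 0"
proof (cases "\<exists>y\<in>X. f y > 1")
  case True
  then obtain y where y: "y \<in> X" "f y > 1" by blast
  then obtain m where m: "f y = Suc m" "m > 0" by (cases "f y") auto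
  have "sum (f(y := m)) X < sum f X" using finX y m by (intro sum_strict_mono_ex1) auto
  then show ?thesis using that(2)[OF y(1) m] f m by simp
next
  case False
  then have "\<forall>x\<in>X. f x = 1" using f by force
  then show ?thesis using that(1) by blast
qed

lemma socle_gen_notin:
  "(\<And>x. x \<in> X \<Longrightarrow> f x > 0) \<Longrightarrow> socle_gen f \<notin> loc P (powers f X)"
proof (induction "sum f X" arbitrary: f rule: less_induct)
  case less
  from less.prems have "\<forall>x\<in>X. f x > 0" by blast
  then show ?case
  proof (cases rule: exponent_cases)
    case 1
    then show ?thesis using powers_one[of f] loc_IdlX prime_compl_one[OF P] by simp
  next
    case (2 y m)
    then show ?thesis
      using less.hyps[of "f(y := m)"] powers_cancel[where f = f and y = y and m = m, OF 2(1) less.prems 2(2,3) socle_gen_closed]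
        socle_gen_step[where f = f and y = y and m = m, OF 2(1,2,3)] by simp
  qed
qed

text \<open>
  If \<open>a\<close> is killed by all parameters and \<open>f y > 1\<close>, then \<open>a\<close> is a multiple \<open>y b\<close> modulo the ideal of
  powers, and \<open>b\<close> is killed by all parameters modulo the ideal with the exponent of \<open>y\<close> lowered.
\<close>

lemma socle_generated:
  "(\<And>x. x \<in> X \<Longrightarrow> f x > 0) \<Longrightarrow> a \<in> carrier R \<Longrightarrow> (\<And>x. x \<in> X \<Longrightarrow> x \<otimes> a \<in> loc P (powers f X))
     \<Longrightarrow> a \<in> loc P (adjoin (powers f X) (socle_gen f))"
proof (induction "sum f X" arbitrary: f a rule: less_induct)
  case less
  note f = less.prems(1) and a = less.prems(2) and xa = less.prems(3)
  let ?A = "adjoin (powers f X) (socle_gen f)"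
  have A: "ideal ?A R" using adjoin_ideal[OF powers_ideal socle_gen_closed] by blast
  have lA: "ideal (loc P ?A) R" using loc_ideal[OF P A] .
  have Zf: "ideal (loc P (powers f X)) R" using loc_ideal[OF P powers_ideal] by blast
  have ZA: "w \<in> loc P (powers f X) \<Longrightarrow> w \<in> loc P ?A" for w
    using loc_mono[OF adjoin_incl[OF powers_ideal socle_gen_closed]] by blast
  from f have "\<forall>x\<in>X. f x > 0" by blast
  then show ?case
  proof (cases rule: exponent_cases)
    case 1
    have "\<one> \<in> ?A" using powers_one[of f] 1 adjoin_mem[OF powers_ideal[of X f] socle_gen_closed[of f]] by simp
    then have "?A = carrier R" using ideal.one_imp_carrier[OF A] by blast
    then show ?thesis using a loc_incl[OF P oneideal] by auto
  next
    case (2 y m)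
    let ?f = "f(y := m)"
    have yc: "y \<in> carrier R" using 2 Xcarr by blast
    define Z where "Z = powers f (X - {y})"
    have Z: "ideal Z R" unfolding Z_def using powers_ideal[of "X - {y}"] by blast
    have ZZf: "Z \<subseteq> loc P (powers f X)"
    proof -
      have "Z \<subseteq> powers f X" unfolding Z_def powers_remove[OF 2(1)]
        using powers_ideal[of "X - {y}" f] yc by (intro adjoin_incl) auto
      then show ?thesis using loc_incl[OF P powers_ideal[of X f]] by blast
    qed
    have "(\<lambda>x. x [^] ?f x) ` (X - {y}) = (\<lambda>x. x [^] f x) ` (X - {y})" by auto
    then have e2: "powers ?f X = adjoin Z (y [^] m)" unfolding Z_def
      using powers_remove[OF 2(1), of ?f] by (simp add: powers_def)
    have "a \<in> loc P (powers ?f X)" using powers_cancel[where f = f and y = y and m = m, OF 2(1) f 2(2,3) a] xa[OF 2(1)] by simp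
    then obtain s where s: "s \<in> carrier R - P" "s \<otimes> a \<in> adjoin Z (y [^] m)" unfolding e2 by (rule locE)
    from s(2) obtain z c where zc: "z \<in> Z" "c \<in> carrier R" "s \<otimes> a = z \<oplus> c \<otimes> y [^] m" by (rule adjoinE)
    define b where "b = c \<otimes> y [^] (m - 1)"
    have b: "b \<in> carrier R" using zc yc by (simp add: b_def)
    have "c \<otimes> y [^] m = y \<otimes> b"
      using 2(3) zc(2) yc by (cases m) (auto simp: b_def m_ac)
    then have sa: "s \<otimes> a = z \<oplus> y \<otimes> b" using zc(3) by simp
    have cc: "z \<in> carrier R" "s \<in> carrier R" using zc(1) s(1) ideal.Icarr[OF Z] by auto
    have "x \<otimes> b \<in> loc P (powers ?f X)" if x: "x \<in> X" for x
    proof -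
      have xc: "x \<in> carrier R" using x Xcarr by blast
      have "y \<otimes> (x \<otimes> b) = x \<otimes> (z \<oplus> y \<otimes> b) \<ominus> x \<otimes> z" using cc b xc yc by algebra
      also have "\<dots> = s \<otimes> (x \<otimes> a) \<ominus> x \<otimes> z" unfolding sa[symmetric] using cc a xc by algebra
      also have "\<dots> \<in> loc P (powers f X)"
        using ideal_minus_closed[OF Zf ideal.I_l_closed[OF Zf xa[OF x] cc(2)] ideal.I_l_closed[OF Zf _ xc]] zc(1) ZZf by blast
      finally show ?thesis using powers_cancel[where f = f and y = y and m = m and b = "x \<otimes> b", OF 2(1) f 2(2,3)] xc b by simp
    qed
    then have "b \<in> loc P (adjoin (powers ?f X) (socle_gen ?f))"
      using less.hyps[OF 2(4) _ b] 2(5) by blast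
    then obtain t where t: "t \<in> carrier R - P" "t \<otimes> b \<in> adjoin (powers ?f X) (socle_gen ?f)" by (rule locE)
    from t(2) obtain w d where wd: "w \<in> powers ?f X" "d \<in> carrier R" "t \<otimes> b = w \<oplus> d \<otimes> socle_gen ?f" by (rule adjoinE)
    have c2: "w \<in> carrier R" "t \<in> carrier R" using wd(1) t(1) ideal.Icarr[OF powers_ideal] by auto
    have "w \<in> loc P (powers ?f X)" using wd(1) loc_incl[OF P powers_ideal[of X ?f]] by blast
    then have yw: "y \<otimes> w \<in> loc P (powers f X)" using powers_cancel[where f = f and y = y and m = m, OF 2(1) f 2(2,3) c2(1)] by simp
    define g where "g = socle_gen ?f"
    have g: "g \<in> carrier R" unfolding g_def by (rule socle_gen_closed)
    have dg: "d \<otimes> socle_gen f \<in> loc P ?A"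
      using ideal.I_l_closed[OF A adjoin_mem[OF powers_ideal socle_gen_closed] wd(2)] loc_incl[OF P A] by blast
    have "t \<otimes> (y \<otimes> b) = y \<otimes> (t \<otimes> b)" using c2 b yc by algebra
    also have "\<dots> = y \<otimes> w \<oplus> d \<otimes> (y \<otimes> g)" unfolding wd(3) g_def[symmetric] using c2 wd(2) g yc by algebra
    also have "y \<otimes> g = socle_gen f" using socle_gen_step[of y f m] 2 by (simp add: g_def)
    finally have "t \<otimes> (y \<otimes> b) \<in> loc P ?A" using ideal_add_closed[OF lA ZA[OF yw] dg] by simp
    then have "y \<otimes> b \<in> loc P ?A" using loc_cancel[OF P t(1)] yc b by simp
    then have "s \<otimes> a \<in> loc P ?A" unfolding sa using ideal_add_closed[OF lA ZA] zc(1) ZZf by blast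
    then show ?thesis using loc_cancel[OF P s(1) a] by simp
  qed
qed

end

section \<open>Frobenius and Cartier maps\<close>

context cring
begin

lemma binomial_ring:
  assumes x: "x \<in> carrier R" and y: "y \<in> carrier R"
  shows "(x \<oplus> y) [^] (n::nat) = (\<Oplus>k\<in>{..n}. [(n choose k)] \<cdot>\<^bsub>R\<^esub> (x [^] k \<otimes> y [^] (n - k)))"
proof (induction n)
  case 0 then show ?case by (simp add: add_pow_def)
next
  case (Suc n)
  define A where "A k = [(n choose k)] \<cdot>\<^bsub>R\<^esub> (x [^] Suc k \<otimes> y [^] (n - k))" for k
  define B where "B k = [(n choose k)] \<cdot>\<^bsub>R\<^esub> (x [^] k \<otimes> y [^] (Suc n - k))" for k
  define T where "T k = [(Suc n choose k)] \<cdot>\<^bsub>R\<^esub> (x [^] k \<otimes> y [^] (Suc n - k))" for k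
  have c: "A \<in> {..n} \<rightarrow> carrier R" "\<And>k. B k \<in> carrier R" "\<And>k. T k \<in> carrier R" "\<And>k. A k \<in> carrier R"
    using x y by (auto simp: A_def B_def T_def)
  have S: "(\<lambda>k. [(n choose k)] \<cdot>\<^bsub>R\<^esub> (x [^] k \<otimes> y [^] (n - k))) \<in> {..n} \<rightarrow> carrier R" using x y by auto
  have T0: "T 0 = B 0" by (simp add: T_def B_def)
  have TS: "T (Suc k) = A k \<oplus> B (Suc k)" for k
    unfolding T_def A_def B_def using x y by (simp add: add.nat_pow_mult)
  have BS: "B (Suc n) = \<zero>" unfolding B_def using x y by (simp add: binomial_eq_0)
  have "(x \<oplus> y) [^] Suc n = (\<Oplus>k\<in>{..n}. [(n choose k)] \<cdot>\<^bsub>R\<^esub> (x [^] k \<otimes> y [^] (n - k))) \<otimes> x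
      \<oplus> (\<Oplus>k\<in>{..n}. [(n choose k)] \<cdot>\<^bsub>R\<^esub> (x [^] k \<otimes> y [^] (n - k))) \<otimes> y"
    using Suc x y S by (simp add: r_distr)
  also have "(\<Oplus>k\<in>{..n}. [(n choose k)] \<cdot>\<^bsub>R\<^esub> (x [^] k \<otimes> y [^] (n - k))) \<otimes> x = (\<Oplus>k\<in>{..n}. A k)"
    using x y S c
    by (subst finsum_ldistr) (auto intro!: finsum_cong' simp: A_def add_pow_ldistr add_pow_rdistr m_ac)
  also have "(\<Oplus>k\<in>{..n}. [(n choose k)] \<cdot>\<^bsub>R\<^esub> (x [^] k \<otimes> y [^] (n - k))) \<otimes> y = (\<Oplus>k\<in>{..n}. B k)"
    using x y S c
    by (subst finsum_ldistr) (auto intro!: finsum_cong' simp: B_def add_pow_ldistr add_pow_rdistr m_ac Suc_diff_le)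
  also have "(\<Oplus>k\<in>{..n}. B k) = (\<Oplus>k\<in>{..Suc n}. B k)" using c BS by (subst finsum_Suc) auto
  also have "\<dots> = (\<Oplus>k\<in>{..n}. B (Suc k)) \<oplus> B 0" using c by (subst finsum_Suc2) auto
  also have "(\<Oplus>k\<in>{..n}. A k) \<oplus> ((\<Oplus>k\<in>{..n}. B (Suc k)) \<oplus> B 0) = (\<Oplus>k\<in>{..n}. T (Suc k)) \<oplus> T 0"
    using c by (simp add: TS T0 finsum_addf a_assoc)
  also have "\<dots> = (\<Oplus>k\<in>{..Suc n}. T k)" using c by (subst finsum_Suc2) auto
  finally show ?case by (simp add: T_def)
qed

lemma frobenius_add:
  assumes p: "prime p" and char: "[p] \<cdot>\<^bsub>R\<^esub> \<one> = \<zero>" and x: "x \<in> carrier R" and y: "y \<in> carrier R"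
  shows "(x \<oplus> y) [^] (p::nat) = x [^] p \<oplus> y [^] p"
proof -
  have z: "[(p * m)] \<cdot>\<^bsub>R\<^esub> a = \<zero>" if "a \<in> carrier R" for a and m :: nat
  proof -
    have "[(p * m)] \<cdot>\<^bsub>R\<^esub> a = [m] \<cdot>\<^bsub>R\<^esub> ([p] \<cdot>\<^bsub>R\<^esub> a)" using that by (simp add: add.nat_pow_pow mult.commute)
    also have "[p] \<cdot>\<^bsub>R\<^esub> a = ([p] \<cdot>\<^bsub>R\<^esub> \<one>) \<otimes> a" using that by (subst add_pow_ldistr) auto
    finally show ?thesis using char that by simp
  qed
  define T where "T k = [(p choose k)] \<cdot>\<^bsub>R\<^esub> (x [^] k \<otimes> y [^] (p - k))" for k
  have Tc: "T k \<in> carrier R" for k using x y by (simp add: T_def)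
  obtain m where m: "p = Suc (Suc m)" using prime_ge_2_nat[OF p] by (metis add_2_eq_Suc le_Suc_ex)
  have T0: "T k = \<zero>" if "0 < k" "k < p" for k
  proof -
    have "p dvd p choose k" using p that by (intro dvd_choose_prime) auto
    then obtain j where "p choose k = p * j" by blast
    then show ?thesis unfolding T_def using z x y by simp
  qed
  have "(x \<oplus> y) [^] p = (\<Oplus>k\<in>{..Suc (Suc m)}. T k)" unfolding binomial_ring[OF x y] T_def m ..
  also have "\<dots> = T p \<oplus> (\<Oplus>k\<in>{..Suc m}. T k)" unfolding m using Tc by (subst finsum_Suc) auto
  also have "(\<Oplus>k\<in>{..Suc m}. T k) = (\<Oplus>k\<in>{..m}. T (Suc k)) \<oplus> T 0" using Tc by (subst finsum_Suc2) auto
  also have "(\<Oplus>k\<in>{..m}. T (Suc k)) = \<zero>" using T0 m by (intro add.finprod_one_eqI) auto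
  also have "T p = x [^] p" using x y by (simp add: T_def)
  also have "T 0 = y [^] p" using x y by (simp add: T_def)
  finally show ?thesis using x y by simp
qed

text \<open>
  Sums over lists, because the index sets of the sums below get composed and may then contain
  repetitions.
\<close>

definition lsum :: "('c \<Rightarrow> 'a) \<Rightarrow> 'c list \<Rightarrow> 'a"
  where "lsum f L = foldr (\<lambda>t a. f t \<oplus> a) L \<zero>"

lemma lsum_simps [simp]: "lsum f [] = \<zero>" "lsum f (t # L) = f t \<oplus> lsum f L"
  by (simp_all add: lsum_def)

lemma lsum_closed: "(\<And>t. t \<in> set L \<Longrightarrow> f t \<in> carrier R) \<Longrightarrow> lsum f L \<in> carrier R"
  by (induction L) auto

lemma lsum_cong: "(\<And>t. t \<in> set L \<Longrightarrow> f t = g t) \<Longrightarrow> lsum f L = lsum g L"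
  by (induction L) auto

lemma lsum_append:
  "(\<And>t. t \<in> set L \<union> set M \<Longrightarrow> f t \<in> carrier R) \<Longrightarrow> lsum f (L @ M) = lsum f L \<oplus> lsum f M"
  by (induction L) (auto simp: lsum_closed a_assoc)

lemma lsum_map: "lsum f (map g L) = lsum (\<lambda>t. f (g t)) L"
  by (induction L) auto

lemma lsum_concat:
  "(\<And>t u. t \<in> set L \<Longrightarrow> u \<in> set (g t) \<Longrightarrow> f u \<in> carrier R)
    \<Longrightarrow> lsum f (concat (map g L)) = lsum (\<lambda>t. lsum f (g t)) L"
proof (induction L)
  case (Cons a L)
  have "lsum f (g a @ concat (map g L)) = lsum f (g a) \<oplus> lsum f (concat (map g L))"
    using Cons.prems by (intro lsum_append) auto
  moreover have "lsum f (concat (map g L)) = lsum (\<lambda>t. lsum f (g t)) L"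
    by (rule Cons.IH, rule Cons.prems) auto
  ultimately show ?case by simp
qed simp

lemma lsum_rdistr:
  "r \<in> carrier R \<Longrightarrow> (\<And>t. t \<in> set L \<Longrightarrow> f t \<in> carrier R) \<Longrightarrow> r \<otimes> lsum f L = lsum (\<lambda>t. r \<otimes> f t) L"
  by (induction L) (auto simp: lsum_closed r_distr)

lemma lsum_hom:
  assumes "\<And>x y. x \<in> carrier R \<Longrightarrow> y \<in> carrier R \<Longrightarrow> h (x \<oplus> y) = h x \<oplus> h y" "h \<zero> = \<zero>"
  shows "(\<And>t. t \<in> set L \<Longrightarrow> f t \<in> carrier R) \<Longrightarrow> h (lsum f L) = lsum (\<lambda>t. h (f t)) L"
  by (induction L) (auto simp: lsum_closed assms)

lemma lsum_ideal: "ideal K R \<Longrightarrow> (\<And>t. t \<in> set L \<Longrightarrow> f t \<in> K) \<Longrightarrow> lsum f L \<in> K"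
  by (induction L) (auto simp: ideal_zero_closed ideal_add_closed)

lemma finsum_eq_lsum:
  "distinct L \<Longrightarrow> (\<And>t. t \<in> set L \<Longrightarrow> f t \<in> carrier R) \<Longrightarrow> finsum R f (set L) = lsum f L"
  by (induction L) (auto simp: Pi_def)

text \<open>
  The linear maps \<open>F\<^sup>e\<^sub>*R \<rightarrow> R\<close> for \<open>q = p\<^sup>e\<close>, as functions on \<open>R\<close>.
\<close>

definition cartier_maps :: "nat \<Rightarrow> ('a \<Rightarrow> 'a) set"
  where "cartier_maps q = {\<phi> \<in> carrier R \<rightarrow> carrier R.
    (\<forall>x\<in>carrier R. \<forall>y\<in>carrier R. \<phi> (x \<oplus> y) = \<phi> x \<oplus> \<phi> y) \<and>
    (\<forall>r\<in>carrier R. \<forall>x\<in>carrier R. \<phi> (r [^] q \<otimes> x) = r \<otimes> \<phi> x)}"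

lemma cartier_maps_eq: "linear_maps R (frobenius_pushforward p e R (self_module R)) (self_module R) = cartier_maps (p ^ e)"
  by (simp add: linear_maps_def frobenius_pushforward_def self_module_def cartier_maps_def)

lemma cartierD:
  assumes "\<phi> \<in> cartier_maps q"
  shows "x \<in> carrier R \<Longrightarrow> \<phi> x \<in> carrier R"
    "x \<in> carrier R \<Longrightarrow> y \<in> carrier R \<Longrightarrow> \<phi> (x \<oplus> y) = \<phi> x \<oplus> \<phi> y"
    "r \<in> carrier R \<Longrightarrow> x \<in> carrier R \<Longrightarrow> \<phi> (r [^] q \<otimes> x) = r \<otimes> \<phi> x"
  using assms by (auto simp: cartier_maps_def)

lemma additive_zero:
  assumes "\<And>x y. x \<in> carrier R \<Longrightarrow> y \<in> carrier R \<Longrightarrow> h (x \<oplus> y) = h x \<oplus> h y" "h \<zero> \<in> carrier R"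
  shows "h \<zero> = \<zero>"
proof -
  have "h \<zero> \<oplus> h \<zero> = h \<zero> \<oplus> \<zero>" using assms(1)[of \<zero> \<zero>] assms(2) by simp
  then show ?thesis using assms(2) add.l_cancel[of "h \<zero>" "h \<zero>" \<zero>] by simp
qed

lemma cartier_zero: "\<phi> \<in> cartier_maps q \<Longrightarrow> \<phi> \<zero> = \<zero>"
  using additive_zero[of \<phi>] cartierD by simp

lemma cartier_finsum:
  assumes "\<phi> \<in> cartier_maps q"
  shows "finite A \<Longrightarrow> f \<in> A \<rightarrow> carrier R \<Longrightarrow> \<phi> (finsum R f A) = (\<Oplus>i\<in>A. \<phi> (f i))"
proof (induction A rule: finite_induct)
  case empty then show ?case using cartier_zero[OF assms] by simp
next
  case (insert i A)
  have "\<phi> (f i) \<in> carrier R" "(\<lambda>i. \<phi> (f i)) \<in> A \<rightarrow> carrier R" using insert.prems cartierD(1)[OF assms] by auto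
  moreover have "\<phi> (f i \<oplus> finsum R f A) = \<phi> (f i) \<oplus> \<phi> (finsum R f A)"
    using insert.prems by (intro cartierD(2)[OF assms]) auto
  ultimately show ?case using insert by simp
qed

lemma cartier_premult:
  assumes "\<phi> \<in> cartier_maps q" "c \<in> carrier R"
  shows "(\<lambda>x. \<phi> (c \<otimes> x)) \<in> cartier_maps q"
proof -
  have "\<phi> (c \<otimes> (r [^] q \<otimes> x)) = r \<otimes> \<phi> (c \<otimes> x)" if "r \<in> carrier R" "x \<in> carrier R" for r x
  proof -
    have "c \<otimes> (r [^] q \<otimes> x) = r [^] q \<otimes> (c \<otimes> x)" using that assms(2) by (simp add: m_lcomm)
    then show ?thesis using cartierD(3)[OF assms(1)] that assms(2) by simp
  qed
  then show ?thesis using cartierD[OF assms(1)] assms(2) by (auto simp: cartier_maps_def r_distr)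
qed

text \<open>
  The ideal on which all maps \<open>\<phi>(r \<cdot>)\<close> take values in \<open>K\<close> contains the \<open>q\<close>-th powers of the elements of
  \<open>K\<close>.
\<close>

lemma cartier_frobenius_power:
  assumes \<phi>: "\<phi> \<in> cartier_maps (p ^ e)" and K: "ideal K R" and x: "x \<in> frobenius_power p e R K"
  shows "\<phi> x \<in> K"
proof -
  let ?D = "{x \<in> carrier R. \<forall>r\<in>carrier R. \<phi> (r \<otimes> x) \<in> K}"
  have D: "ideal ?D R"
  proof (rule idealI_closed)
    show "\<zero> \<in> ?D" using cartier_zero[OF \<phi>] ideal_zero_closed[OF K] by simp
    show "a \<oplus> b \<in> ?D" if "a \<in> ?D" "b \<in> ?D" for a b
      using that cartierD(2)[OF \<phi>] ideal_add_closed[OF K] by (auto simp: r_distr)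
    show "r \<otimes> a \<in> ?D" if "a \<in> ?D" "r \<in> carrier R" for a r
      using that by (auto simp: m_assoc[symmetric])
  qed auto
  have "k [^] (p ^ e) \<in> ?D" if k: "k \<in> K" for k
  proof -
    have kc: "k \<in> carrier R" using ideal.Icarr[OF K k] .
    have "\<phi> (r \<otimes> k [^] (p ^ e)) \<in> K" if r: "r \<in> carrier R" for r
    proof -
      have "\<phi> (r \<otimes> k [^] (p ^ e)) = k \<otimes> \<phi> r" using cartierD(3)[OF \<phi> kc r] r kc by (simp add: m_comm)
      then show ?thesis using ideal.I_r_closed[OF K k cartierD(1)[OF \<phi> r]] by simp
    qed
    then show ?thesis using kc by simp
  qed
  then have "frobenius_power p e R K \<subseteq> ?D" unfolding frobenius_power_def
    by (intro genideal_minimal D) blast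
  then have "\<phi> (\<one> \<otimes> x) \<in> K" "x \<in> carrier R" using x by blast+
  then show ?thesis by simp
qed

lemma pow_image_carrier: "ideal K R \<Longrightarrow> (\<lambda>x. x [^] (n::nat)) ` K \<subseteq> carrier R"
  using ideal.Icarr[of K R] by auto

lemma frobenius_power_ideal: "ideal K R \<Longrightarrow> ideal (frobenius_power p e R K) R"
  unfolding frobenius_power_def by (intro genideal_ideal pow_image_carrier)

lemma frobenius_power_mem: "ideal K R \<Longrightarrow> k \<in> K \<Longrightarrow> k [^] (p ^ e) \<in> frobenius_power p e R K"
  unfolding frobenius_power_def using genideal_self[OF pow_image_carrier] by blast

lemma common_denominator:
  assumes P: "primeideal P R" and K: "ideal K R"
  shows "finite E \<Longrightarrow> (\<And>i. i \<in> E \<Longrightarrow> a i \<in> loc P K) \<Longrightarrow> \<exists>s\<in>carrier R - P. \<forall>i\<in>E. s \<otimes> a i \<in> K"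
proof (induction E rule: finite_induct)
  case empty then show ?case using prime_compl_one[OF P] by blast
next
  case (insert i E)
  then obtain s where s: "s \<in> carrier R - P" "\<forall>i\<in>E. s \<otimes> a i \<in> K" by auto
  obtain t where t: "t \<in> carrier R - P" "a i \<in> carrier R" "t \<otimes> a i \<in> K" using insert.prems[of i] by (auto elim: locE)
  have "(s \<otimes> t) \<otimes> a j \<in> K" if j: "j \<in> insert i E" for j
  proof -
    have ac: "a j \<in> carrier R" using insert.prems[OF j] loc_carrier by blast
    have e: "(s \<otimes> t) \<otimes> a j = s \<otimes> (t \<otimes> a j)" "(s \<otimes> t) \<otimes> a j = t \<otimes> (s \<otimes> a j)" using s t ac by (auto simp: m_ac)
    show ?thesis
    proof (cases "j = i")
      case True then show ?thesis unfolding e(1) using ideal.I_l_closed[OF K t(3)] s by simp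
    next
      case False
      then have "s \<otimes> a j \<in> K" using s(2) j by blast
      then show ?thesis unfolding e(2) using ideal.I_l_closed[OF K] t by simp
    qed
  qed
  then show ?case using prime_compl_mult[OF P s(1) t(1)] by blast
qed

text \<open>
  A matrix over the local ring at \<open>P\<close> whose columns are linearly independent modulo \<open>P\<close> has a left
  inverse there; denominators are cleared by the factor \<open>s\<close>. This is Gaussian elimination: the
  first column has an entry \<open>g\<close> outside \<open>P\<close>, which serves as pivot, and the eliminated matrix
  \<open>G'\<close> is again nonsingular modulo \<open>P\<close>.
\<close>

lemma solve_nonsingular:
  assumes P: "primeideal P R"
  shows "finite C \<Longrightarrow> finite E \<Longrightarrow> (\<And>r c. r \<in> E \<Longrightarrow> c \<in> C \<Longrightarrow> G r c \<in> carrier R)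
    \<Longrightarrow> (\<And>v. v \<in> C \<rightarrow> carrier R \<Longrightarrow> (\<And>r. r \<in> E \<Longrightarrow> (\<Oplus>c\<in>C. G r c \<otimes> v c) \<in> P) \<Longrightarrow> \<forall>c\<in>C. v c \<in> P)
    \<Longrightarrow> w \<in> C \<rightarrow> carrier R
    \<Longrightarrow> \<exists>s\<in>carrier R - P. \<exists>y\<in>E \<rightarrow> carrier R. \<forall>c\<in>C. (\<Oplus>r\<in>E. y r \<otimes> G r c) = s \<otimes> w c"
proof (induction C arbitrary: E G w rule: finite_induct)
  case empty
  have "(\<lambda>_. \<zero>) \<in> E \<rightarrow> carrier R" by simp
  then show ?case using prime_compl_one[OF P] by blast
next
  case (insert c1 C)
  note finE = insert.prems(1) and Gc = insert.prems(2) and ns = insert.prems(3) and wc = insert.prems(4)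
  have Pi: "ideal P R" using P primeideal.axioms(1) by blast
  have "\<exists>r1\<in>E. G r1 c1 \<notin> P"
  proof (rule ccontr)
    assume neg: "\<not> ?thesis"
    \<comment> \<open>a column with all entries in \<open>P\<close> would make this unit vector a kernel vector modulo \<open>P\<close>\<close>
    define v where "v = (\<lambda>c. if c = c1 then \<one> else \<zero>)"
    have "(\<Oplus>c\<in>insert c1 C. G r c \<otimes> v c) \<in> P" if r: "r \<in> E" for r
    proof -
      have "(\<Oplus>c\<in>C. G r c \<otimes> v c) = \<zero>" using Gc[OF r] insert.hyps by (intro add.finprod_one_eqI) (auto simp: v_def)
      then have "(\<Oplus>c\<in>insert c1 C. G r c \<otimes> v c) = G r c1"
        using Gc[OF r] insert.hyps by (subst finsum_insert) (auto simp: v_def)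
      then show ?thesis using neg r by auto
    qed
    then have "v c1 \<in> P" using ns[of v] by (auto simp: v_def)
    then show False using prime_compl_one[OF P] by (simp add: v_def)
  qed
  then obtain r1 where r1: "r1 \<in> E" "G r1 c1 \<notin> P" by blast
  define g where "g = G r1 c1"
  have g: "g \<in> carrier R" "g \<in> carrier R - P" using r1 Gc by (auto simp: g_def)
  define E' where "E' = E - {r1}"
  have EE: "E = insert r1 E'" "r1 \<notin> E'" "finite E'" using r1 finE by (auto simp: E'_def)
  define G' where "G' r c = g \<otimes> G r c \<ominus> G r c1 \<otimes> G r1 c" for r c
  define w' where "w' c = g \<otimes> w c \<ominus> w c1 \<otimes> G r1 c" for c
  have Gcc: "G r c \<in> carrier R" if "r \<in> E" "c \<in> insert c1 C" for r c using Gc that by blast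
  have Gr1: "\<And>c. c \<in> C \<Longrightarrow> G r1 c \<in> carrier R" using Gcc r1 by blast
  have GE: "\<And>r c. r \<in> E' \<Longrightarrow> c \<in> C \<Longrightarrow> G r c \<in> carrier R" "\<And>r. r \<in> E' \<Longrightarrow> G r c1 \<in> carrier R" using Gcc EE by blast+
  have wcc: "w c1 \<in> carrier R" "\<And>c. c \<in> C \<Longrightarrow> w c \<in> carrier R" using wc by auto
  have "\<exists>s\<in>carrier R - P. \<exists>y\<in>E' \<rightarrow> carrier R. \<forall>c\<in>C. (\<Oplus>r\<in>E'. y r \<otimes> G' r c) = s \<otimes> w' c"
  proof (rule insert.IH[OF EE(3)])
    show "G' r c \<in> carrier R" if "r \<in> E'" "c \<in> C" for r c
      unfolding G'_def using that GE Gr1 g by simp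
    show "w' \<in> C \<rightarrow> carrier R" unfolding w'_def using wcc Gr1 g by simp
    fix v assume v: "v \<in> C \<rightarrow> carrier R" and vP: "\<And>r. r \<in> E' \<Longrightarrow> (\<Oplus>c\<in>C. G' r c \<otimes> v c) \<in> P"
    have vc: "\<And>c. c \<in> C \<Longrightarrow> v c \<in> carrier R" using v by blast
    define S where "S r = (\<Oplus>c\<in>C. G r c \<otimes> v c)" for r
    have Sc: "S r \<in> carrier R" if "r \<in> E" for r unfolding S_def using Gcc[OF that] vc by (intro finsum_closed) auto
    \<comment> \<open>extend a kernel vector of \<open>G'\<close> by the value at \<open>c1\<close> that makes row \<open>r1\<close> vanish\<close>
    define u where "u c = (if c = c1 then \<ominus> S r1 else g \<otimes> v c)" for c
    have u: "u \<in> insert c1 C \<rightarrow> carrier R" using vc g Sc r1 by (auto simp: u_def)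
    have sum: "(\<Oplus>c\<in>insert c1 C. G r c \<otimes> u c) = g \<otimes> S r \<ominus> G r c1 \<otimes> S r1" if r: "r \<in> E" for r
    proof -
      have "(\<Oplus>c\<in>C. G r c \<otimes> u c) = (\<Oplus>c\<in>C. g \<otimes> (G r c \<otimes> v c))"
        using insert.hyps Gcc[OF r] vc g by (intro finsum_cong') (auto simp: u_def m_lcomm)
      also have "\<dots> = g \<otimes> S r" unfolding S_def using insert.hyps Gcc[OF r] vc g
        by (intro finsum_rdistr[symmetric]) auto
      finally have e: "(\<Oplus>c\<in>C. G r c \<otimes> u c) = g \<otimes> S r" .
      have "(\<Oplus>c\<in>insert c1 C. G r c \<otimes> u c) = G r c1 \<otimes> u c1 \<oplus> (\<Oplus>c\<in>C. G r c \<otimes> u c)"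
        using insert.hyps Gcc[OF r] u by (intro finsum_insert) auto
      also have "\<dots> = G r c1 \<otimes> (\<ominus> S r1) \<oplus> g \<otimes> S r" unfolding e by (simp add: u_def)
      also have "\<dots> = g \<otimes> S r \<ominus> G r c1 \<otimes> S r1"
      proof -
        have "a \<otimes> (\<ominus> b) \<oplus> c = c \<ominus> a \<otimes> b" if "a \<in> carrier R" "b \<in> carrier R" "c \<in> carrier R" for a b c
          using that by algebra
        then show ?thesis using Gcc[OF r, of c1] Sc[OF r1(1)] Sc[OF r] g(1) by simp
      qed
      finally show ?thesis .
    qed
    have "(\<Oplus>c\<in>insert c1 C. G r c \<otimes> u c) \<in> P" if r: "r \<in> E" for r
    proof (cases "r = r1")
      case True
      have "g \<otimes> S r1 \<ominus> g \<otimes> S r1 = \<zero>" using g Sc[OF r1(1)] by simp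
      then show ?thesis unfolding sum[OF r] using True ideal_zero_closed[OF Pi] by (simp add: g_def)
    next
      case False
      then have r': "r \<in> E'" using r EE by blast
      have "(\<Oplus>c\<in>C. G' r c \<otimes> v c) = (\<Oplus>c\<in>C. g \<otimes> (G r c \<otimes> v c) \<oplus> (\<ominus> G r c1) \<otimes> (G r1 c \<otimes> v c))"
      proof (rule finsum_cong'[OF refl])
        show "(\<lambda>c. g \<otimes> (G r c \<otimes> v c) \<oplus> (\<ominus> G r c1) \<otimes> (G r1 c \<otimes> v c)) \<in> C \<rightarrow> carrier R"
          using GE r' Gr1 vc g by simp
        fix c assume c: "c \<in> C"
        have "(a \<otimes> b \<ominus> d \<otimes> e) \<otimes> f = a \<otimes> (b \<otimes> f) \<oplus> (\<ominus> d) \<otimes> (e \<otimes> f)"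
          if "a \<in> carrier R" "b \<in> carrier R" "d \<in> carrier R" "e \<in> carrier R" "f \<in> carrier R" for a b d e f
          using that by algebra
        then show "G' r c \<otimes> v c = g \<otimes> (G r c \<otimes> v c) \<oplus> (\<ominus> G r c1) \<otimes> (G r1 c \<otimes> v c)"
          unfolding G'_def using GE(1)[OF r' c] GE(2)[OF r'] Gr1[OF c] vc[OF c] g(1) by blast
      qed
      also have "\<dots> = (\<Oplus>c\<in>C. g \<otimes> (G r c \<otimes> v c)) \<oplus> (\<Oplus>c\<in>C. (\<ominus> G r c1) \<otimes> (G r1 c \<otimes> v c))"
        using GE r' Gr1 vc g by (intro finsum_addf) auto
      also have "(\<Oplus>c\<in>C. g \<otimes> (G r c \<otimes> v c)) = g \<otimes> S r" unfolding S_def using insert.hyps GE r' vc g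
        by (intro finsum_rdistr[symmetric]) auto
      also have "(\<Oplus>c\<in>C. (\<ominus> G r c1) \<otimes> (G r1 c \<otimes> v c)) = (\<ominus> G r c1) \<otimes> S r1"
        unfolding S_def using insert.hyps GE r' vc Gr1
        by (intro finsum_rdistr[symmetric]) auto
      also have "g \<otimes> S r \<oplus> (\<ominus> G r c1) \<otimes> S r1 = g \<otimes> S r \<ominus> G r c1 \<otimes> S r1"
        using g Sc r r1 GE(2)[OF r'] by (simp add: a_minus_def l_minus)
      finally show ?thesis unfolding sum[OF r] using vP[OF r'] by simp
    qed
    then have "\<forall>c\<in>insert c1 C. u c \<in> P" using ns[OF u] by blast
    then have "g \<otimes> v c \<in> P" if "c \<in> C" for c using that insert.hyps by (auto simp: u_def split: if_splits)
    then show "\<forall>c\<in>C. v c \<in> P" using primeideal.I_prime[OF P g(1)] vc g by blast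
  qed
  then obtain s y where s: "s \<in> carrier R - P" and y: "y \<in> E' \<rightarrow> carrier R"
    and sy: "\<And>c. c \<in> C \<Longrightarrow> (\<Oplus>r\<in>E'. y r \<otimes> G' r c) = s \<otimes> w' c" by blast
  have yc: "\<And>r. r \<in> E' \<Longrightarrow> y r \<in> carrier R" using y by blast
  have sc: "s \<in> carrier R" using s by simp
  define B where "B = (\<Oplus>r\<in>E'. y r \<otimes> G r c1)"
  have B: "B \<in> carrier R" unfolding B_def using yc GE by (intro finsum_closed) auto
  define z where "z r = (if r = r1 then s \<otimes> w c1 \<ominus> B else g \<otimes> y r)" for r
  have z: "z \<in> E \<rightarrow> carrier R" unfolding EE(1) using yc g sc wcc B by (auto simp: z_def)
  have split: "(\<Oplus>r\<in>E. z r \<otimes> G r c) = (s \<otimes> w c1 \<ominus> B) \<otimes> G r1 c \<oplus> g \<otimes> (\<Oplus>r\<in>E'. y r \<otimes> G r c)"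
    if c: "c \<in> insert c1 C" for c
  proof -
    have gE: "\<And>r. r \<in> E' \<Longrightarrow> G r c \<in> carrier R" using Gcc c EE by blast
    have "(\<Oplus>r\<in>E. z r \<otimes> G r c) = z r1 \<otimes> G r1 c \<oplus> (\<Oplus>r\<in>E'. z r \<otimes> G r c)"
      unfolding EE(1) using EE z Gcc[OF _ c] by (intro finsum_insert) auto
    also have "(\<Oplus>r\<in>E'. z r \<otimes> G r c) = (\<Oplus>r\<in>E'. g \<otimes> (y r \<otimes> G r c))"
      using EE(2) gE yc g by (intro finsum_cong') (auto simp: z_def m_assoc)
    also have "\<dots> = g \<otimes> (\<Oplus>r\<in>E'. y r \<otimes> G r c)" using EE(3) gE yc g by (intro finsum_rdistr[symmetric]) auto
    finally show ?thesis by (simp add: z_def)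
  qed
  have "(\<Oplus>r\<in>E. z r \<otimes> G r c) = (s \<otimes> g) \<otimes> w c" if c: "c \<in> insert c1 C" for c
  proof (cases "c = c1")
    case True
    have "(a \<ominus> b) \<otimes> g \<oplus> g \<otimes> b = a \<otimes> g" if "a \<in> carrier R" "b \<in> carrier R" for a b
      using that g(1) by algebra
    from this[of "s \<otimes> w c1" B] show ?thesis
      unfolding split[OF c] using True B sc wcc g(1) by (simp add: B_def[symmetric] g_def[symmetric] m_ac)
  next
    case False
    then have c': "c \<in> C" using c by simp
    define H where "H = (\<Oplus>r\<in>E'. y r \<otimes> G r c)"
    have H: "H \<in> carrier R" unfolding H_def using yc GE c' by (intro finsum_closed) auto
    have "s \<otimes> w' c = (\<Oplus>r\<in>E'. y r \<otimes> G' r c)" using sy[OF c'] by simp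
    also have "\<dots> = (\<Oplus>r\<in>E'. g \<otimes> (y r \<otimes> G r c) \<oplus> (\<ominus> G r1 c) \<otimes> (y r \<otimes> G r c1))"
    proof (rule finsum_cong'[OF refl])
      show "(\<lambda>r. g \<otimes> (y r \<otimes> G r c) \<oplus> (\<ominus> G r1 c) \<otimes> (y r \<otimes> G r c1)) \<in> E' \<rightarrow> carrier R"
        using yc GE c' Gr1 g by simp
      fix r assume r: "r \<in> E'"
      have "f \<otimes> (a \<otimes> b \<ominus> d \<otimes> e) = a \<otimes> (f \<otimes> b) \<oplus> (\<ominus> e) \<otimes> (f \<otimes> d)"
        if "a \<in> carrier R" "b \<in> carrier R" "d \<in> carrier R" "e \<in> carrier R" "f \<in> carrier R" for a b d e f
        using that by algebra
      then show "y r \<otimes> G' r c = g \<otimes> (y r \<otimes> G r c) \<oplus> (\<ominus> G r1 c) \<otimes> (y r \<otimes> G r c1)"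
        unfolding G'_def using GE(1)[OF r c'] GE(2)[OF r] Gr1[OF c'] yc[OF r] g(1) by blast
    qed
    also have "\<dots> = (\<Oplus>r\<in>E'. g \<otimes> (y r \<otimes> G r c)) \<oplus> (\<Oplus>r\<in>E'. (\<ominus> G r1 c) \<otimes> (y r \<otimes> G r c1))"
      using yc GE c' Gr1 g by (intro finsum_addf) auto
    also have "(\<Oplus>r\<in>E'. g \<otimes> (y r \<otimes> G r c)) = g \<otimes> H"
      unfolding H_def using EE(3) yc GE c' g by (intro finsum_rdistr[symmetric]) auto
    also have "(\<Oplus>r\<in>E'. (\<ominus> G r1 c) \<otimes> (y r \<otimes> G r c1)) = (\<ominus> G r1 c) \<otimes> B"
      unfolding B_def using EE(3) yc GE c' Gr1 by (intro finsum_rdistr[symmetric]) auto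
    finally have key: "s \<otimes> (g \<otimes> w c \<ominus> w c1 \<otimes> G r1 c) = g \<otimes> H \<oplus> (\<ominus> G r1 c) \<otimes> B" unfolding w'_def .
    have alg: "(s \<otimes> b \<ominus> B) \<otimes> d \<oplus> X = s \<otimes> g \<otimes> e"
      if k: "s \<otimes> (g \<otimes> e \<ominus> b \<otimes> d) = X \<oplus> (\<ominus> d) \<otimes> B" and cc: "b \<in> carrier R" "d \<in> carrier R" "e \<in> carrier R" "X \<in> carrier R"
      for b d e X
    proof -
      have "(s \<otimes> b \<ominus> B) \<otimes> d \<oplus> X = s \<otimes> b \<otimes> d \<oplus> (X \<oplus> (\<ominus> d) \<otimes> B)" using cc sc B by algebra
      also have "\<dots> = s \<otimes> b \<otimes> d \<oplus> s \<otimes> (g \<otimes> e \<ominus> b \<otimes> d)" unfolding k ..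
      also have "\<dots> = s \<otimes> g \<otimes> e" using cc sc g(1) by algebra
      finally show ?thesis .
    qed
    show ?thesis unfolding split[OF c] H_def[symmetric]
      using alg[OF key] wcc(1) wcc(2)[OF c'] Gr1[OF c'] H g(1) by simp
  qed
  then show ?case using z prime_compl_mult[OF P s g(2)] by blast
qed

end

section \<open>Generators and relations of Frobenius at a prime\<close>

locale frobenius_ring = noetherian_cring +
  fixes p :: nat
  assumes prime_p: "prime p" and char_p: "[p] \<cdot>\<^bsub>R\<^esub> \<one> = \<zero>"
begin

lemma p_pos: "p > 0" using prime_p prime_gt_0_nat by blast

lemma frob_add: "x \<in> carrier R \<Longrightarrow> y \<in> carrier R \<Longrightarrow> (x \<oplus> y) [^] p = x [^] p \<oplus> y [^] p"
  using frobenius_add[OF prime_p char_p] .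

lemma zero_pow_p: "\<zero> [^] p = \<zero>" using p_pos by (cases p) auto

text \<open>
  The linear combination of the elements of \<open>E\<close> in \<open>F\<^sub>*R\<close> with coefficients \<open>a\<close>.
\<close>

definition comb :: "('a \<Rightarrow> 'a) \<Rightarrow> 'a set \<Rightarrow> 'a"
  where "comb a E = (\<Oplus>e\<in>E. a e [^] p \<otimes> e)"

lemma comb_closed: "a \<in> E \<rightarrow> carrier R \<Longrightarrow> E \<subseteq> carrier R \<Longrightarrow> comb a E \<in> carrier R"
  unfolding comb_def by (intro finsum_closed) auto

lemma comb_cong: "(\<And>e. e \<in> E \<Longrightarrow> a e = b e) \<Longrightarrow> b \<in> E \<rightarrow> carrier R \<Longrightarrow> E \<subseteq> carrier R \<Longrightarrow> comb a E = comb b E"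
  unfolding comb_def by (intro finsum_cong') auto

lemma comb_add:
  assumes a: "a \<in> E \<rightarrow> carrier R" and b: "b \<in> E \<rightarrow> carrier R" and E: "E \<subseteq> carrier R"
  shows "comb a E \<oplus> comb b E = comb (\<lambda>e. a e \<oplus> b e) E"
proof -
  have c: "a e \<in> carrier R" "b e \<in> carrier R" "e \<in> carrier R" if "e \<in> E" for e using a b E that by auto
  have "comb a E \<oplus> comb b E = (\<Oplus>e\<in>E. a e [^] p \<otimes> e \<oplus> b e [^] p \<otimes> e)"
    unfolding comb_def using c by (intro finsum_addf[symmetric]) auto
  also have "\<dots> = comb (\<lambda>e. a e \<oplus> b e) E"
    unfolding comb_def using c by (intro finsum_cong') (auto simp: frob_add l_distr)
  finally show ?thesis .
qed

lemma comb_scale: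
  assumes "finite E" "a \<in> E \<rightarrow> carrier R" "r \<in> carrier R" "E \<subseteq> carrier R"
  shows "r [^] p \<otimes> comb a E = comb (\<lambda>e. r \<otimes> a e) E"
  unfolding comb_def using assms
  by (subst finsum_rdistr) (auto intro!: finsum_cong' simp: nat_pow_distrib m_assoc Pi_iff subset_iff)

lemma comb_zero: "E \<subseteq> carrier R \<Longrightarrow> comb (\<lambda>_. \<zero>) E = \<zero>"
  unfolding comb_def by (intro add.finprod_one_eqI) (auto simp: zero_pow_p)

lemma comb_uminus:
  assumes "finite E" "a \<in> E \<rightarrow> carrier R" "E \<subseteq> carrier R"
  shows "\<ominus> comb a E = comb (\<lambda>e. \<ominus> a e) E"
proof -
  have "comb a E \<oplus> comb (\<lambda>e. \<ominus> a e) E = comb (\<lambda>e. a e \<oplus> \<ominus> a e) E"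
    using assms by (intro comb_add) auto
  also have "\<dots> = comb (\<lambda>_. \<zero>) E" using assms by (intro comb_cong) (auto simp: r_neg Pi_iff)
  finally have "comb (\<lambda>e. \<ominus> a e) E \<oplus> comb a E = \<zero>"
    using comb_zero[OF assms(3)] comb_closed[of "\<lambda>e. \<ominus> a e" E] comb_closed[of a E] assms
    by (simp add: a_comm Pi_iff)
  then show ?thesis using comb_closed[of "\<lambda>e. \<ominus> a e" E] comb_closed[of a E] assms
    by (simp add: minus_equality Pi_iff)
qed

lemma comb_minus:
  assumes "finite E" "a \<in> E \<rightarrow> carrier R" "b \<in> E \<rightarrow> carrier R" "E \<subseteq> carrier R"
  shows "comb a E \<ominus> comb b E = comb (\<lambda>e. a e \<ominus> b e) E"
  using comb_add[of a E "\<lambda>e. \<ominus> b e"] comb_uminus[of E b] assms by (simp add: a_minus_def Pi_iff)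

lemma comb_insert:
  "finite E \<Longrightarrow> e1 \<notin> E \<Longrightarrow> insert e1 E \<subseteq> carrier R \<Longrightarrow> a \<in> insert e1 E \<rightarrow> carrier R
    \<Longrightarrow> comb a (insert e1 E) = a e1 [^] p \<otimes> e1 \<oplus> comb a E"
  unfolding comb_def by (intro finsum_insert) auto

lemma comb_ideal:
  assumes "ideal K R" "E \<subseteq> carrier R"
  shows "finite E \<Longrightarrow> (\<And>e. e \<in> E \<Longrightarrow> a e [^] p \<in> K) \<Longrightarrow> comb a E \<in> K"
proof -
  have "finite F \<Longrightarrow> F \<subseteq> E \<Longrightarrow> (\<And>e. e \<in> E \<Longrightarrow> a e [^] p \<in> K) \<Longrightarrow> finsum R (\<lambda>e. a e [^] p \<otimes> e) F \<in> K" for F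
  proof (induction F rule: finite_induct)
    case empty then show ?case using ideal_zero_closed[OF assms(1)] by simp
  next
    case (insert x F)
    have m: "\<And>e. e \<in> insert x F \<Longrightarrow> a e [^] p \<otimes> e \<in> K"
      using insert.prems assms(2) ideal.I_r_closed[OF assms(1)] by blast
    then have "(\<lambda>e. a e [^] p \<otimes> e) \<in> F \<rightarrow> carrier R" "a x [^] p \<otimes> x \<in> carrier R"
      using ideal.Icarr[OF assms(1)] by auto
    then have "finsum R (\<lambda>e. a e [^] p \<otimes> e) (insert x F) = a x [^] p \<otimes> x \<oplus> finsum R (\<lambda>e. a e [^] p \<otimes> e) F"
      using insert.hyps by simp
    then show ?case using ideal_add_closed[OF assms(1) m[of x]] insert by auto
  qed
  then show "finite E \<Longrightarrow> (\<And>e. e \<in> E \<Longrightarrow> a e [^] p \<in> K) \<Longrightarrow> comb a E \<in> K" by (simp add: comb_def)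
qed

end

locale frobenius_at_prime = frobenius_ring +
  fixes P
  assumes P: "primeideal P R"
begin

lemma P_ideal: "ideal P R" using P primeideal.axioms(1) by blast

text \<open>
  \<open>E\<close> generates \<open>F\<^sub>*R\<close> at \<open>P\<close>.
\<close>

definition spans :: "'a set \<Rightarrow> bool"
  where "spans E \<longleftrightarrow> finite E \<and> E \<subseteq> carrier R \<and>
    (\<forall>y\<in>carrier R. \<exists>s\<in>carrier R - P. \<exists>a\<in>E \<rightarrow> carrier R. s [^] p \<otimes> y = comb a E)"

text \<open>
  The elements of \<open>F\<^sub>*R\<close> that are locally combinations of \<open>E\<close> with coefficients in \<open>B\<close>, that is,
  \<open>B \<cdot> F\<^sub>*R\<close> at \<open>P\<close>. Denominators are \<open>p\<close>-th powers, as \<open>t\<close> acts on \<open>F\<^sub>*R\<close> through \<open>t\<^sup>p\<close>.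
\<close>

definition locspan :: "'a set \<Rightarrow> 'a set \<Rightarrow> 'a set"
  where "locspan E B = {w \<in> carrier R. \<exists>t\<in>carrier R - P. \<exists>b\<in>E \<rightarrow> B. t [^] p \<otimes> w = comb b E}"

lemma locspan_cancel:
  assumes "t \<in> carrier R - P" "w \<in> carrier R" "t [^] p \<otimes> w \<in> locspan E B"
  shows "w \<in> locspan E B"
proof -
  obtain s b where sb: "s \<in> carrier R - P" "b \<in> E \<rightarrow> B" "s [^] p \<otimes> (t [^] p \<otimes> w) = comb b E"
    using assms(3) unfolding locspan_def by blast
  have "(s \<otimes> t) [^] p \<otimes> w = comb b E" using sb assms by (simp add: nat_pow_distrib m_assoc)
  then show ?thesis using sb(2) prime_compl_mult[OF P sb(1) assms(1)] assms(2) unfolding locspan_def by blast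
qed

lemma locspan_add:
  assumes E: "spans E" and B: "ideal B R" and w: "w \<in> locspan E B" and w': "w' \<in> locspan E B"
  shows "w \<oplus> w' \<in> locspan E B"
proof -
  have fE: "finite E" "E \<subseteq> carrier R" using E by (auto simp: spans_def)
  obtain t b where tb: "t \<in> carrier R - P" "b \<in> E \<rightarrow> B" "t [^] p \<otimes> w = comb b E" "w \<in> carrier R"
    using w unfolding locspan_def by blast
  obtain t' b' where tb': "t' \<in> carrier R - P" "b' \<in> E \<rightarrow> B" "t' [^] p \<otimes> w' = comb b' E" "w' \<in> carrier R"
    using w' unfolding locspan_def by blast
  have bc: "b \<in> E \<rightarrow> carrier R" "b' \<in> E \<rightarrow> carrier R" using tb(2) tb'(2) ideal.Icarr[OF B] by auto
  have tc: "t \<in> carrier R" "t' \<in> carrier R" using tb tb' by auto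
  have alg: "(x \<otimes> x') \<otimes> (w \<oplus> w') = x' \<otimes> (x \<otimes> w) \<oplus> x \<otimes> (x' \<otimes> w')"
    if "x \<in> carrier R" "x' \<in> carrier R" for x x' using that tb(4) tb'(4) by algebra
  have "(t \<otimes> t') [^] p \<otimes> (w \<oplus> w') = t' [^] p \<otimes> comb b E \<oplus> t [^] p \<otimes> comb b' E"
    unfolding tb(3)[symmetric] tb'(3)[symmetric] using alg[of "t [^] p" "t' [^] p"] tc by (simp add: nat_pow_distrib)
  also have "\<dots> = comb (\<lambda>e. t' \<otimes> b e \<oplus> t \<otimes> b' e) E"
    using bc tc fE by (simp add: comb_scale comb_add Pi_iff)
  finally have "(t \<otimes> t') [^] p \<otimes> (w \<oplus> w') = comb (\<lambda>e. t' \<otimes> b e \<oplus> t \<otimes> b' e) E" .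
  moreover have "(\<lambda>e. t' \<otimes> b e \<oplus> t \<otimes> b' e) \<in> E \<rightarrow> B"
    using tb(2) tb'(2) tc ideal_add_closed[OF B] ideal.I_l_closed[OF B] by blast
  ultimately show ?thesis using prime_compl_mult[OF P tb(1) tb'(1)] tb(4) tb'(4) unfolding locspan_def by blast
qed

lemma locspan_zero: assumes "spans E" "ideal B R" shows "\<zero> \<in> locspan E B"
proof -
  have "\<one> [^] p \<otimes> \<zero> = comb (\<lambda>_. \<zero>) E" using comb_zero[of E] assms by (simp add: spans_def)
  moreover have "(\<lambda>_. \<zero>) \<in> E \<rightarrow> B" using ideal_zero_closed[OF assms(2)] by simp
  ultimately show ?thesis using prime_compl_one[OF P] unfolding locspan_def by blast
qed

lemma locspan_frob:
  assumes E: "spans E" and B: "ideal B R" and b: "b \<in> B" and y: "y \<in> carrier R"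
  shows "b [^] p \<otimes> y \<in> locspan E B"
proof -
  have fE: "finite E" "E \<subseteq> carrier R" using E by (auto simp: spans_def)
  have bc: "b \<in> carrier R" using ideal.Icarr[OF B b] .
  obtain s a where sa: "s \<in> carrier R - P" "a \<in> E \<rightarrow> carrier R" "s [^] p \<otimes> y = comb a E"
    using E y unfolding spans_def by blast
  have "s [^] p \<otimes> (b [^] p \<otimes> y) = b [^] p \<otimes> comb a E" unfolding sa(3)[symmetric] using sa(1) bc y by (simp add: m_lcomm)
  also have "\<dots> = comb (\<lambda>e. b \<otimes> a e) E" using comb_scale[OF fE(1) sa(2) bc fE(2)] .
  finally have "s [^] p \<otimes> (b [^] p \<otimes> y) = comb (\<lambda>e. b \<otimes> a e) E" .
  moreover have "(\<lambda>e. b \<otimes> a e) \<in> E \<rightarrow> B" using sa(2) ideal.I_r_closed[OF B b] by blast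
  ultimately show ?thesis using sa(1) bc y unfolding locspan_def by blast
qed

lemma locspan_ideal:
  assumes E: "spans E" and B: "ideal B R"
  shows "ideal (locspan E B) R"
proof (rule idealI_closed)
  show "locspan E B \<subseteq> carrier R" by (auto simp: locspan_def)
  show "\<zero> \<in> locspan E B" using locspan_zero[OF assms] .
  show "a \<oplus> b \<in> locspan E B" if "a \<in> locspan E B" "b \<in> locspan E B" for a b using locspan_add[OF assms that] .
  fix w r assume w: "w \<in> locspan E B" and r: "r \<in> carrier R"
  have fE: "finite E" "E \<subseteq> carrier R" using E by (auto simp: spans_def)
  obtain t b where tb: "t \<in> carrier R - P" "b \<in> E \<rightarrow> B" "t [^] p \<otimes> w = comb b E" "w \<in> carrier R"
    using w unfolding locspan_def by blast
  have bc: "b \<in> E \<rightarrow> carrier R" using tb(2) ideal.Icarr[OF B] by auto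
  have F: "finite F \<Longrightarrow> F \<subseteq> E \<Longrightarrow> (\<Oplus>e\<in>F. r \<otimes> (b e [^] p \<otimes> e)) \<in> locspan E B" for F
  proof (induction F rule: finite_induct)
    case (insert x F)
    have xc: "x \<in> carrier R" "b x \<in> B" "b x \<in> carrier R" using insert.prems fE tb(2) bc by auto
    have fc: "(\<lambda>e. r \<otimes> (b e [^] p \<otimes> e)) \<in> F \<rightarrow> carrier R" using insert.prems fE bc r by fastforce
    have "r \<otimes> (b x [^] p \<otimes> x) = b x [^] p \<otimes> (r \<otimes> x)" using r xc by (simp add: m_lcomm)
    then have "r \<otimes> (b x [^] p \<otimes> x) \<in> locspan E B" using locspan_frob[OF E B xc(2)] r xc(1) by simp
    moreover have "r \<otimes> (b x [^] p \<otimes> x) \<in> carrier R" using r xc by simp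
    ultimately show ?case using insert fc locspan_add[OF assms] by simp
  qed (use locspan_zero[OF assms] in simp)
  have "t [^] p \<otimes> (r \<otimes> w) = r \<otimes> comb b E" unfolding tb(3)[symmetric] using tb(1,4) r by (simp add: m_lcomm)
  also have "\<dots> = (\<Oplus>e\<in>E. r \<otimes> (b e [^] p \<otimes> e))" unfolding comb_def
    using fE bc r by (intro finsum_rdistr) auto
  finally have "t [^] p \<otimes> (r \<otimes> w) \<in> locspan E B" using F[OF fE(1)] by simp
  then show "r \<otimes> w \<in> locspan E B" using locspan_cancel[OF tb(1)] r tb(4) by simp
qed

text \<open>
  \<open>B \<cdot> F\<^sub>*R\<close> is the Frobenius power of \<open>B\<close>. The point is that the coefficients can be taken in
  \<open>B\<close>, because multiples by elements of \<open>R\<close> can be expanded again.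
\<close>

lemma loc_frobenius_power_locspan:
  assumes E: "spans E" and B: "ideal B R"
  shows "loc P (frobenius_power p 1 R B) \<subseteq> locspan E B"
proof
  fix w assume "w \<in> loc P (frobenius_power p 1 R B)"
  then obtain s where s: "s \<in> carrier R - P" "w \<in> carrier R" "s \<otimes> w \<in> frobenius_power p 1 R B" by (rule locE)
  have D: "ideal (locspan E B) R" using locspan_ideal[OF assms] .
  have "b [^] p \<in> locspan E B" if b: "b \<in> B" for b
    using locspan_frob[OF assms b one_closed] ideal.Icarr[OF B b] by simp
  then have "frobenius_power p 1 R B \<subseteq> locspan E B"
    unfolding frobenius_power_def using D by (intro genideal_minimal) auto
  then have "s \<otimes> w \<in> locspan E B" using s by blast
  then have "s [^] (p - 1) \<otimes> (s \<otimes> w) \<in> locspan E B" using ideal.I_l_closed[OF D] s by simp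
  moreover have "s [^] (p - 1) \<otimes> (s \<otimes> w) = s [^] p \<otimes> w" using s p_pos by (cases p) (auto simp: m_assoc)
  ultimately show "w \<in> locspan E B" using locspan_cancel[OF s(1,2)] by simp
qed

definition minimal_span :: "'a set \<Rightarrow> bool"
  where "minimal_span E \<longleftrightarrow> spans E \<and> (\<forall>F. spans F \<longrightarrow> card E \<le> card F)"

text \<open>
  A minimal generating set is independent modulo the maximal ideal: otherwise a coefficient
  \<open>a e1\<close> outside \<open>P\<close> in a relation modulo \<open>P \<cdot> F\<^sub>*R\<close> could be used to remove \<open>e1\<close>.
\<close>

lemma minimal_span_independent:
  assumes E: "minimal_span E" and a: "a \<in> E \<rightarrow> carrier R"
    and w: "comb a E \<in> loc P (frobenius_power p 1 R P)"
  shows "\<forall>e\<in>E. a e \<in> P"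
proof (rule ccontr)
  assume "\<not> ?thesis"
  then obtain e1 where e1: "e1 \<in> E" "a e1 \<notin> P" by blast
  have sE: "spans E" using E by (simp add: minimal_span_def)
  have fE: "finite E" "E \<subseteq> carrier R" using sE by (auto simp: spans_def)
  obtain t b where tb: "t \<in> carrier R - P" "b \<in> E \<rightarrow> P" "t [^] p \<otimes> comb a E = comb b E"
    using loc_frobenius_power_locspan[OF sE P_ideal] w unfolding locspan_def by blast
  have tc: "t \<in> carrier R" using tb by simp
  have bc: "b \<in> E \<rightarrow> carrier R" using tb(2) ideal.Icarr[OF P_ideal] by auto
  \<comment> \<open>an exact relation whose coefficient at \<open>e1\<close> is still outside \<open>P\<close>\<close>
  define d where "d e = t \<otimes> a e \<ominus> b e" for e
  have dc: "d \<in> E \<rightarrow> carrier R" unfolding d_def using a bc tc by auto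
  have d0: "comb d E = \<zero>"
  proof -
    have "comb d E = comb (\<lambda>e. t \<otimes> a e) E \<ominus> comb b E" unfolding d_def
      using fE a bc tc by (intro comb_minus[symmetric]) auto
    also have "comb (\<lambda>e. t \<otimes> a e) E = comb b E" using comb_scale[OF fE(1) a tc fE(2)] tb(3) by simp
    finally show ?thesis using comb_closed[OF bc fE(2)] by simp
  qed
  define g where "g = d e1"
  have g: "g \<in> carrier R - P"
  proof -
    have "t \<otimes> a e1 \<notin> P" using prime_compl_mult[OF P tb(1), of "a e1"] e1 a by auto
    moreover have "(t \<otimes> a e1 \<ominus> b e1) \<oplus> b e1 = t \<otimes> a e1"
    proof -
      have "(x \<ominus> y) \<oplus> y = x" if "x \<in> carrier R" "y \<in> carrier R" for x y using that by algebra
      moreover have "t \<otimes> a e1 \<in> carrier R" "b e1 \<in> carrier R" using a bc tc e1 by auto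
      ultimately show ?thesis by blast
    qed
    ultimately have "d e1 \<notin> P" unfolding d_def using ideal_add_closed[OF P_ideal, of "t \<otimes> a e1 \<ominus> b e1" "b e1"] tb(2) e1 by auto
    then show ?thesis using dc e1 by (auto simp: g_def)
  qed
  define F where "F = E - {e1}"
  have F: "E = insert e1 F" "e1 \<notin> F" "finite F" "F \<subseteq> carrier R" using e1 fE by (auto simp: F_def)
  have dF: "d \<in> F \<rightarrow> carrier R" and e1c: "e1 \<in> carrier R" using dc F fE by auto
  have ge: "g [^] p \<otimes> e1 = comb (\<lambda>e. \<ominus> d e) F"
  proof -
    have "g [^] p \<otimes> e1 \<oplus> comb d F = \<zero>"
      using comb_insert[OF F(3,2), of d] d0 dc fE F(1) by (simp add: g_def)
    then have "g [^] p \<otimes> e1 = \<ominus> comb d F" using comb_closed[OF dF F(4)] g e1c by (simp add: minus_equality)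
    then show ?thesis using comb_uminus[OF F(3) dF F(4)] by simp
  qed
  have "spans F" unfolding spans_def
  proof (intro conjI ballI F(3,4))
    fix y assume y: "y \<in> carrier R"
    obtain s c where sc: "s \<in> carrier R - P" "c \<in> E \<rightarrow> carrier R" "s [^] p \<otimes> y = comb c E"
      using sE y unfolding spans_def by blast
    have cc: "c e1 \<in> carrier R" "c \<in> F \<rightarrow> carrier R" using sc F by auto
    have dm: "(\<lambda>e. \<ominus> d e) \<in> F \<rightarrow> carrier R" using dF by auto
    have "(g \<otimes> s) [^] p \<otimes> y = g [^] p \<otimes> comb c E" unfolding sc(3)[symmetric]
      using g sc(1) y by (simp add: nat_pow_distrib m_assoc)
    also have "comb c E = c e1 [^] p \<otimes> e1 \<oplus> comb c F"
      unfolding F(1) using F fE sc(2) by (intro comb_insert) auto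
    also have "g [^] p \<otimes> (c e1 [^] p \<otimes> e1 \<oplus> comb c F) = c e1 [^] p \<otimes> (g [^] p \<otimes> e1) \<oplus> g [^] p \<otimes> comb c F"
      using g cc e1c comb_closed[OF cc(2) F(4)] by (simp add: r_distr m_lcomm)
    also have "\<dots> = comb (\<lambda>e. c e1 \<otimes> \<ominus> d e) F \<oplus> comb (\<lambda>e. g \<otimes> c e) F"
      unfolding ge using comb_scale[OF F(3) dm cc(1) F(4)] comb_scale[OF F(3) cc(2) _ F(4), of g] g by simp
    also have "\<dots> = comb (\<lambda>e. c e1 \<otimes> \<ominus> d e \<oplus> g \<otimes> c e) F"
      using dm cc g F(4) by (intro comb_add) auto
    finally have "(g \<otimes> s) [^] p \<otimes> y = comb (\<lambda>e. c e1 \<otimes> \<ominus> d e \<oplus> g \<otimes> c e) F" .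
    moreover have "(\<lambda>e. c e1 \<otimes> \<ominus> d e \<oplus> g \<otimes> c e) \<in> F \<rightarrow> carrier R" using dm cc g by auto
    ultimately show "\<exists>s\<in>carrier R - P. \<exists>a\<in>F \<rightarrow> carrier R. s [^] p \<otimes> y = comb a F"
      using prime_compl_mult[OF P g sc(1)] by blast
  qed
  then have "card E \<le> card F" using E by (simp add: minimal_span_def)
  moreover have "card F < card E" unfolding F_def using card_Diff1_less[OF fE(1) e1(1)] .
  ultimately show False by simp
qed

text \<open>
  Relations among the elements of \<open>E\<close> in \<open>F\<^sub>*R/B\<close> have coefficients in \<open>A\<close>. In the applications
  \<open>B\<close> is \<open>A \<cdot> F\<^sub>*R\<close>, so this is linear independence over \<open>R/A\<close>, at \<open>P\<close>.
\<close>

definition independent_mod :: "'a set \<Rightarrow> 'a set \<Rightarrow> 'a set \<Rightarrow> bool"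
  where "independent_mod E B A \<longleftrightarrow>
    (\<forall>a\<in>E \<rightarrow> carrier R. comb a E \<in> loc P B \<longrightarrow> (\<forall>e\<in>E. a e \<in> loc P A))"

text \<open>
  Independence descends along a regular sequence on \<open>F\<^sub>*R\<close>, on which \<open>x\<close> acts as \<open>x\<^sup>p\<close>. One element
  \<open>x\<close> is removed at a time. A relation modulo \<open>B\<close> is also one modulo \<open>B + (x\<^sup>p)\<close>, so its coefficients
  are \<open>x b\<close> modulo \<open>A\<close>; since \<open>x\<^sup>p\<close> is regular, the elements \<open>b\<close> are again coefficients of a
  relation. The ideal \<open>T\<close> of all coefficients that occur at a fixed place thus satisfies
  \<open>T \<subseteq> A + x T\<close>.
\<close>

lemma independent_mod_descend:
  assumes E: "finite E" "E \<subseteq> carrier R"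
  shows "ideal A R \<Longrightarrow> ideal B R \<Longrightarrow> set xs \<subseteq> P \<Longrightarrow> (\<And>a. a \<in> A \<Longrightarrow> a [^] p \<in> B)
    \<Longrightarrow> regular_seq P B (map (\<lambda>x. x [^] p) xs)
    \<Longrightarrow> independent_mod E (adjoins B (map (\<lambda>x. x [^] p) xs)) (adjoins A xs)
    \<Longrightarrow> independent_mod E B A"
proof (induction xs arbitrary: A B)
  case (Cons x xs)
  note A = Cons.prems(1) and B = Cons.prems(2) and AB = Cons.prems(4)
  have x: "x \<in> P" "x \<in> carrier R" "x [^] p \<in> carrier R" using Cons.prems(3) ideal.Icarr[OF P_ideal] by auto
  have Ax: "ideal (adjoin A x) R" and Bx: "ideal (adjoin B (x [^] p)) R" using adjoin_ideal A B x by auto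
  have lB: "ideal (loc P B) R" using loc_ideal[OF P B] .
  have reg: "\<And>a. a \<in> carrier R \<Longrightarrow> x [^] p \<otimes> a \<in> loc P B \<Longrightarrow> a \<in> loc P B"
    and regs: "regular_seq P (adjoin B (x [^] p)) (map (\<lambda>x. x [^] p) xs)" using Cons.prems(5) by simp_all
  have "a [^] p \<in> adjoin B (x [^] p)" if a: "a \<in> adjoin A x" for a
  proof -
    obtain k r where kr: "k \<in> A" "r \<in> carrier R" "a = k \<oplus> r \<otimes> x" using a by (rule adjoinE)
    have "a [^] p = k [^] p \<oplus> r [^] p \<otimes> x [^] p"
      unfolding kr(3) using kr(2) x ideal.Icarr[OF A kr(1)] by (simp add: frob_add nat_pow_distrib)
    then show ?thesis using adjoinI[OF AB[OF kr(1)]] kr(2) by simp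
  qed
  then have IH: "independent_mod E (adjoin B (x [^] p)) (adjoin A x)"
    using Cons.IH[OF Ax Bx _ _ regs] Cons.prems by simp
  show ?case unfolding independent_mod_def
  proof (intro ballI impI)
    fix a0 e0 assume a0: "a0 \<in> E \<rightarrow> carrier R" "comb a0 E \<in> loc P B" and e0: "e0 \<in> E"
    \<comment> \<open>the coefficients at \<open>e0\<close> of all relations modulo \<open>B\<close>\<close>
    define T where "T = {a e0 | a. a \<in> E \<rightarrow> carrier R \<and> comb a E \<in> loc P B}"
    have T: "ideal T R"
    proof (rule idealI_closed)
      show "T \<subseteq> carrier R" using e0 by (auto simp: T_def)
      have "comb (\<lambda>_. \<zero>) E \<in> loc P B" using comb_zero[OF E(2)] ideal_zero_closed[OF lB] by simp
      then show "\<zero> \<in> T" unfolding T_def by (intro CollectI exI[of _ "\<lambda>_. \<zero>"]) simp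
      show "u \<oplus> v \<in> T" if uv: "u \<in> T" "v \<in> T" for u v
      proof -
        obtain a b where ab: "a \<in> E \<rightarrow> carrier R" "comb a E \<in> loc P B" "u = a e0"
          "b \<in> E \<rightarrow> carrier R" "comb b E \<in> loc P B" "v = b e0" using uv unfolding T_def by blast
        have "comb (\<lambda>e. a e \<oplus> b e) E \<in> loc P B"
          using comb_add[OF ab(1,4) E(2)] ideal_add_closed[OF lB ab(2,5)] by simp
        then show ?thesis unfolding T_def using ab
          by (intro CollectI exI[of _ "\<lambda>e. a e \<oplus> b e"]) auto
      qed
      show "r \<otimes> u \<in> T" if ur: "u \<in> T" "r \<in> carrier R" for u r
      proof -
        obtain a where ab: "a \<in> E \<rightarrow> carrier R" "comb a E \<in> loc P B" "u = a e0" using ur unfolding T_def by blast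
        have "comb (\<lambda>e. r \<otimes> a e) E \<in> loc P B"
          using comb_scale[OF E(1) ab(1) ur(2) E(2)] ideal.I_l_closed[OF lB ab(2), of "r [^] p"] ur(2) by simp
        then show ?thesis unfolding T_def using ab ur(2)
          by (intro CollectI exI[of _ "\<lambda>e. r \<otimes> a e"]) auto
      qed
    qed
    have "T \<subseteq> loc P A"
    proof (rule nakayama[OF P T A])
      fix k assume "k \<in> T"
      then obtain a where a: "a \<in> E \<rightarrow> carrier R" "comb a E \<in> loc P B" "k = a e0" unfolding T_def by blast
      have "comb a E \<in> loc P (adjoin B (x [^] p))"
        using a(2) loc_mono[OF adjoin_incl[OF B x(3)]] by blast
      then have "\<forall>e\<in>E. a e \<in> loc P (adjoin A x)" using IH a(1) unfolding independent_mod_def by blast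
      then obtain s where s: "s \<in> carrier R - P" "\<forall>e\<in>E. s \<otimes> a e \<in> adjoin A x"
        using common_denominator[OF P Ax E(1)] by blast
      have "\<forall>e\<in>E. \<exists>lb. fst lb \<in> A \<and> snd lb \<in> carrier R \<and> s \<otimes> a e = fst lb \<oplus> snd lb \<otimes> x"
      proof
        fix e assume "e \<in> E"
        then have "s \<otimes> a e \<in> adjoin A x" using s(2) by blast
        then obtain l b where "l \<in> A" "b \<in> carrier R" "s \<otimes> a e = l \<oplus> b \<otimes> x" by (rule adjoinE)
        then show "\<exists>lb. fst lb \<in> A \<and> snd lb \<in> carrier R \<and> s \<otimes> a e = fst lb \<oplus> snd lb \<otimes> x"
          by (intro exI[of _ "(l, b)"]) simp
      qed
      from bchoice[OF this] obtain f where
        f: "\<forall>e\<in>E. fst (f e) \<in> A \<and> snd (f e) \<in> carrier R \<and> s \<otimes> a e = fst (f e) \<oplus> snd (f e) \<otimes> x" by blast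
      define l where "l e = fst (f e)" for e
      define b where "b e = snd (f e)" for e
      have lA: "\<And>e. e \<in> E \<Longrightarrow> l e \<in> A" and bc: "b \<in> E \<rightarrow> carrier R"
        and sa: "\<And>e. e \<in> E \<Longrightarrow> s \<otimes> a e = l e \<oplus> x \<otimes> b e"
        using f x(2) by (auto simp: l_def b_def m_comm)
      have lc: "l \<in> E \<rightarrow> carrier R" using lA ideal.Icarr[OF A] by blast
      have sc: "s \<in> carrier R" using s(1) by simp
      have "s [^] p \<otimes> comb a E = comb (\<lambda>e. l e \<oplus> x \<otimes> b e) E"
        unfolding comb_scale[OF E(1) a(1) sc E(2)] using sa lc bc x(2) E(2) by (intro comb_cong) (auto simp: Pi_iff)
      also have "\<dots> = comb l E \<oplus> comb (\<lambda>e. x \<otimes> b e) E" using lc bc x(2) E(2) by (intro comb_add[symmetric]) auto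
      also have "comb (\<lambda>e. x \<otimes> b e) E = x [^] p \<otimes> comb b E" using comb_scale[OF E(1) bc x(2) E(2)] by simp
      finally have eq: "s [^] p \<otimes> comb a E = comb l E \<oplus> x [^] p \<otimes> comb b E" .
      have lB': "comb l E \<in> loc P B" using comb_ideal[OF B E(2,1)] AB lA loc_incl[OF P B] by blast
      have "s [^] p \<otimes> comb a E \<in> loc P B" using ideal.I_l_closed[OF lB a(2)] sc by simp
      moreover have "(u \<oplus> v) \<ominus> u = v" if "u \<in> carrier R" "v \<in> carrier R" for u v using that by algebra
      ultimately have "x [^] p \<otimes> comb b E \<in> loc P B"
        using ideal_minus_closed[OF lB _ lB'] eq comb_closed[OF lc E(2)] comb_closed[OF bc E(2)] x(3)
        by (metis m_closed)
      then have "comb b E \<in> loc P B" using reg comb_closed[OF bc E(2)] by blast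
      then have "b e0 \<in> T" unfolding T_def using bc by blast
      then have "x \<otimes> b e0 \<in> P \<cdot> T" using x(1) ideal_prod.prod by metis
      then show "\<exists>l\<in>A. \<exists>w\<in>P \<cdot> T. \<exists>s\<in>carrier R - P. s \<otimes> k = l \<oplus> w"
        using sa[OF e0] lA[OF e0] s(1) unfolding a(3) by blast
    qed
    moreover have "a0 e0 \<in> T" unfolding T_def using a0 by blast
    ultimately show "a0 e0 \<in> loc P A" by blast
  qed
qed simp

end

section \<open>A local generator of the Cartier maps\<close>

context frobenius_ring
begin

text \<open>
  After \<open>s\<close> has been inverted, the elements \<open>x\<close> generate \<open>F\<^sup>e\<^sub>*R\<close>, and the maps \<open>\<Phi>(c \<cdot>)\<close> give the
  coefficients. So this encodes at once that \<open>F\<^sup>e\<^sub>*R\<close> is projective and that \<open>\<Phi>\<close> generates the Cartier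
  maps.
\<close>

definition trace_basis :: "nat \<Rightarrow> 'a \<Rightarrow> ('a \<Rightarrow> 'a) \<Rightarrow> ('a \<times> 'a) list \<Rightarrow> bool"
  where "trace_basis q s \<Phi> L \<longleftrightarrow> \<Phi> \<in> cartier_maps q \<and> set L \<subseteq> carrier R \<times> carrier R \<and>
    (\<forall>y\<in>carrier R. s [^] q \<otimes> y = lsum (\<lambda>(c, x). \<Phi> (c \<otimes> y) [^] q \<otimes> x) L)"

lemma cartier_compose:
  assumes "\<phi> \<in> cartier_maps q" "\<psi> \<in> cartier_maps q'"
  shows "\<psi> \<circ> \<phi> \<in> cartier_maps (q * q')"
proof -
  have "\<psi> (\<phi> (r [^] (q * q') \<otimes> x)) = r \<otimes> \<psi> (\<phi> x)" if "r \<in> carrier R" "x \<in> carrier R" for r x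
  proof -
    have "r [^] (q * q') = (r [^] q') [^] q" using that by (simp add: nat_pow_pow mult.commute)
    then show ?thesis using cartierD[OF assms(1)] cartierD[OF assms(2)] that by simp
  qed
  then show ?thesis using cartierD[OF assms(1)] cartierD[OF assms(2)]
    by (auto simp: cartier_maps_def)
qed

text \<open>
  Expand \<open>y\<close> with respect to \<open>\<Phi>\<close>, and then the coefficients \<open>\<Phi>(c y)\<close> with respect to \<open>\<Psi>\<close>. The
  factor \<open>s\<close> to the power \<open>p\<^sup>e\<^sup>+\<^sup>1 - p\<close> only serves to raise \<open>s\<^sup>p\<close> to the power that the definition asks
  for.
\<close>

lemma trace_basis_compose:
  assumes 1: "trace_basis p s \<Phi> L" and 2: "trace_basis (p ^ e) t \<Psi> M" and st: "s \<in> carrier R" "t \<in> carrier R"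
  shows "trace_basis (p ^ Suc e) (s \<otimes> t) (\<Psi> \<circ> \<Phi>)
    (concat (map (\<lambda>(c, x). map (\<lambda>(d, z). (d [^] p \<otimes> c, s [^] (p ^ Suc e - p) \<otimes> (z [^] p \<otimes> x))) M) L))"
proof -
  let ?q = "p ^ e" and ?r = "p ^ Suc e"
  have \<Phi>: "\<Phi> \<in> cartier_maps p" and Lc: "set L \<subseteq> carrier R \<times> carrier R"
    and L: "\<And>y. y \<in> carrier R \<Longrightarrow> s [^] p \<otimes> y = lsum (\<lambda>(c, x). \<Phi> (c \<otimes> y) [^] p \<otimes> x) L"
    using 1 by (auto simp: trace_basis_def)
  have \<Psi>: "\<Psi> \<in> cartier_maps ?q" and Mc: "set M \<subseteq> carrier R \<times> carrier R"
    and M: "\<And>y. y \<in> carrier R \<Longrightarrow> t [^] ?q \<otimes> y = lsum (\<lambda>(c, x). \<Psi> (c \<otimes> y) [^] ?q \<otimes> x) M"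
    using 2 by (auto simp: trace_basis_def)
  have pw: "z [^] ?r = (z [^] ?q) [^] p" if "z \<in> carrier R" for z using that by (simp add: nat_pow_pow mult.commute)
  have rp: "?r = (?r - p) + p" using p_pos by (simp add: Suc_leI)
  let ?v = "s [^] (?r - p)"
  have v: "?v \<in> carrier R" using st by simp
  have inner: "t [^] ?r \<otimes> (\<Phi> (c \<otimes> y) [^] p \<otimes> x)
      = lsum (\<lambda>(d, z). \<Psi> (\<Phi> ((d [^] p \<otimes> c) \<otimes> y)) [^] ?r \<otimes> (z [^] p \<otimes> x)) M"
    if y: "y \<in> carrier R" and cx: "c \<in> carrier R" "x \<in> carrier R" for y c x
  proof -
    have f: "\<Phi> (c \<otimes> y) \<in> carrier R" using cartierD(1)[OF \<Phi>] y cx by simp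
    have dz: "d \<in> carrier R \<and> z \<in> carrier R" if "(d, z) \<in> set M" for d z using Mc that by auto
    have mem: "(case u of (d, z) \<Rightarrow> \<Psi> (d \<otimes> \<Phi> (c \<otimes> y)) [^] ?q \<otimes> z) \<in> carrier R" if "u \<in> set M" for u
      using Mc that cartierD(1)[OF \<Psi>] f by (auto split: prod.split)
    have "t [^] ?r \<otimes> (\<Phi> (c \<otimes> y) [^] p \<otimes> x) = (t [^] ?q \<otimes> \<Phi> (c \<otimes> y)) [^] p \<otimes> x"
      unfolding pw[OF st(2)] using st f cx by (simp add: nat_pow_distrib m_assoc)
    also have "t [^] ?q \<otimes> \<Phi> (c \<otimes> y) = lsum (\<lambda>(d, z). \<Psi> (d \<otimes> \<Phi> (c \<otimes> y)) [^] ?q \<otimes> z) M" using M[OF f] .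
    also have "\<dots> [^] p = lsum (\<lambda>u. (case u of (d, z) \<Rightarrow> \<Psi> (d \<otimes> \<Phi> (c \<otimes> y)) [^] ?q \<otimes> z) [^] p) M"
      using mem by (intro lsum_hom[where h = "\<lambda>x. x [^] p"]) (auto simp: frob_add zero_pow_p)
    also have "\<dots> \<otimes> x = lsum (\<lambda>u. x \<otimes> (case u of (d, z) \<Rightarrow> \<Psi> (d \<otimes> \<Phi> (c \<otimes> y)) [^] ?q \<otimes> z) [^] p) M"
    proof -
      have "lsum (\<lambda>u. (case u of (d, z) \<Rightarrow> \<Psi> (d \<otimes> \<Phi> (c \<otimes> y)) [^] ?q \<otimes> z) [^] p) M \<in> carrier R"
        using mem by (intro lsum_closed) auto
      then show ?thesis using mem cx by (subst m_comm) (auto intro!: lsum_rdistr)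
    qed
    also have "\<dots> = lsum (\<lambda>(d, z). \<Psi> (\<Phi> ((d [^] p \<otimes> c) \<otimes> y)) [^] ?r \<otimes> (z [^] p \<otimes> x)) M"
    proof (rule lsum_cong)
      fix u assume u: "u \<in> set M"
      obtain d z where dz': "u = (d, z)" by (cases u)
      have dzc: "d \<in> carrier R" "z \<in> carrier R" using dz u dz' by auto
      have "\<Phi> ((d [^] p \<otimes> c) \<otimes> y) = d \<otimes> \<Phi> (c \<otimes> y)"
        using cartierD(3)[OF \<Phi> dzc(1), of "c \<otimes> y"] dzc cx y by (simp add: m_assoc)
      moreover have "\<Psi> (d \<otimes> \<Phi> (c \<otimes> y)) \<in> carrier R" using cartierD(1)[OF \<Psi>] dzc f by simp
      ultimately show "x \<otimes> (case u of (d, z) \<Rightarrow> \<Psi> (d \<otimes> \<Phi> (c \<otimes> y)) [^] ?q \<otimes> z) [^] p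
          = (case u of (d, z) \<Rightarrow> \<Psi> (\<Phi> ((d [^] p \<otimes> c) \<otimes> y)) [^] ?r \<otimes> (z [^] p \<otimes> x))"
        unfolding dz' using dzc cx by (simp add: pw nat_pow_distrib m_ac del: power_Suc)
    qed
    finally show ?thesis .
  qed
  show ?thesis unfolding trace_basis_def
  proof (intro conjI ballI)
    show "\<Psi> \<circ> \<Phi> \<in> cartier_maps ?r" using cartier_compose[OF \<Phi> \<Psi>] by simp
    show "set (concat (map (\<lambda>(c, x). map (\<lambda>(d, z). (d [^] p \<otimes> c, ?v \<otimes> (z [^] p \<otimes> x))) M) L)) \<subseteq> carrier R \<times> carrier R"
    proof
      fix u assume "u \<in> set (concat (map (\<lambda>(c, x). map (\<lambda>(d, z). (d [^] p \<otimes> c, ?v \<otimes> (z [^] p \<otimes> x))) M) L))"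
      then obtain c x d z where "(c, x) \<in> set L" "(d, z) \<in> set M" "u = (d [^] p \<otimes> c, ?v \<otimes> (z [^] p \<otimes> x))" by auto
      moreover have "c \<in> carrier R" "x \<in> carrier R" "d \<in> carrier R" "z \<in> carrier R" using calculation Lc Mc by auto
      ultimately show "u \<in> carrier R \<times> carrier R" using v by simp
    qed
    fix y assume y: "y \<in> carrier R"
    let ?F = "\<lambda>(c, x). (\<Psi> \<circ> \<Phi>) (c \<otimes> y) [^] ?r \<otimes> x"
    let ?g = "\<lambda>(c, x). map (\<lambda>(d, z). (d [^] p \<otimes> c, ?v \<otimes> (z [^] p \<otimes> x))) M"
    have Fc: "?F u \<in> carrier R" if "u \<in> carrier R \<times> carrier R" for u
    proof -
      obtain c x where u: "u = (c, x)" "c \<in> carrier R" "x \<in> carrier R" using \<open>u \<in> carrier R \<times> carrier R\<close> by blast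
      have "\<Psi> (\<Phi> (c \<otimes> y)) \<in> carrier R" using cartierD(1)[OF \<Psi> cartierD(1)[OF \<Phi>]] u y by simp
      then show ?thesis using u by simp
    qed
    have "lsum ?F (concat (map ?g L)) = lsum (\<lambda>t. lsum ?F (?g t)) L"
    proof (rule lsum_concat)
      fix w u assume wu: "w \<in> set L" "u \<in> set (?g w)"
      obtain c x where w: "w = (c, x)" by (cases w)
      obtain d z where u: "(d, z) \<in> set M" "u = (d [^] p \<otimes> c, ?v \<otimes> (z [^] p \<otimes> x))" using wu(2) w by auto
      have "c \<in> carrier R" "x \<in> carrier R" "d \<in> carrier R" "z \<in> carrier R" using wu(1) w u(1) Lc Mc by auto
      then have "u \<in> carrier R \<times> carrier R" using u(2) v by simp
      then show "?F u \<in> carrier R" by (rule Fc)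
    qed
    also have "\<dots> = lsum (\<lambda>u. (?v \<otimes> t [^] ?r) \<otimes> (case u of (c, x) \<Rightarrow> \<Phi> (c \<otimes> y) [^] p \<otimes> x)) L"
    proof (rule lsum_cong)
      fix u assume u: "u \<in> set L"
      obtain c x where cx': "u = (c, x)" by (cases u)
      have cx: "c \<in> carrier R" "x \<in> carrier R" using Lc u cx' by auto
      let ?H = "\<lambda>(d, z). \<Psi> (\<Phi> ((d [^] p \<otimes> c) \<otimes> y)) [^] ?r \<otimes> (z [^] p \<otimes> x)"
      have Hc: "?H w \<in> carrier R" if "w \<in> set M" for w
      proof -
        obtain d z where w: "w = (d, z)" by (cases w)
        have dz: "d \<in> carrier R" "z \<in> carrier R" using \<open>w \<in> set M\<close> Mc w by auto
        have "\<Psi> (\<Phi> ((d [^] p \<otimes> c) \<otimes> y)) \<in> carrier R" using cartierD(1)[OF \<Psi> cartierD(1)[OF \<Phi>]] dz cx y by simp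
        then show ?thesis using w dz cx by simp
      qed
      have "lsum ?F (?g u) = lsum (\<lambda>w. ?F ((\<lambda>(d, z). (d [^] p \<otimes> c, ?v \<otimes> (z [^] p \<otimes> x))) w)) M"
        unfolding cx' by (simp add: lsum_map)
      also have "\<dots> = lsum (\<lambda>w. ?v \<otimes> ?H w) M"
      proof (rule lsum_cong)
        fix w assume w: "w \<in> set M"
        obtain d z where dz': "w = (d, z)" by (cases w)
        have dz: "d \<in> carrier R" "z \<in> carrier R" using Mc w dz' by auto
        have "\<Psi> (\<Phi> ((d [^] p \<otimes> c) \<otimes> y)) [^] ?r \<in> carrier R"
          using dz cx y cartierD(1)[OF \<Phi>] cartierD(1)[OF \<Psi>] by simp
        then show "?F ((\<lambda>(d, z). (d [^] p \<otimes> c, ?v \<otimes> (z [^] p \<otimes> x))) w) = ?v \<otimes> ?H w"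
          unfolding dz' using dz cx v by (simp add: m_lcomm del: power_Suc)
      qed
      also have "\<dots> = ?v \<otimes> lsum ?H M" by (rule lsum_rdistr[OF v Hc, symmetric])
      also have "lsum ?H M = t [^] ?r \<otimes> (\<Phi> (c \<otimes> y) [^] p \<otimes> x)" using inner[OF y cx] by simp
      also have "?v \<otimes> \<dots> = (?v \<otimes> t [^] ?r) \<otimes> (\<Phi> (c \<otimes> y) [^] p \<otimes> x)"
        using v st cx y cartierD(1)[OF \<Phi>] by (simp add: m_assoc)
      finally show "lsum ?F (?g u) = (?v \<otimes> t [^] ?r) \<otimes> (case u of (c, x) \<Rightarrow> \<Phi> (c \<otimes> y) [^] p \<otimes> x)"
        unfolding cx' by simp
    qed
    also have "\<dots> = (?v \<otimes> t [^] ?r) \<otimes> lsum (\<lambda>u. case u of (c, x) \<Rightarrow> \<Phi> (c \<otimes> y) [^] p \<otimes> x) L"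
      using Lc v st y cartierD(1)[OF \<Phi>] by (intro lsum_rdistr[symmetric]) auto
    also have "lsum (\<lambda>u. case u of (c, x) \<Rightarrow> \<Phi> (c \<otimes> y) [^] p \<otimes> x) L = s [^] p \<otimes> y" using L[OF y] by simp
    also have "(?v \<otimes> t [^] ?r) \<otimes> (s [^] p \<otimes> y) = ((?v \<otimes> s [^] p) \<otimes> t [^] ?r) \<otimes> y"
      using v st y by (simp add: m_ac)
    also have "?v \<otimes> s [^] p = s [^] ?r" using st rp nat_pow_mult[of s "?r - p" p] by simp
    also have "s [^] ?r \<otimes> t [^] ?r = (s \<otimes> t) [^] ?r" using st by (simp add: nat_pow_distrib)
    finally show "(s \<otimes> t) [^] ?r \<otimes> y = lsum ?F (concat (map ?g L))" by simp
  qed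
qed

lemma trace_basis_iterate:
  assumes P: "primeideal P R" and 1: "trace_basis p s \<Phi> L" "s \<in> carrier R - P"
  shows "e > 0 \<Longrightarrow> \<exists>t\<in>carrier R - P. \<exists>\<Psi> M. trace_basis (p ^ e) t \<Psi> M"
proof (induction e)
  case (Suc e)
  show ?case
  proof (cases "e = 0")
    case True then show ?thesis using 1 by auto
  next
    case False
    then obtain t \<Psi> M where t: "t \<in> carrier R - P" "trace_basis (p ^ e) t \<Psi> M" using Suc by auto
    have "trace_basis (p ^ Suc e) (s \<otimes> t) (\<Psi> \<circ> \<Phi>)
      (concat (map (\<lambda>(c, x). map (\<lambda>(d, z). (d [^] p \<otimes> c, s [^] (p ^ Suc e - p) \<otimes> (z [^] p \<otimes> x))) M) L))"
      using trace_basis_compose[OF 1(1) t(2)] 1(2) t(1) by simp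
    then show ?thesis using prime_compl_mult[OF P 1(2) t(1)] by blast
  qed
qed simp

end

locale frobenius_regular = frobenius_at_prime R p P + regular_at_prime R P X
  for R (structure) and p P X +
  assumes F_fin: "F_finite p R"
begin

lemma global_span: "\<exists>U. finite U \<and> U \<subseteq> carrier R \<and> (\<forall>y\<in>carrier R. \<exists>c\<in>U \<rightarrow> carrier R. y = comb c U)"
proof -
  let ?F = "frobenius_pushforward p 1 R (self_module R)"
  have F: "carrier ?F = carrier R" "smult ?F = (\<lambda>r x. r [^] p \<otimes> x)"
    by (simp_all add: frobenius_pushforward_def self_module_def)
  have fs: "finsum ?F g A = finsum R g A" for g and A :: "'a set"
    by (simp add: finsum_def finprod_def frobenius_pushforward_def self_module_def)
  show ?thesis using F_fin unfolding F_finite_def finitely_generated_module_def fs F comb_def .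
qed

lemma exists_minimal_span: "\<exists>E. minimal_span E"
proof -
  obtain U where U: "finite U" "U \<subseteq> carrier R" "\<forall>y\<in>carrier R. \<exists>c\<in>U \<rightarrow> carrier R. y = comb c U"
    using global_span by blast
  have "spans U" unfolding spans_def
  proof (intro conjI ballI U(1,2))
    fix y assume y: "y \<in> carrier R"
    then obtain c where "c \<in> U \<rightarrow> carrier R" "y = comb c U" using U(3) by blast
    then show "\<exists>s\<in>carrier R - P. \<exists>a\<in>U \<rightarrow> carrier R. s [^] p \<otimes> y = comb a U"
      using prime_compl_one[OF P] y by (intro bexI[of _ \<one>] bexI[of _ c]) auto
  qed
  then show ?thesis using ex_has_least_nat[of spans U card] unfolding minimal_span_def by blast
qed

text \<open>
  At \<open>P\<close>, the Frobenius power of \<open>P\<close> is generated by the \<open>p\<close>-th powers of the parameters.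
\<close>

lemma loc_powers_p: "loc P (powers (\<lambda>_. p) X) = loc P (frobenius_power p 1 R P)"
proof
  have i: "ideal (powers (\<lambda>_. p) X) R" using powers_ideal by blast
  have "powers (\<lambda>_. p) X \<subseteq> frobenius_power p 1 R P"
    unfolding powers_def frobenius_power_def using XP pow_image_carrier[OF P_ideal]
    by (intro subset_Idl_subset) auto
  then show "loc P (powers (\<lambda>_. p) X) \<subseteq> loc P (frobenius_power p 1 R P)" by (rule loc_mono)
  have li: "ideal (loc P (powers (\<lambda>_. p) X)) R" using loc_ideal[OF P i] .
  let ?D = "{w \<in> carrier R. w [^] p \<in> loc P (powers (\<lambda>_. p) X)}"
  have D: "ideal ?D R"
  proof (rule idealI_closed)
    show "\<zero> \<in> ?D" using ideal_zero_closed[OF li] by (simp add: zero_pow_p)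
    show "a \<oplus> b \<in> ?D" if "a \<in> ?D" "b \<in> ?D" for a b using that ideal_add_closed[OF li] by (simp add: frob_add)
    show "r \<otimes> a \<in> ?D" if "a \<in> ?D" "r \<in> carrier R" for a r
      using that ideal.I_l_closed[OF li] by (simp add: nat_pow_distrib)
  qed auto
  have "X \<subseteq> ?D"
    using Xcarr genideal_self[of "(\<lambda>x. x [^] p) ` X"] loc_incl[OF P i] unfolding powers_def by auto
  then have XD: "Idl X \<subseteq> ?D" using D by (intro genideal_minimal)
  have "w [^] p \<in> loc P (powers (\<lambda>_. p) X)" if w: "w \<in> P" for w
  proof -
    obtain s where s: "s \<in> carrier R - P" "w \<in> carrier R" "s \<otimes> w \<in> Idl X"
      using generate w by (blast elim: locE)
    then have "s [^] p \<otimes> w [^] p \<in> loc P (powers (\<lambda>_. p) X)" using XD by (auto simp: nat_pow_distrib)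
    then show ?thesis using loc_cancel[OF P prime_compl_pow[OF P s(1)]] s(2) by simp
  qed
  then have "frobenius_power p 1 R P \<subseteq> loc P (powers (\<lambda>_. p) X)"
    unfolding frobenius_power_def using li by (intro genideal_minimal) auto
  then show "loc P (frobenius_power p 1 R P) \<subseteq> loc P (powers (\<lambda>_. p) X)" using loc_le[OF P] by blast
qed

lemma minimal_span_free:
  assumes E: "minimal_span E" shows "independent_mod E {\<zero>} {\<zero>}"
proof -
  have fE: "finite E" "E \<subseteq> carrier R" using E by (auto simp: minimal_span_def spans_def)
  obtain xs where xs: "set xs = X" "distinct xs" using finite_distinct_list[OF finX] by blast
  have xc: "set xs \<subseteq> carrier R" using xs Xcarr by simp
  show ?thesis
  proof (rule independent_mod_descend[OF fE zeroideal zeroideal])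
    show "set xs \<subseteq> P" using xs XP by simp
    show "a [^] p \<in> {\<zero>}" if "a \<in> {\<zero>}" for a using that zero_pow_p by simp
    show "regular_seq P {\<zero>} (map (\<lambda>x. x [^] p) xs)"
      using regular_seq_powers[OF P zeroideal xc regular[OF xs], of "\<lambda>_. p"] p_pos by simp
    have e1: "adjoins {\<zero>} (map (\<lambda>x. x [^] p) xs) = powers (\<lambda>_. p) X"
      unfolding powers_def using xc xs by (subst adjoins_zero) auto
    have e2: "adjoins {\<zero>} xs = Idl X" using adjoins_zero[OF xc] xs by simp
    show "independent_mod E (adjoins {\<zero>} (map (\<lambda>x. x [^] p) xs)) (adjoins {\<zero>} xs)"
      unfolding independent_mod_def e1 e2 loc_IdlX loc_powers_p
      using minimal_span_independent[OF E] by blast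
  qed
qed

text \<open>
  The coordinate functions of the basis. Coefficients are unique only up to elements that vanish
  in the local ring. These form a finitely generated ideal and are therefore killed by one \<open>u \<notin> P\<close>,
  so the multiples of the coefficients by \<open>u\<close> are well defined functions on \<open>R\<close>.
\<close>

lemma exists_dual_basis:
  assumes E: "minimal_span E"
  shows "\<exists>t\<in>carrier R - P. \<exists>\<phi>. (\<forall>e\<in>E. \<phi> e \<in> cartier_maps p) \<and>
    (\<forall>y\<in>carrier R. t [^] p \<otimes> y = comb (\<lambda>e. \<phi> e y) E)"
proof -
  have sE: "spans E" using E by (simp add: minimal_span_def)
  have fE: "finite E" "E \<subseteq> carrier R" using sE by (auto simp: spans_def)
  obtain U where U: "finite U" "U \<subseteq> carrier R" "\<forall>y\<in>carrier R. \<exists>c\<in>U \<rightarrow> carrier R. y = comb c U"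
    using global_span by blast
  \<comment> \<open>the elements whose expansion needs no denominator other than \<open>s\<close>\<close>
  define D where "D s = {y \<in> carrier R. \<exists>a\<in>E \<rightarrow> carrier R. s [^] p \<otimes> y = comb a E}" for s
  have Dadd: "y \<oplus> z \<in> D s" if s: "s \<in> carrier R" and yz: "y \<in> D s" "z \<in> D s" for s y z
  proof -
    obtain a b where ab: "a \<in> E \<rightarrow> carrier R" "s [^] p \<otimes> y = comb a E" "b \<in> E \<rightarrow> carrier R" "s [^] p \<otimes> z = comb b E"
      and c: "y \<in> carrier R" "z \<in> carrier R" using yz unfolding D_def by blast
    have "s [^] p \<otimes> (y \<oplus> z) = comb (\<lambda>e. a e \<oplus> b e) E"
      using s c ab comb_add[OF ab(1,3) fE(2)] by (simp add: r_distr)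
    moreover have "(\<lambda>e. a e \<oplus> b e) \<in> E \<rightarrow> carrier R" using ab by auto
    ultimately show ?thesis unfolding D_def using c by blast
  qed
  have Dscale: "r [^] p \<otimes> y \<in> D s" if s: "s \<in> carrier R" "r \<in> carrier R" and y: "y \<in> D s" for s y r
  proof -
    obtain a where ab: "a \<in> E \<rightarrow> carrier R" "s [^] p \<otimes> y = comb a E" "y \<in> carrier R" using y unfolding D_def by blast
    have "s [^] p \<otimes> (r [^] p \<otimes> y) = r [^] p \<otimes> (s [^] p \<otimes> y)" using s ab by (simp add: m_lcomm)
    also have "\<dots> = comb (\<lambda>e. r \<otimes> a e) E" unfolding ab(2) using comb_scale[OF fE(1) ab(1) s(2) fE(2)] .
    finally have "s [^] p \<otimes> (r [^] p \<otimes> y) = comb (\<lambda>e. r \<otimes> a e) E" .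
    moreover have "(\<lambda>e. r \<otimes> a e) \<in> E \<rightarrow> carrier R" using ab s by auto
    ultimately show ?thesis unfolding D_def using ab s by blast
  qed
  have fin: "finite F \<Longrightarrow> F \<subseteq> carrier R \<Longrightarrow> \<exists>s\<in>carrier R - P. F \<subseteq> D s" for F
  proof (induction F rule: finite_induct)
    case empty then show ?case using prime_compl_one[OF P] by blast
  next
    case (insert x F)
    then obtain s where s: "s \<in> carrier R - P" "F \<subseteq> D s" by auto
    have xc: "x \<in> carrier R" using insert.prems by simp
    have "\<exists>r\<in>carrier R - P. \<exists>a\<in>E \<rightarrow> carrier R. r [^] p \<otimes> x = comb a E"
      using sE xc unfolding spans_def by simp
    then obtain r a where r: "r \<in> carrier R - P" "a \<in> E \<rightarrow> carrier R" "r [^] p \<otimes> x = comb a E"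
      by blast
    have mono: "y \<in> D (u \<otimes> v)" if yuv: "y \<in> D u" "u \<in> carrier R" "v \<in> carrier R" for y u v
    proof -
      obtain b where b: "b \<in> E \<rightarrow> carrier R" "u [^] p \<otimes> y = comb b E" "y \<in> carrier R" using yuv(1) unfolding D_def by blast
      have "(u \<otimes> v) [^] p \<otimes> y = v [^] p \<otimes> (u [^] p \<otimes> y)" using yuv b(3) by (simp add: nat_pow_distrib m_ac)
      also have "\<dots> = comb (\<lambda>e. v \<otimes> b e) E" unfolding b(2) using comb_scale[OF fE(1) b(1) yuv(3) fE(2)] .
      finally have "(u \<otimes> v) [^] p \<otimes> y = comb (\<lambda>e. v \<otimes> b e) E" .
      moreover have "(\<lambda>e. v \<otimes> b e) \<in> E \<rightarrow> carrier R" using b(1) yuv(3) by auto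
      ultimately show ?thesis unfolding D_def using b(3) by blast
    qed
    have sr: "s \<in> carrier R" "r \<in> carrier R" using s r by auto
    have "x \<in> D r" unfolding D_def using r(2,3) xc by blast
    then have "x \<in> D (s \<otimes> r)" using mono[of x r s] sr m_comm[of s r] by simp
    moreover have "F \<subseteq> D (s \<otimes> r)" using mono[OF _ sr] s(2) by blast
    ultimately show ?case using prime_compl_mult[OF P s(1) r(1)] by (intro bexI[of _ "s \<otimes> r"]) auto
  qed
  obtain s where s: "s \<in> carrier R - P" "U \<subseteq> D s" using fin[OF U(1,2)] by blast
  have sc: "s \<in> carrier R" using s by simp
  have Dall: "y \<in> D s" if y: "y \<in> carrier R" for y
  proof -
    obtain c where c: "c \<in> U \<rightarrow> carrier R" "y = comb c U" using U(3) y by blast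
    have fin: "finite F \<Longrightarrow> F \<subseteq> U \<Longrightarrow> comb c F \<in> D s" for F
    proof (induction F rule: finite_induct)
      case empty
      have "s [^] p \<otimes> \<zero> = comb (\<lambda>_. \<zero>) E" using comb_zero[OF fE(2)] sc by simp
      moreover have "(\<lambda>_. \<zero>) \<in> E \<rightarrow> carrier R" by simp
      ultimately have "\<zero> \<in> D s" unfolding D_def by blast
      then show ?case by (simp add: comb_def)
    next
      case (insert x F)
      have "comb c (insert x F) = c x [^] p \<otimes> x \<oplus> comb c F"
        using insert.hyps insert.prems U(2) c(1) by (intro comb_insert) auto
      moreover have "c x [^] p \<otimes> x \<in> D s" using Dscale[OF sc] insert.prems s(2) c(1) by blast
      ultimately show ?case using Dadd[OF sc] insert by simp
    qed
    show ?thesis using fin[OF U(1)] c(2) by simp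
  qed
  have "\<forall>y\<in>carrier R. \<exists>a. a \<in> E \<rightarrow> carrier R \<and> s [^] p \<otimes> y = comb a E" using Dall unfolding D_def by blast
  from bchoice[OF this] obtain co where co: "\<And>y. y \<in> carrier R \<Longrightarrow> co y \<in> E \<rightarrow> carrier R"
    "\<And>y. y \<in> carrier R \<Longrightarrow> s [^] p \<otimes> y = comb (co y) E" by blast
  have lz: "ideal (loc P {\<zero>}) R" using loc_ideal[OF P zeroideal] .
  obtain G where G: "G \<subseteq> carrier R" "finite G" "loc P {\<zero>} = Idl G" using finetely_gen[OF lz] by blast
  have "\<exists>u\<in>carrier R - P. \<forall>g\<in>G. u \<otimes> g \<in> {\<zero>}"
    using common_denominator[OF P zeroideal G(2), of "\<lambda>g. g"] genideal_self[OF G(1)] G(3) by blast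
  then obtain u where u: "u \<in> carrier R - P" "\<forall>g\<in>G. u \<otimes> g = \<zero>" by blast
  have uc: "u \<in> carrier R" using u by simp
  have kill: "u \<otimes> z = \<zero>" if z: "z \<in> loc P {\<zero>}" for z
  proof -
    have "ideal {r \<in> carrier R. u \<otimes> r \<in> {\<zero>}} R" using ideal.helper_max_prime[OF zeroideal cring_axioms uc] .
    then have "Idl G \<subseteq> {r \<in> carrier R. u \<otimes> r \<in> {\<zero>}}" using u G(1) by (intro genideal_minimal) auto
    then show ?thesis using z G(3) by blast
  qed
  have unique: "u \<otimes> a e = u \<otimes> b e"
    if ab: "a \<in> E \<rightarrow> carrier R" "b \<in> E \<rightarrow> carrier R" "comb a E = comb b E" and e: "e \<in> E" for a b e
  proof -
    have ce: "a e \<in> carrier R" "b e \<in> carrier R" using ab e by auto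
    have "comb (\<lambda>e. a e \<ominus> b e) E = \<zero>" using comb_minus[OF fE(1) ab(1,2) fE(2)] ab(3) comb_closed[OF ab(2) fE(2)]
      by (simp add: a_minus_def r_neg)
    then have "comb (\<lambda>e. a e \<ominus> b e) E \<in> loc P {\<zero>}" using ideal_zero_closed[OF lz] by simp
    moreover have "(\<lambda>e. a e \<ominus> b e) \<in> E \<rightarrow> carrier R" using ab by auto
    ultimately have "a e \<ominus> b e \<in> loc P {\<zero>}"
      using minimal_span_free[OF E] e unfolding independent_mod_def by blast
    then have "u \<otimes> (a e \<ominus> b e) = \<zero>" by (rule kill)
    moreover have "u \<otimes> (a e \<ominus> b e) = u \<otimes> a e \<ominus> u \<otimes> b e" using ce uc by algebra
    ultimately show ?thesis using ce uc by simp
  qed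
  define \<phi> where "\<phi> e y = u \<otimes> co y e" for e y
  have "\<phi> e \<in> cartier_maps p" if e: "e \<in> E" for e
  proof -
    have cc: "co y e \<in> carrier R" if "y \<in> carrier R" for y using co(1)[OF that] e by blast
    have add: "\<phi> e (x \<oplus> y) = \<phi> e x \<oplus> \<phi> e y" if xy: "x \<in> carrier R" "y \<in> carrier R" for x y
    proof -
      have "comb (co (x \<oplus> y)) E = s [^] p \<otimes> (x \<oplus> y)" using co(2) xy by simp
      also have "\<dots> = comb (co x) E \<oplus> comb (co y) E" using co(2)[OF xy(1)] co(2)[OF xy(2)] xy sc by (simp add: r_distr)
      also have "\<dots> = comb (\<lambda>e. co x e \<oplus> co y e) E" using comb_add[OF co(1)[OF xy(1)] co(1)[OF xy(2)] fE(2)] .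
      finally have "u \<otimes> co (x \<oplus> y) e = u \<otimes> (co x e \<oplus> co y e)"
        using co(1) xy e by (intro unique) auto
      then show ?thesis unfolding \<phi>_def using cc xy uc by (simp add: r_distr)
    qed
    have scale: "\<phi> e (r [^] p \<otimes> x) = r \<otimes> \<phi> e x" if xr: "x \<in> carrier R" "r \<in> carrier R" for x r
    proof -
      have "comb (co (r [^] p \<otimes> x)) E = s [^] p \<otimes> (r [^] p \<otimes> x)" using co(2) xr by simp
      also have "\<dots> = r [^] p \<otimes> comb (co x) E" using co(2)[OF xr(1)] xr sc by (simp add: m_lcomm)
      also have "\<dots> = comb (\<lambda>e. r \<otimes> co x e) E" using comb_scale[OF fE(1) co(1)[OF xr(1)] xr(2) fE(2)] .
      finally have "u \<otimes> co (r [^] p \<otimes> x) e = u \<otimes> (r \<otimes> co x e)"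
        using co(1)[of "r [^] p \<otimes> x"] co(1)[OF xr(1)] xr e by (intro unique) auto
      then show ?thesis unfolding \<phi>_def using cc xr uc by (simp add: m_lcomm)
    qed
    show ?thesis using add scale cc uc by (auto simp: cartier_maps_def \<phi>_def)
  qed
  moreover have "(u \<otimes> s) [^] p \<otimes> y = comb (\<lambda>e. \<phi> e y) E" if y: "y \<in> carrier R" for y
  proof -
    have "(u \<otimes> s) [^] p \<otimes> y = u [^] p \<otimes> comb (co y) E" unfolding co(2)[OF y, symmetric]
      using uc sc y by (simp add: nat_pow_distrib m_assoc)
    also have "\<dots> = comb (\<lambda>e. \<phi> e y) E" unfolding \<phi>_def using comb_scale[OF fE(1) co(1)[OF y] uc fE(2)] .
    finally show ?thesis .
  qed
  ultimately show ?thesis using prime_compl_mult[OF P u(1) s(1)] by blast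
qed

text \<open>
  The kernel of the form \<open>(c, z) \<mapsto> \<Phi>(c z)\<close> modulo \<open>P\<close> is an ideal. If it were nonzero modulo the
  Frobenius power of \<open>P\<close>, it would meet the socle and so contain the socle generator, on which \<open>\<Phi>\<close>
  is a unit.
\<close>

lemma nondegenerate_functional:
  assumes \<Phi>: "\<Phi> \<in> cartier_maps p" and unit: "\<Phi> (socle_gen (\<lambda>_. p)) \<notin> P"
    and z: "z \<in> carrier R" "\<And>c. c \<in> carrier R \<Longrightarrow> \<Phi> (c \<otimes> z) \<in> P"
  shows "z \<in> loc P (frobenius_power p 1 R P)"
proof (rule ccontr)
  assume nz: "z \<notin> loc P (frobenius_power p 1 R P)"
  define K where "K = powers (\<lambda>_. p) X"
  define Z where "Z = loc P K"
  define g where "g = socle_gen (\<lambda>_. p)"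
  have K: "ideal K R" unfolding K_def using powers_ideal by blast
  have Z: "ideal Z R" "loc P Z = Z" unfolding Z_def using loc_ideal[OF P K] loc_loc[OF P K] by auto
  have ZF: "Z = loc P (frobenius_power p 1 R P)" unfolding Z_def K_def by (rule loc_powers_p)
  have FI: "ideal (frobenius_power p 1 R P) R" using frobenius_power_ideal[OF P_ideal] .
  have ZP: "\<Phi> w \<in> P" if w: "w \<in> Z" for w
  proof -
    obtain s where s: "s \<in> carrier R - P" "w \<in> carrier R" "s \<otimes> w \<in> frobenius_power p 1 R P"
      using w unfolding ZF by (rule locE)
    have "s [^] (p - 1) \<otimes> (s \<otimes> w) \<in> frobenius_power p 1 R P" using ideal.I_l_closed[OF FI s(3)] s(1) by simp
    moreover have "s [^] (p - 1) \<otimes> (s \<otimes> w) = s [^] p \<otimes> w" using s p_pos by (cases p) (auto simp: m_assoc)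
    ultimately have "\<Phi> (s [^] p \<otimes> w) \<in> P" using cartier_frobenius_power[of \<Phi> p 1 P] \<Phi> P_ideal by simp
    then have "s \<otimes> \<Phi> w \<in> P" using cartierD(3)[OF \<Phi>] s by simp
    then show ?thesis using primeideal.I_prime[OF P] s cartierD(1)[OF \<Phi>] by blast
  qed
  have min: "Q = P" if Q: "primeideal Q R" "Z \<subseteq> Q" "Q \<subseteq> P" for Q
  proof -
    have Qi: "ideal Q R" using Q(1) primeideal.axioms(1) by blast
    have "x \<in> Q" if x: "x \<in> X" for x
    proof -
      have "x [^] p \<in> K" unfolding K_def powers_def using genideal_self[of "(\<lambda>x. x [^] p) ` X"] Xcarr x by blast
      then have "x [^] p \<in> Q" using loc_incl[OF P K] Q(2) by (auto simp: Z_def)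
      then show ?thesis using prime_compl_pow[OF Q(1), of x p] Xcarr x by blast
    qed
    then have "loc P (Idl X) \<subseteq> loc P Q" by (intro loc_mono genideal_minimal Qi) blast
    then show ?thesis using loc_IdlX loc_prime[OF Q(3) P Q(1)] Q(3) by simp
  qed
  obtain c where c: "c \<in> carrier R" "c \<otimes> z \<notin> Z" "\<forall>q\<in>P. q \<otimes> (c \<otimes> z) \<in> Z"
    using exists_socle_multiple[OF P Z z(1) nz[folded ZF] min] by blast
  have "c \<otimes> z \<in> loc P (adjoin K g)" unfolding K_def g_def
    using c XP z(1) p_pos by (intro socle_generated) (auto simp: Z_def K_def)
  then obtain s where s: "s \<in> carrier R - P" "s \<otimes> (c \<otimes> z) \<in> adjoin K g" by (rule locE)
  from s(2) obtain k d where kd: "k \<in> K" "d \<in> carrier R" "s \<otimes> (c \<otimes> z) = k \<oplus> d \<otimes> g" by (rule adjoinE)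
  have gc: "g \<in> carrier R" unfolding g_def by (rule socle_gen_closed)
  have cc: "k \<in> carrier R" "s \<in> carrier R" using ideal.Icarr[OF K kd(1)] s(1) by auto
  have kZ: "k \<in> Z" unfolding Z_def using kd(1) loc_incl[OF P K] by blast
  have "d \<notin> P"
  proof
    assume d: "d \<in> P"
    let ?D = "{r \<in> carrier R. g \<otimes> r \<in> Z}"
    have D: "ideal ?D R" using ideal.helper_max_prime[OF Z(1) cring_axioms gc] .
    have "X \<subseteq> ?D"
    proof
      fix x assume x: "x \<in> X"
      have "x \<otimes> g \<in> Z" using socle_gen_annihilated[OF x, of "\<lambda>_. p"] p_pos loc_incl[OF P K]
        by (auto simp: g_def K_def Z_def)
      then show "x \<in> ?D" using x Xcarr m_comm[OF gc, of x] by auto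
    qed
    then have XD: "Idl X \<subseteq> ?D" using D by (intro genideal_minimal)
    obtain t where t: "t \<in> carrier R - P" "t \<otimes> d \<in> Idl X" using generate d by (blast elim: locE)
    have "g \<otimes> (t \<otimes> d) \<in> Z" using XD t(2) by blast
    moreover have "g \<otimes> (t \<otimes> d) = t \<otimes> (d \<otimes> g)" using gc t(1) kd(2) by (simp add: m_ac)
    ultimately have "t \<otimes> (d \<otimes> g) \<in> Z" by simp
    then have "d \<otimes> g \<in> Z" using loc_cancel[OF P t(1), of "d \<otimes> g" K] kd(2) gc by (simp add: Z_def)
    then have "s \<otimes> (c \<otimes> z) \<in> Z" unfolding kd(3) using ideal_add_closed[OF Z(1) kZ] by blast
    then show False using c(2) loc_cancel[OF P s(1), of "c \<otimes> z" K] c(1) z(1) by (simp add: Z_def)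
  qed
  \<comment> \<open>\<open>d\<close> acts through \<open>d\<^sup>p\<close>, so \<open>d\<close> is completed to a \<open>p\<close>-th power\<close>
  define d' where "d' = d [^] (p - 1)"
  have d': "d' \<in> carrier R" "d' \<otimes> d = d [^] p" using kd(2) p_pos by (cases p; simp add: d'_def)+
  have "d' \<otimes> (k \<oplus> d \<otimes> g) = d' \<otimes> k \<oplus> (d' \<otimes> d) \<otimes> g" using d'(1) kd(2) cc gc by algebra
  then have "\<Phi> (d' \<otimes> (s \<otimes> (c \<otimes> z))) = \<Phi> (d' \<otimes> k) \<oplus> \<Phi> (d [^] p \<otimes> g)"
    unfolding kd(3) d'(2) using cartierD(2)[OF \<Phi>] d' kd(2) cc gc by simp
  also have "\<Phi> (d [^] p \<otimes> g) = d \<otimes> \<Phi> g" using cartierD(3)[OF \<Phi> kd(2) gc] .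
  finally have eq: "\<Phi> (d' \<otimes> (s \<otimes> (c \<otimes> z))) = \<Phi> (d' \<otimes> k) \<oplus> d \<otimes> \<Phi> g" .
  have "d' \<otimes> (s \<otimes> (c \<otimes> z)) = (d' \<otimes> s \<otimes> c) \<otimes> z" using d' cc c z by (simp add: m_assoc)
  then have l: "\<Phi> (d' \<otimes> (s \<otimes> (c \<otimes> z))) \<in> P" using z(2)[of "d' \<otimes> s \<otimes> c"] d' cc c by simp
  have r: "\<Phi> (d' \<otimes> k) \<in> P" using ZP ideal.I_l_closed[OF Z(1) kZ d'(1)] by blast
  have \<Phi>g: "\<Phi> g \<in> carrier R" using cartierD(1)[OF \<Phi> gc] .
  have "(u \<oplus> v) \<ominus> u = v" if "u \<in> carrier R" "v \<in> carrier R" for u v using that by algebra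
  then have "d \<otimes> \<Phi> g = \<Phi> (d' \<otimes> (s \<otimes> (c \<otimes> z))) \<ominus> \<Phi> (d' \<otimes> k)"
    unfolding eq using ideal.Icarr[OF P_ideal r] kd(2) \<Phi>g by simp
  then have "d \<otimes> \<Phi> g \<in> P" using ideal_minus_closed[OF P_ideal l r] by simp
  then show False using primeideal.I_prime[OF P kd(2) \<Phi>g] \<open>d \<notin> P\<close> unit by (simp add: g_def)
qed

text \<open>
  Some coordinate function \<open>\<Phi>\<close> is a unit on the socle generator, because that element is not in the
  Frobenius power of \<open>P\<close>. By nondegeneracy its Gram matrix on the basis is nonsingular modulo
  \<open>P\<close>, and inverting it expresses all coordinate functions through \<open>\<Phi>\<close>.
\<close>

theorem exists_trace_basis: "\<exists>s\<in>carrier R - P. \<exists>\<Phi> L. trace_basis p s \<Phi> L"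
proof -
  obtain E where E: "minimal_span E" using exists_minimal_span by blast
  have fE: "finite E" "E \<subseteq> carrier R" using E by (auto simp: minimal_span_def spans_def)
  obtain t \<phi> where t: "t \<in> carrier R - P" and \<phi>: "\<And>e. e \<in> E \<Longrightarrow> \<phi> e \<in> cartier_maps p"
    and dual: "\<And>y. y \<in> carrier R \<Longrightarrow> t [^] p \<otimes> y = comb (\<lambda>e. \<phi> e y) E"
    using exists_dual_basis[OF E] by blast
  have tc: "t \<in> carrier R" using t by simp
  have \<phi>c: "\<phi> e y \<in> carrier R" if "e \<in> E" "y \<in> carrier R" for e y using cartierD(1)[OF \<phi>[OF that(1)] that(2)] .
  define g where "g = socle_gen (\<lambda>_. p)"
  have gc: "g \<in> carrier R" unfolding g_def by (rule socle_gen_closed)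
  have FI: "ideal (frobenius_power p 1 R P) R" using frobenius_power_ideal[OF P_ideal] .
  have FP: "q [^] p \<in> frobenius_power p 1 R P" if "q \<in> P" for q using frobenius_power_mem[OF P_ideal that, of p 1] by simp
  have "\<exists>e0\<in>E. \<phi> e0 g \<notin> P"
  proof (rule ccontr)
    assume "\<not> ?thesis"
    then have "comb (\<lambda>e. \<phi> e g) E \<in> frobenius_power p 1 R P"
      using FP by (intro comb_ideal[OF FI fE(2,1)]) blast
    then have "g \<in> loc P (frobenius_power p 1 R P)"
      using dual[OF gc] locI[OF prime_compl_pow[OF P t, of p] gc] by simp
    then show False using socle_gen_notin[of "\<lambda>_. p"] p_pos loc_powers_p by (simp add: g_def)
  qed
  then obtain e0 where e0: "e0 \<in> E" "\<phi> e0 g \<notin> P" by blast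
  define \<Phi> where "\<Phi> = \<phi> e0"
  have \<Phi>: "\<Phi> \<in> cartier_maps p" using \<phi>[OF e0(1)] by (simp add: \<Phi>_def)
  have \<Phi>c: "\<Phi> y \<in> carrier R" if "y \<in> carrier R" for y using cartierD(1)[OF \<Phi> that] .
  have \<Phi>comb: "\<Phi> (c \<otimes> comb v E) = (\<Oplus>f\<in>E. \<Phi> (c \<otimes> f) \<otimes> v f)" if c: "c \<in> carrier R" and v: "v \<in> E \<rightarrow> carrier R" for c v
  proof -
    have m: "(\<lambda>f. v f [^] p \<otimes> f) \<in> E \<rightarrow> carrier R" using v fE by auto
    have "\<Phi> (c \<otimes> comb v E) = (\<Oplus>f\<in>E. \<Phi> (c \<otimes> (v f [^] p \<otimes> f)))"
      unfolding comb_def using cartier_finsum[OF cartier_premult[OF \<Phi> c] fE(1) m] .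
    also have "\<dots> = (\<Oplus>f\<in>E. \<Phi> (c \<otimes> f) \<otimes> v f)"
    proof (rule finsum_cong'[OF refl])
      show "(\<lambda>f. \<Phi> (c \<otimes> f) \<otimes> v f) \<in> E \<rightarrow> carrier R" using \<Phi>c c v fE by (auto simp: Pi_iff)
      fix f assume f: "f \<in> E"
      have fc: "f \<in> carrier R" "v f \<in> carrier R" using f v fE by auto
      have "c \<otimes> (v f [^] p \<otimes> f) = v f [^] p \<otimes> (c \<otimes> f)" using c fc by (simp add: m_lcomm)
      then show "\<Phi> (c \<otimes> (v f [^] p \<otimes> f)) = \<Phi> (c \<otimes> f) \<otimes> v f"
        using cartierD(3)[OF \<Phi> fc(2), of "c \<otimes> f"] c fc \<Phi>c by (simp add: m_comm)
    qed
    finally show ?thesis .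
  qed
  have nonsing: "\<forall>f\<in>E. v f \<in> P"
    if v: "v \<in> E \<rightarrow> carrier R" and vP: "\<And>e. e \<in> E \<Longrightarrow> (\<Oplus>f\<in>E. \<Phi> (e \<otimes> f) \<otimes> v f) \<in> P" for v
  proof -
    have zc: "comb v E \<in> carrier R" using comb_closed[OF v fE(2)] .
    have "\<Phi> (c \<otimes> comb v E) \<in> P" if c: "c \<in> carrier R" for c
    proof -
      have \<phi>cc: "(\<lambda>e. \<phi> e c) \<in> E \<rightarrow> carrier R" using \<phi>c c by blast
      have "t \<otimes> \<Phi> (c \<otimes> comb v E) = \<Phi> (t [^] p \<otimes> (c \<otimes> comb v E))"
        using cartierD(3)[OF \<Phi> tc, of "c \<otimes> comb v E"] c zc by simp
      also have "t [^] p \<otimes> (c \<otimes> comb v E) = comb v E \<otimes> comb (\<lambda>e. \<phi> e c) E"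
        using dual[OF c] c tc zc by (simp add: m_assoc[symmetric]) (simp add: m_comm comb_closed[OF \<phi>cc fE(2)])
      also have "\<Phi> (comb v E \<otimes> comb (\<lambda>e. \<phi> e c) E) = (\<Oplus>e\<in>E. \<Phi> (comb v E \<otimes> e) \<otimes> \<phi> e c)"
        using \<Phi>comb[OF zc \<phi>cc] .
      also have "\<dots> \<in> P"
      proof -
        have summand: "\<Phi> (comb v E \<otimes> e) \<otimes> \<phi> e c \<in> P" if e: "e \<in> E" for e
        proof -
          have ec: "e \<in> carrier R" using e fE by blast
          have "\<Phi> (e \<otimes> comb v E) \<in> P" using \<Phi>comb[OF ec v] vP[OF e] by simp
          then show ?thesis using ideal.I_r_closed[OF P_ideal] \<phi>c[OF e c] m_comm[OF zc ec] by simp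
        qed
        have fin: "finite F \<Longrightarrow> F \<subseteq> E \<Longrightarrow> (\<Oplus>e\<in>F. \<Phi> (comb v E \<otimes> e) \<otimes> \<phi> e c) \<in> P" for F
        proof (induction F rule: finite_induct)
          case (insert x F)
          then have m: "\<And>e. e \<in> insert x F \<Longrightarrow> \<Phi> (comb v E \<otimes> e) \<otimes> \<phi> e c \<in> P" using summand by blast
          then have "(\<lambda>e. \<Phi> (comb v E \<otimes> e) \<otimes> \<phi> e c) \<in> F \<rightarrow> carrier R" "\<Phi> (comb v E \<otimes> x) \<otimes> \<phi> x c \<in> carrier R"
            using ideal.Icarr[OF P_ideal] by auto
          then have "(\<Oplus>e\<in>insert x F. \<Phi> (comb v E \<otimes> e) \<otimes> \<phi> e c)
              = \<Phi> (comb v E \<otimes> x) \<otimes> \<phi> x c \<oplus> (\<Oplus>e\<in>F. \<Phi> (comb v E \<otimes> e) \<otimes> \<phi> e c)"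
            using insert.hyps by simp
          then show ?case using insert.IH insert.prems m[of x] ideal_add_closed[OF P_ideal] by simp
        qed (use ideal_zero_closed[OF P_ideal] in simp)
        show ?thesis using fin[OF fE(1)] by simp
      qed
      finally have "t \<otimes> \<Phi> (c \<otimes> comb v E) \<in> P" .
      moreover have "\<Phi> (c \<otimes> comb v E) \<in> carrier R" using \<Phi>c c zc by simp
      ultimately show ?thesis using primeideal.I_prime[OF P tc] t by blast
    qed
    then have "comb v E \<in> loc P (frobenius_power p 1 R P)"
      using nondegenerate_functional[OF \<Phi> _ zc] e0(2) by (simp add: \<Phi>_def g_def)
    then show ?thesis using minimal_span_independent[OF E v] by blast
  qed
  have "\<exists>s\<in>carrier R - P. \<exists>c\<in>carrier R. \<forall>e\<in>E. \<Phi> (c \<otimes> e) = (if e = f then s else \<zero>)" if f: "f \<in> E" for f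
  proof -
    define w where "w = (\<lambda>e. if e = f then \<one> else \<zero>)"
    have "\<exists>s\<in>carrier R - P. \<exists>y\<in>E \<rightarrow> carrier R. \<forall>e\<in>E. (\<Oplus>r\<in>E. y r \<otimes> \<Phi> (r \<otimes> e)) = s \<otimes> w e"
    proof (rule solve_nonsingular[OF P fE(1) fE(1)])
      show "\<Phi> (r \<otimes> e) \<in> carrier R" if "r \<in> E" "e \<in> E" for r e using that \<Phi>c fE(2) by (simp add: subset_iff)
      show "w \<in> E \<rightarrow> carrier R" by (simp add: w_def)
      show "\<forall>c\<in>E. v c \<in> P" if "v \<in> E \<rightarrow> carrier R" "\<And>r. r \<in> E \<Longrightarrow> (\<Oplus>c\<in>E. \<Phi> (r \<otimes> c) \<otimes> v c) \<in> P" for v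
        using nonsing[OF that] .
    qed
    then obtain s y where s: "s \<in> carrier R - P" and y: "y \<in> E \<rightarrow> carrier R"
      and sy: "\<And>e. e \<in> E \<Longrightarrow> (\<Oplus>r\<in>E. y r \<otimes> \<Phi> (r \<otimes> e)) = s \<otimes> w e" by blast
    have "\<Phi> (comb y E \<otimes> e) = (if e = f then s else \<zero>)" if e: "e \<in> E" for e
    proof -
      have ec: "e \<in> carrier R" using e fE by blast
      have "\<Phi> (comb y E \<otimes> e) = \<Phi> (e \<otimes> comb y E)" using m_comm[OF ec comb_closed[OF y fE(2)]] by simp
      also have "\<dots> = (\<Oplus>r\<in>E. \<Phi> (e \<otimes> r) \<otimes> y r)" using \<Phi>comb[OF ec y] .
      also have "\<dots> = (\<Oplus>r\<in>E. y r \<otimes> \<Phi> (r \<otimes> e))"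
      proof (rule finsum_cong'[OF refl])
        show "(\<lambda>r. y r \<otimes> \<Phi> (r \<otimes> e)) \<in> E \<rightarrow> carrier R" using \<Phi>c y ec fE by (auto simp: Pi_iff)
        fix r assume "r \<in> E"
        then have "r \<in> carrier R" "y r \<in> carrier R" using y fE by auto
        then show "\<Phi> (e \<otimes> r) \<otimes> y r = y r \<otimes> \<Phi> (r \<otimes> e)" using m_comm[OF ec] m_comm \<Phi>c ec by simp
      qed
      finally show ?thesis using sy[OF e] s by (simp add: w_def)
    qed
    then show ?thesis using s comb_closed[OF y fE(2)] by blast
  qed
  then have "\<forall>f\<in>E. \<exists>sc. fst sc \<in> carrier R - P \<and> snd sc \<in> carrier R \<and> (\<forall>e\<in>E. \<Phi> (snd sc \<otimes> e) = (if e = f then fst sc else \<zero>))"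
    by (metis fst_conv snd_conv)
  from bchoice[OF this] obtain h where h: "\<And>f. f \<in> E \<Longrightarrow> fst (h f) \<in> carrier R - P \<and> snd (h f) \<in> carrier R
    \<and> (\<forall>e\<in>E. \<Phi> (snd (h f) \<otimes> e) = (if e = f then fst (h f) else \<zero>))" by blast
  define \<sigma> where "\<sigma> f = fst (h f)" for f
  define \<gamma> where "\<gamma> f = snd (h f)" for f
  have \<sigma>: "\<And>f. f \<in> E \<Longrightarrow> \<sigma> f \<in> carrier R - P" and \<gamma>: "\<And>f. f \<in> E \<Longrightarrow> \<gamma> f \<in> carrier R"
    and \<Phi>\<gamma>: "\<And>f e. f \<in> E \<Longrightarrow> e \<in> E \<Longrightarrow> \<Phi> (\<gamma> f \<otimes> e) = (if e = f then \<sigma> f else \<zero>)"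
    using h by (auto simp: \<sigma>_def \<gamma>_def)
  have key: "t \<otimes> \<Phi> (\<gamma> f \<otimes> y) = \<sigma> f \<otimes> \<phi> f y" if f: "f \<in> E" and y: "y \<in> carrier R" for f y
  proof -
    have \<phi>y: "(\<lambda>e. \<phi> e y) \<in> E \<rightarrow> carrier R" using \<phi>c y by blast
    have "t \<otimes> \<Phi> (\<gamma> f \<otimes> y) = \<Phi> (t [^] p \<otimes> (\<gamma> f \<otimes> y))" using cartierD(3)[OF \<Phi> tc, of "\<gamma> f \<otimes> y"] \<gamma>[OF f] y by simp
    also have "t [^] p \<otimes> (\<gamma> f \<otimes> y) = \<gamma> f \<otimes> comb (\<lambda>e. \<phi> e y) E"
      unfolding dual[OF y, symmetric] using tc \<gamma>[OF f] y by (simp add: m_lcomm)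
    also have "\<Phi> \<dots> = (\<Oplus>e\<in>E. \<Phi> (\<gamma> f \<otimes> e) \<otimes> \<phi> e y)" using \<Phi>comb[OF \<gamma>[OF f] \<phi>y] .
    also have "\<dots> = (\<Oplus>e\<in>E. if f = e then \<sigma> f \<otimes> \<phi> f y else \<zero>)"
      using \<Phi>\<gamma>[OF f] \<phi>c y \<sigma>[OF f] by (intro finsum_cong') auto
    also have "\<dots> = \<sigma> f \<otimes> \<phi> f y"
      using finsum_singleton[OF f fE(1), of "\<lambda>_. \<sigma> f \<otimes> \<phi> f y"] \<phi>c[OF f y] \<sigma>[OF f] by simp
    finally show ?thesis .
  qed
  \<comment> \<open>bring the denominators \<open>\<sigma> f\<close> to the common value \<open>S\<close>\<close>
  define \<tau> where "\<tau> f = (\<Otimes>g\<in>E - {f}. \<sigma> g)" for f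
  define S where "S = (\<Otimes>g\<in>E. \<sigma> g)"
  have prodP: "finite F \<Longrightarrow> F \<subseteq> E \<Longrightarrow> (\<Otimes>g\<in>F. \<sigma> g) \<in> carrier R - P" for F
  proof (induction F rule: finite_induct)
    case (insert x F)
    have "(\<Otimes>g\<in>insert x F. \<sigma> g) = \<sigma> x \<otimes> (\<Otimes>g\<in>F. \<sigma> g)"
      using insert.hyps insert.prems \<sigma> by (intro finprod_insert) auto
    then show ?case using prime_compl_mult[OF P \<sigma>] insert by simp
  qed (use prime_compl_one[OF P] in simp)
  have S: "S \<in> carrier R - P" unfolding S_def using prodP[OF fE(1)] by simp
  have \<tau>c: "\<tau> f \<in> carrier R" for f unfolding \<tau>_def using \<sigma> by (intro finprod_closed) auto
  have S\<tau>: "S = \<tau> f \<otimes> \<sigma> f" if f: "f \<in> E" for f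
  proof -
    have "E = insert f (E - {f})" using f by blast
    then have "S = (\<Otimes>g\<in>insert f (E - {f}). \<sigma> g)" by (simp add: S_def)
    also have "\<dots> = \<sigma> f \<otimes> \<tau> f" unfolding \<tau>_def using fE(1) f \<sigma> by (intro finprod_insert) auto
    finally show ?thesis using \<sigma>[OF f] \<tau>c by (simp add: m_comm)
  qed
  define C where "C f = (\<tau> f \<otimes> t) [^] p \<otimes> \<gamma> f" for f
  have Cc: "C f \<in> carrier R" if "f \<in> E" for f using \<tau>c tc \<gamma>[OF that] by (simp add: C_def)
  have \<Phi>C: "\<Phi> (C f \<otimes> y) = S \<otimes> \<phi> f y" if f: "f \<in> E" and y: "y \<in> carrier R" for f y
  proof -
    have "\<Phi> (C f \<otimes> y) = (\<tau> f \<otimes> t) \<otimes> \<Phi> (\<gamma> f \<otimes> y)"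
      using cartierD(3)[OF \<Phi>, of "\<tau> f \<otimes> t" "\<gamma> f \<otimes> y"] \<tau>c tc \<gamma>[OF f] y by (simp add: C_def m_assoc)
    also have "\<dots> = \<tau> f \<otimes> (t \<otimes> \<Phi> (\<gamma> f \<otimes> y))" using \<tau>c tc \<gamma>[OF f] y \<Phi>c by (simp add: m_assoc)
    also have "\<dots> = S \<otimes> \<phi> f y" unfolding key[OF f y] S\<tau>[OF f] using \<tau>c \<sigma>[OF f] \<phi>c[OF f y] by (simp add: m_assoc)
    finally show ?thesis .
  qed
  obtain es where es: "set es = E" "distinct es" using finite_distinct_list[OF fE(1)] by blast
  have "trace_basis p (S \<otimes> t) \<Phi> (map (\<lambda>f. (C f, f)) es)" unfolding trace_basis_def
  proof (intro conjI ballI \<Phi>)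
    show "set (map (\<lambda>f. (C f, f)) es) \<subseteq> carrier R \<times> carrier R" using es Cc fE by auto
    fix y assume y: "y \<in> carrier R"
    have m: "(S \<otimes> \<phi> f y) [^] p \<otimes> f \<in> carrier R" if "f \<in> E" for f using that S \<phi>c[OF that y] fE by auto
    have "lsum (\<lambda>(c, x). \<Phi> (c \<otimes> y) [^] p \<otimes> x) (map (\<lambda>f. (C f, f)) es) = lsum (\<lambda>f. (S \<otimes> \<phi> f y) [^] p \<otimes> f) es"
      unfolding lsum_map using \<Phi>C es y by (intro lsum_cong) simp
    also have "\<dots> = comb (\<lambda>f. S \<otimes> \<phi> f y) E" unfolding comb_def
      using finsum_eq_lsum[OF es(2), of "\<lambda>f. (S \<otimes> \<phi> f y) [^] p \<otimes> f"] m es(1) by simp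
    also have "\<dots> = S [^] p \<otimes> comb (\<lambda>f. \<phi> f y) E" using \<phi>c y S fE by (intro comb_scale[symmetric]) auto
    also have "\<dots> = (S \<otimes> t) [^] p \<otimes> y" unfolding dual[OF y, symmetric]
      using S tc y by (simp add: nat_pow_distrib m_assoc)
    finally show "(S \<otimes> t) [^] p \<otimes> y = lsum (\<lambda>(c, x). \<Phi> (c \<otimes> y) [^] p \<otimes> x) (map (\<lambda>f. (C f, f)) es)" by simp
  qed
  then show ?thesis using prime_compl_mult[OF P S t] by blast
qed

end

section \<open>Fedder's criterion\<close>

context frobenius_ring
begin

lemma trace_basis_frobenius_power:
  assumes P: "primeideal P R" and tb: "trace_basis (p ^ e) s \<Phi> L" and s: "s \<in> carrier R - P"
    and K: "ideal K R" and y: "y \<in> carrier R" and m: "\<And>c. c \<in> carrier R \<Longrightarrow> \<Phi> (c \<otimes> y) \<in> K"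
  shows "y \<in> loc P (frobenius_power p e R K)"
proof -
  have FI: "ideal (frobenius_power p e R K) R" using frobenius_power_ideal[OF K] .
  have L: "set L \<subseteq> carrier R \<times> carrier R"
    and eq: "s [^] (p ^ e) \<otimes> y = lsum (\<lambda>(c, x). \<Phi> (c \<otimes> y) [^] (p ^ e) \<otimes> x) L"
    using tb y by (auto simp: trace_basis_def)
  have "lsum (\<lambda>(c, x). \<Phi> (c \<otimes> y) [^] (p ^ e) \<otimes> x) L \<in> frobenius_power p e R K"
  proof (rule lsum_ideal[OF FI])
    fix u assume u: "u \<in> set L"
    obtain c x where cx': "u = (c, x)" by (cases u)
    have cx: "c \<in> carrier R" "x \<in> carrier R" using u L cx' by auto
    show "(case u of (c, x) \<Rightarrow> \<Phi> (c \<otimes> y) [^] (p ^ e) \<otimes> x) \<in> frobenius_power p e R K"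
      unfolding cx' using ideal.I_r_closed[OF FI frobenius_power_mem[OF K m[OF cx(1)]] cx(2)] by simp
  qed
  then show ?thesis unfolding eq[symmetric] using locI[OF prime_compl_pow[OF P s] y] by blast
qed

text \<open>
  Apply \<open>\<phi>\<close> to the expansion of \<open>s\<^sup>q y\<close> and move the coefficients into \<open>\<Phi>\<close>: the multiplier is
  \<open>w = \<Sum> \<phi>(x)\<^sup>q c\<close>. The inner claim is about arbitrary lists of pairs
  so that list induction applies.
\<close>

lemma trace_basis_generates:
  assumes tb: "trace_basis q s \<Phi> L" and s: "s \<in> carrier R" and \<phi>: "\<phi> \<in> cartier_maps q"
  shows "\<exists>w\<in>carrier R. \<forall>y\<in>carrier R. s \<otimes> \<phi> y = \<Phi> (w \<otimes> y)"
proof -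
  have \<Phi>: "\<Phi> \<in> cartier_maps q" and L: "set L \<subseteq> carrier R \<times> carrier R"
    and eq: "\<And>y. y \<in> carrier R \<Longrightarrow> s [^] q \<otimes> y = lsum (\<lambda>(c, x). \<Phi> (c \<otimes> y) [^] q \<otimes> x) L"
    using tb by (auto simp: trace_basis_def)
  have main: "set M \<subseteq> carrier R \<times> carrier R \<Longrightarrow>
      lsum (\<lambda>(c, x). \<phi> x [^] q \<otimes> c) M \<in> carrier R \<and>
      (\<forall>y\<in>carrier R. lsum (\<lambda>(c, x). \<Phi> (c \<otimes> y) [^] q \<otimes> x) M \<in> carrier R \<and>
         \<phi> (lsum (\<lambda>(c, x). \<Phi> (c \<otimes> y) [^] q \<otimes> x) M) = \<Phi> (lsum (\<lambda>(c, x). \<phi> x [^] q \<otimes> c) M \<otimes> y))" for M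
  proof (induction M)
    case Nil then show ?case using cartier_zero[OF \<phi>] cartier_zero[OF \<Phi>] by simp
  next
    case (Cons u M)
    obtain c x where cx': "u = (c, x)" by (cases u)
    have cx: "c \<in> carrier R" "x \<in> carrier R" using Cons.prems cx' by auto
    let ?w = "lsum (\<lambda>(c, x). \<phi> x [^] q \<otimes> c) M"
    have IH: "?w \<in> carrier R"
      "\<And>y. y \<in> carrier R \<Longrightarrow> lsum (\<lambda>(c, x). \<Phi> (c \<otimes> y) [^] q \<otimes> x) M \<in> carrier R"
      "\<And>y. y \<in> carrier R \<Longrightarrow> \<phi> (lsum (\<lambda>(c, x). \<Phi> (c \<otimes> y) [^] q \<otimes> x) M) = \<Phi> (?w \<otimes> y)"
      using Cons by auto
    have \<phi>x: "\<phi> x \<in> carrier R" using cartierD(1)[OF \<phi> cx(2)] .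
    show ?case
    proof (intro conjI ballI)
      show "lsum (\<lambda>(c, x). \<phi> x [^] q \<otimes> c) (u # M) \<in> carrier R" using IH(1) \<phi>x cx by (simp add: cx')
      fix y assume y: "y \<in> carrier R"
      have \<Phi>y: "\<Phi> (c \<otimes> y) \<in> carrier R" using cartierD(1)[OF \<Phi>] cx y by simp
      show "lsum (\<lambda>(c, x). \<Phi> (c \<otimes> y) [^] q \<otimes> x) (u # M) \<in> carrier R" using IH(2)[OF y] \<Phi>y cx by (simp add: cx')
      have "\<phi> (lsum (\<lambda>(c, x). \<Phi> (c \<otimes> y) [^] q \<otimes> x) (u # M)) = \<Phi> (c \<otimes> y) \<otimes> \<phi> x \<oplus> \<Phi> (?w \<otimes> y)"
        using cartierD(2)[OF \<phi>] cartierD(3)[OF \<phi> \<Phi>y cx(2)] IH(2,3)[OF y] \<Phi>y cx by (simp add: cx')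
      also have "\<Phi> (c \<otimes> y) \<otimes> \<phi> x = \<Phi> (\<phi> x [^] q \<otimes> (c \<otimes> y))"
        using cartierD(3)[OF \<Phi> \<phi>x, of "c \<otimes> y"] cx y \<phi>x \<Phi>y by (simp add: m_comm)
      also have "\<dots> \<oplus> \<Phi> (?w \<otimes> y) = \<Phi> (\<phi> x [^] q \<otimes> (c \<otimes> y) \<oplus> ?w \<otimes> y)"
        using cartierD(2)[OF \<Phi>, of "\<phi> x [^] q \<otimes> (c \<otimes> y)" "?w \<otimes> y"] cx y \<phi>x IH(1) by simp
      also have "\<phi> x [^] q \<otimes> (c \<otimes> y) \<oplus> ?w \<otimes> y = lsum (\<lambda>(c, x). \<phi> x [^] q \<otimes> c) (u # M) \<otimes> y"
        using cx y \<phi>x IH(1) by (simp add: cx' l_distr m_assoc)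
      finally show "\<phi> (lsum (\<lambda>(c, x). \<Phi> (c \<otimes> y) [^] q \<otimes> x) (u # M)) = \<Phi> (lsum (\<lambda>(c, x). \<phi> x [^] q \<otimes> c) (u # M) \<otimes> y)" .
    qed
  qed
  have "s \<otimes> \<phi> y = \<Phi> (lsum (\<lambda>(c, x). \<phi> x [^] q \<otimes> c) L \<otimes> y)" if y: "y \<in> carrier R" for y
    using main[OF L] eq[OF y] cartierD(3)[OF \<phi> s y] y by simp
  then show ?thesis using main[OF L] by blast
qed

definition locally_traced :: "nat \<Rightarrow> bool"
  where "locally_traced e \<longleftrightarrow> (\<forall>P. primeideal P R \<longrightarrow> (\<exists>s\<in>carrier R - P. \<exists>\<Phi> L. trace_basis (p ^ e) s \<Phi> L))"

text \<open>
  From left to right, for \<open>c \<in> (I\<^sup>[\<^sup>q\<^sup>] : I)\<close> all maps \<open>\<Phi>(r c \<cdot>)\<close> preserve \<open>I\<close>, hence send \<open>a J\<close> into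
  \<open>J\<close>, and this forces \<open>a c J\<close> into the Frobenius power of \<open>J\<close>. From right to left, write \<open>\<phi>\<close>
  locally as \<open>\<Phi>(w \<cdot>)\<close>; that \<open>\<phi>\<close> preserves \<open>I\<close> puts \<open>t w\<close> into \<open>(I\<^sup>[\<^sup>q\<^sup>] : I)\<close> for some
  \<open>t \<notin> P\<close>.
\<close>

theorem fedder_criterion:
  assumes tr: "locally_traced e" and I: "ideal I R" and J: "ideal J R" and a: "a \<in> carrier R"
  shows "(\<forall>\<phi>\<in>cartier_maps (p ^ e). \<phi> ` I \<subseteq> I \<longrightarrow> (\<forall>j\<in>J. \<phi> (a \<otimes> j) \<in> J))
    \<longleftrightarrow> (\<forall>c\<in>ideal_colon R (frobenius_power p e R I) I. a \<otimes> c \<in> ideal_colon R (frobenius_power p e R J) J)"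
    (is "?L \<longleftrightarrow> ?R")
proof
  let ?q = "p ^ e"
  have FI: "ideal (frobenius_power p e R I) R" and FJ: "ideal (frobenius_power p e R J) R"
    using frobenius_power_ideal I J by auto
  have Ic: "i \<in> I \<Longrightarrow> i \<in> carrier R" and Jc: "j \<in> J \<Longrightarrow> j \<in> carrier R" for i j
    using ideal.Icarr[OF I] ideal.Icarr[OF J] by auto
  {
    assume L: ?L
    show ?R
    proof
      fix c assume c: "c \<in> ideal_colon R (frobenius_power p e R I) I"
      have cc: "c \<in> carrier R" using c by (simp add: ideal_colon_def)
      have "(a \<otimes> c) \<otimes> j \<in> frobenius_power p e R J" if j: "j \<in> J" for j
      proof (rule mem_ideal_if_locally[OF FJ])
        show acj: "(a \<otimes> c) \<otimes> j \<in> carrier R" using a cc Jc[OF j] by simp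
        fix P assume P: "primeideal P R"
        obtain s \<Phi> M where s: "s \<in> carrier R - P" and tb: "trace_basis ?q s \<Phi> M"
          using tr P unfolding locally_traced_def by blast
        have \<Phi>: "\<Phi> \<in> cartier_maps ?q" using tb by (simp add: trace_basis_def)
        show "(a \<otimes> c) \<otimes> j \<in> loc P (frobenius_power p e R J)"
        proof (rule trace_basis_frobenius_power[OF P tb s J acj])
          fix r assume r: "r \<in> carrier R"
          let ?\<phi> = "\<lambda>x. \<Phi> ((r \<otimes> c) \<otimes> x)"
          have "?\<phi> \<in> cartier_maps ?q" using cartier_premult[OF \<Phi>] r cc by simp
          moreover have "?\<phi> ` I \<subseteq> I"
          proof
            fix v assume "v \<in> ?\<phi> ` I"
            then obtain i where i: "i \<in> I" "v = ?\<phi> i" by blast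
            have "c \<otimes> i \<in> frobenius_power p e R I" using c i(1) by (simp add: ideal_colon_def)
            then have "r \<otimes> (c \<otimes> i) \<in> frobenius_power p e R I" using ideal.I_l_closed[OF FI _ r] by blast
            then have "(r \<otimes> c) \<otimes> i \<in> frobenius_power p e R I" using r cc Ic[OF i(1)] by (simp add: m_assoc)
            then show "v \<in> I" using cartier_frobenius_power[OF \<Phi> I] i(2) by simp
          qed
          ultimately have "?\<phi> (a \<otimes> j) \<in> J" using L j by blast
          moreover have "(r \<otimes> c) \<otimes> (a \<otimes> j) = r \<otimes> ((a \<otimes> c) \<otimes> j)" using r cc a Jc[OF j] by (simp add: m_ac)
          ultimately show "\<Phi> (r \<otimes> ((a \<otimes> c) \<otimes> j)) \<in> J" by simp
        qed
      qed
      then show "a \<otimes> c \<in> ideal_colon R (frobenius_power p e R J) J" using a cc by (simp add: ideal_colon_def)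
    qed
  next
    assume Rh: ?R
    show ?L
    proof (intro ballI impI)
      fix \<phi> j assume \<phi>: "\<phi> \<in> cartier_maps ?q" and \<phi>I: "\<phi> ` I \<subseteq> I" and j: "j \<in> J"
      have aj: "a \<otimes> j \<in> carrier R" using a Jc[OF j] by simp
      show "\<phi> (a \<otimes> j) \<in> J"
      proof (rule mem_ideal_if_locally[OF J])
        show \<phi>aj: "\<phi> (a \<otimes> j) \<in> carrier R" using cartierD(1)[OF \<phi> aj] .
        fix P assume P: "primeideal P R"
        obtain s \<Phi> M where s: "s \<in> carrier R - P" and tb: "trace_basis ?q s \<Phi> M"
          using tr P unfolding locally_traced_def by blast
        have sc: "s \<in> carrier R" using s by simp
        have \<Phi>: "\<Phi> \<in> cartier_maps ?q" using tb by (simp add: trace_basis_def)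
        obtain w where w: "w \<in> carrier R" "\<And>y. y \<in> carrier R \<Longrightarrow> s \<otimes> \<phi> y = \<Phi> (w \<otimes> y)"
          using trace_basis_generates[OF tb sc \<phi>] by blast
        have wI: "w \<otimes> i \<in> loc P (frobenius_power p e R I)" if i: "i \<in> I" for i
        proof (rule trace_basis_frobenius_power[OF P tb s I])
          show "w \<otimes> i \<in> carrier R" using w Ic[OF i] by simp
          fix r assume r: "r \<in> carrier R"
          have "s \<otimes> \<phi> (r \<otimes> i) = \<Phi> (w \<otimes> (r \<otimes> i))" using w(2) r Ic[OF i] by simp
          moreover have "w \<otimes> (r \<otimes> i) = r \<otimes> (w \<otimes> i)" using r w(1) Ic[OF i] by (simp add: m_lcomm)
          moreover have "s \<otimes> \<phi> (r \<otimes> i) \<in> I" using \<phi>I ideal.I_l_closed[OF I i r] ideal.I_l_closed[OF I _ sc] by blast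
          ultimately show "\<Phi> (r \<otimes> (w \<otimes> i)) \<in> I" by simp
        qed
        obtain G where G: "G \<subseteq> carrier R" "finite G" "I = Idl G" using finetely_gen[OF I] by blast
        have "\<exists>t\<in>carrier R - P. \<forall>g\<in>G. t \<otimes> (w \<otimes> g) \<in> frobenius_power p e R I"
          using common_denominator[OF P FI G(2), of "\<lambda>g. w \<otimes> g"] wI genideal_self[OF G(1)] G(3) by blast
        then obtain t where t: "t \<in> carrier R - P" "\<forall>g\<in>G. t \<otimes> (w \<otimes> g) \<in> frobenius_power p e R I" by blast
        have tc: "t \<in> carrier R" using t by simp
        let ?D = "{r \<in> carrier R. (t \<otimes> w) \<otimes> r \<in> frobenius_power p e R I}"
        have D: "ideal ?D R" using ideal.helper_max_prime[OF FI cring_axioms] tc w(1) by simp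
        have "G \<subseteq> ?D" using t(2) G(1) tc w(1) by (auto simp: m_assoc)
        then have "Idl G \<subseteq> ?D" by (rule genideal_minimal[OF D])
        then have "I \<subseteq> ?D" by (simp only: G(3)[symmetric])
        then have "t \<otimes> w \<in> ideal_colon R (frobenius_power p e R I) I" using tc w(1) by (auto simp: ideal_colon_def)
        then have "a \<otimes> (t \<otimes> w) \<in> ideal_colon R (frobenius_power p e R J) J" using Rh by blast
        then have m: "(a \<otimes> (t \<otimes> w)) \<otimes> j \<in> frobenius_power p e R J" using j by (simp add: ideal_colon_def)
        \<comment> \<open>multiply by the missing powers of \<open>t\<close> so that \<open>t\<close> can be taken out of \<open>\<Phi>\<close>\<close>
        have q: "?q > 0" using p_pos by simp
        have "t [^] (?q - 1) \<otimes> ((a \<otimes> (t \<otimes> w)) \<otimes> j) \<in> frobenius_power p e R J"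
          using ideal.I_l_closed[OF FJ m] tc by simp
        moreover have "t [^] (?q - 1) \<otimes> ((a \<otimes> (t \<otimes> w)) \<otimes> j) = t [^] ?q \<otimes> (w \<otimes> (a \<otimes> j))"
        proof -
          have "t [^] ?q = t [^] (?q - 1) \<otimes> t" using q nat_pow_mult[OF tc, of "?q - 1" 1] tc by simp
          then show ?thesis using tc a w(1) Jc[OF j] by (simp add: m_ac)
        qed
        ultimately have "\<Phi> (t [^] ?q \<otimes> (w \<otimes> (a \<otimes> j))) \<in> J" using cartier_frobenius_power[OF \<Phi> J] by simp
        then have "t \<otimes> (s \<otimes> \<phi> (a \<otimes> j)) \<in> J"
          using cartierD(3)[OF \<Phi> tc, of "w \<otimes> (a \<otimes> j)"] w aj by simp
        then have "(t \<otimes> s) \<otimes> \<phi> (a \<otimes> j) \<in> J" using tc sc \<phi>aj by (simp add: m_assoc)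
        then show "\<phi> (a \<otimes> j) \<in> loc P J" using locI[OF prime_compl_mult[OF P t(1) s] \<phi>aj] by blast
      qed
    qed
  }
qed

lemma coset_carrier:
  assumes "ideal I R" shows "carrier (R Quot I) = (+>) I ` carrier R"
  by (auto simp: FactRing_def A_RCOSETS_def')

lemma coset_ops:
  assumes "ideal I R" "x \<in> carrier R" "y \<in> carrier R"
  shows "(I +> x) \<otimes>\<^bsub>R Quot I\<^esub> (I +> y) = I +> (x \<otimes> y)"
    "(I +> x) \<oplus>\<^bsub>R Quot I\<^esub> (I +> y) = I +> (x \<oplus> y)"
    "I +> x = I +> y \<longleftrightarrow> x \<ominus> y \<in> I"
proof -
  interpret h: ring_hom_ring R "R Quot I" "(+>) I" using ideal.rcos_ring_hom_ring[OF assms(1)] .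
  show "(I +> x) \<otimes>\<^bsub>R Quot I\<^esub> (I +> y) = I +> (x \<otimes> y)"
    "(I +> x) \<oplus>\<^bsub>R Quot I\<^esub> (I +> y) = I +> (x \<oplus> y)" using assms by simp_all
  show "I +> x = I +> y \<longleftrightarrow> x \<ominus> y \<in> I" using quotient_eq_iff_same_a_r_cos[OF assms] by blast
qed

lemma coset_pow:
  assumes "ideal I R" "x \<in> carrier R"
  shows "(I +> x) [^]\<^bsub>R Quot I\<^esub> (n::nat) = I +> (x [^] n)"
proof -
  interpret h: ring_hom_cring R "R Quot I" "(+>) I" using ideal.rcos_ring_hom_cring[OF assms(1) cring_axioms] .
  show ?thesis using h.hom_pow[OF assms(2)] by simp
qed

lemma coset_mem_quotient_ideal:
  assumes I: "ideal I R" and J: "ideal J R" "I \<subseteq> J" and x: "x \<in> carrier R"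
  shows "I +> x \<in> quotient_ideal R I J \<longleftrightarrow> x \<in> J"
proof
  assume "I +> x \<in> quotient_ideal R I J"
  then obtain j where j: "j \<in> J" "I +> x = I +> j" unfolding quotient_ideal_def by blast
  have jc: "j \<in> carrier R" using ideal.Icarr[OF J(1) j(1)] .
  have "x \<ominus> j \<in> J" using coset_ops(3)[OF I x jc] j(2) J(2) by blast
  then have "(x \<ominus> j) \<oplus> j \<in> J" using ideal_add_closed[OF J(1)] j(1) by blast
  moreover have "(x \<ominus> j) \<oplus> j = x" using x jc by algebra
  ultimately show "x \<in> J" by simp
qed (auto simp: quotient_ideal_def)

text \<open>
  A Cartier map that preserves \<open>I\<close> induces a map \<open>\<psi>\<close> on the quotient. Conversely, from \<open>\<psi>\<close> one
  obtains a lift of \<open>s \<psi>\<close> for some \<open>s \<notin> P\<close>, namely \<open>\<phi>(z) = \<Sum> \<Phi>(c z) h(x)\<close>, where \<open>h(x)\<close>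
  represents \<open>\<psi>(x + I)\<close>. A lift near each prime is enough because membership in \<open>J\<close> is local.
\<close>

theorem quotient_compatible_iff:
  assumes tr: "locally_traced e" and I: "ideal I R" and J: "ideal J R" "I \<subseteq> J" and A: "ideal A R"
  shows "(\<forall>a\<in>extend_ideal R I A.
       \<forall>\<psi>\<in>linear_maps (R Quot I) (frobenius_pushforward p e (R Quot I) (self_module (R Quot I))) (self_module (R Quot I)).
         \<psi> ` ((\<lambda>x. a \<otimes>\<^bsub>R Quot I\<^esub> x) ` quotient_ideal R I J) \<subseteq> quotient_ideal R I J)
    \<longleftrightarrow> (\<forall>a\<in>A. \<forall>\<phi>\<in>cartier_maps (p ^ e). \<phi> ` I \<subseteq> I \<longrightarrow> (\<forall>j\<in>J. \<phi> (a \<otimes> j) \<in> J))"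
    (is "?L \<longleftrightarrow> ?R")
proof -
  let ?Q = "R Quot I" and ?q = "p ^ e"
  interpret Q: cring ?Q using ideal.quotient_is_cring[OF I cring_axioms] .
  note Qcar = coset_carrier[OF I] and ops = coset_ops[OF I] and cpow = coset_pow[OF I] and mem = coset_mem_quotient_ideal[OF I J]
  have Jc: "j \<in> J \<Longrightarrow> j \<in> carrier R" and Ac: "a \<in> A \<Longrightarrow> a \<in> carrier R" and Ic: "i \<in> I \<Longrightarrow> i \<in> carrier R" for a j i
    using ideal.Icarr[OF J(1)] ideal.Icarr[OF A] ideal.Icarr[OF I] by auto
  have ext: "extend_ideal R I A = (+>) I ` A"
  proof -
    have "ideal ((+>) I ` A) ?Q" using ring_ideal_imp_quot_ideal[OF I A] .
    then show ?thesis unfolding extend_ideal_def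
      using Q.genideal_minimal[of "(+>) I ` A" "(+>) I ` A"] Q.genideal_self[of "(+>) I ` A"] Qcar ideal.Icarr[OF A]
      by blast
  qed
  have lin: "linear_maps ?Q (frobenius_pushforward p e ?Q (self_module ?Q)) (self_module ?Q) = cring.cartier_maps ?Q ?q"
    by (rule Q.cartier_maps_eq)
  have cos: "I +> x \<in> carrier ?Q" if "x \<in> carrier R" for x using that Qcar by blast
  show ?thesis unfolding ext lin
  proof
    assume L: "\<forall>a\<in>(+>) I ` A. \<forall>\<psi>\<in>cring.cartier_maps ?Q ?q. \<psi> ` ((\<lambda>x. a \<otimes>\<^bsub>?Q\<^esub> x) ` quotient_ideal R I J) \<subseteq> quotient_ideal R I J"
    show ?R
    proof (intro ballI impI)
      fix a \<phi> j assume a: "a \<in> A" and \<phi>: "\<phi> \<in> cartier_maps ?q" and \<phi>I: "\<phi> ` I \<subseteq> I" and j: "j \<in> J"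
      define \<psi> where "\<psi> X = I +> \<phi> (SOME x. x \<in> carrier R \<and> X = I +> x)" for X
      have \<psi>: "\<psi> (I +> x) = I +> \<phi> x" if x: "x \<in> carrier R" for x
      proof -
        define y where "y = (SOME y. y \<in> carrier R \<and> I +> x = I +> y)"
        have y: "y \<in> carrier R" "I +> x = I +> y"
          using someI[of "\<lambda>y. y \<in> carrier R \<and> I +> x = I +> y" x] x unfolding y_def by auto
        have d: "x \<ominus> y \<in> I" using ops(3)[OF x y(1)] y(2) by blast
        have "(x \<ominus> y) \<oplus> y = x" using x y(1) by algebra
        then have "\<phi> x = \<phi> (x \<ominus> y) \<oplus> \<phi> y" using cartierD(2)[OF \<phi>, of "x \<ominus> y" y] x y(1) by simp
        moreover have "\<phi> (x \<ominus> y) \<in> I" using \<phi>I d by blast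
        moreover have "(u \<oplus> v) \<ominus> v = u" if "u \<in> carrier R" "v \<in> carrier R" for u v using that by algebra
        ultimately have "\<phi> x \<ominus> \<phi> y \<in> I" using cartierD(1)[OF \<phi>] x y(1) by simp
        then have "I +> \<phi> x = I +> \<phi> y" using ops(3) cartierD(1)[OF \<phi>] x y(1) by blast
        then show ?thesis by (simp add: \<psi>_def y_def)
      qed
      have "\<psi> \<in> cring.cartier_maps ?Q ?q"
        unfolding Q.cartier_maps_def
      proof (intro CollectI conjI ballI)
        show "\<psi> \<in> carrier ?Q \<rightarrow> carrier ?Q" using \<psi> cos cartierD(1)[OF \<phi>] unfolding Qcar by auto
        fix X Y assume "X \<in> carrier ?Q" "Y \<in> carrier ?Q"
        then obtain x y where xy: "x \<in> carrier R" "X = I +> x" "y \<in> carrier R" "Y = I +> y" unfolding Qcar by blast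
        show "\<psi> (X \<oplus>\<^bsub>?Q\<^esub> Y) = \<psi> X \<oplus>\<^bsub>?Q\<^esub> \<psi> Y"
          unfolding xy(2,4) using xy(1,3) cartierD(1,2)[OF \<phi>] by (simp add: ops \<psi>)
        show "\<psi> (X [^]\<^bsub>?Q\<^esub> ?q \<otimes>\<^bsub>?Q\<^esub> Y) = X \<otimes>\<^bsub>?Q\<^esub> \<psi> Y"
          unfolding xy(2,4) using xy(1,3) cartierD(1,3)[OF \<phi>] by (simp add: ops cpow \<psi>)
      qed
      moreover have "I +> a \<in> (+>) I ` A" using a by blast
      moreover have "I +> j \<in> quotient_ideal R I J" using j by (simp add: quotient_ideal_def)
      ultimately have "\<psi> ((I +> a) \<otimes>\<^bsub>?Q\<^esub> (I +> j)) \<in> quotient_ideal R I J" using L by blast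
      then have "I +> \<phi> (a \<otimes> j) \<in> quotient_ideal R I J" using ops(1)[OF Ac[OF a] Jc[OF j]] \<psi> Ac[OF a] Jc[OF j] by simp
      then show "\<phi> (a \<otimes> j) \<in> J" using mem cartierD(1)[OF \<phi>] Ac[OF a] Jc[OF j] by simp
    qed
  next
    assume Rh: ?R
    show "\<forall>a\<in>(+>) I ` A. \<forall>\<psi>\<in>cring.cartier_maps ?Q ?q. \<psi> ` ((\<lambda>x. a \<otimes>\<^bsub>?Q\<^esub> x) ` quotient_ideal R I J) \<subseteq> quotient_ideal R I J"
    proof (intro ballI subsetI)
      fix X \<psi> V assume X: "X \<in> (+>) I ` A" and \<psi>: "\<psi> \<in> cring.cartier_maps ?Q ?q"
        and V: "V \<in> \<psi> ` ((\<lambda>x. X \<otimes>\<^bsub>?Q\<^esub> x) ` quotient_ideal R I J)"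
      obtain a where a: "a \<in> A" "X = I +> a" using X by blast
      obtain j where j: "j \<in> J" "V = \<psi> ((I +> a) \<otimes>\<^bsub>?Q\<^esub> (I +> j))" using V unfolding quotient_ideal_def a(2) by blast
      have ac: "a \<in> carrier R" and jc: "j \<in> carrier R" using Ac Jc a j by auto
      have V': "V = \<psi> (I +> (a \<otimes> j))" using j(2) ops(1)[OF ac jc] by simp
      have "\<forall>x\<in>carrier R. \<exists>y. y \<in> carrier R \<and> \<psi> (I +> x) = I +> y"
        using Q.cartierD(1)[OF \<psi>] cos unfolding Qcar by blast
      from bchoice[OF this] obtain h where h: "\<And>x. x \<in> carrier R \<Longrightarrow> h x \<in> carrier R"
        "\<And>x. x \<in> carrier R \<Longrightarrow> \<psi> (I +> x) = I +> h x" by blast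
      have haj: "h (a \<otimes> j) \<in> carrier R" using h ac jc by simp
      have "h (a \<otimes> j) \<in> J"
      proof (rule mem_ideal_if_locally[OF J(1) haj])
        fix P assume P: "primeideal P R"
        obtain s \<Phi> M where s: "s \<in> carrier R - P" and tb: "trace_basis ?q s \<Phi> M"
          using tr P unfolding locally_traced_def by blast
        have sc: "s \<in> carrier R" using s by simp
        have \<Phi>: "\<Phi> \<in> cartier_maps ?q" and M: "set M \<subseteq> carrier R \<times> carrier R"
          and eq: "\<And>y. y \<in> carrier R \<Longrightarrow> s [^] ?q \<otimes> y = lsum (\<lambda>(c, x). \<Phi> (c \<otimes> y) [^] ?q \<otimes> x) M"
          using tb by (auto simp: trace_basis_def)
        have \<Phi>c: "\<Phi> y \<in> carrier R" if "y \<in> carrier R" for y using cartierD(1)[OF \<Phi> that] .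
        define \<phi> where "\<phi> z = lsum (\<lambda>(c, x). \<Phi> (c \<otimes> z) \<otimes> h x) M" for z
        have main: "set N \<subseteq> carrier R \<times> carrier R \<Longrightarrow> (\<lambda>z. lsum (\<lambda>(c, x). \<Phi> (c \<otimes> z) \<otimes> h x) N) \<in> cartier_maps ?q
            \<and> (\<forall>z\<in>carrier R. lsum (\<lambda>(c, x). \<Phi> (c \<otimes> z) [^] ?q \<otimes> x) N \<in> carrier R \<and>
              I +> lsum (\<lambda>(c, x). \<Phi> (c \<otimes> z) \<otimes> h x) N = \<psi> (I +> lsum (\<lambda>(c, x). \<Phi> (c \<otimes> z) [^] ?q \<otimes> x) N))" for N
        proof (induction N)
          case Nil
          have "I +> \<zero> = \<zero>\<^bsub>?Q\<^esub>" using ring_hom_zero[OF ideal.rcos_ring_hom[OF I] ring_axioms Q.ring_axioms] .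
          then have "\<psi> (I +> \<zero>) = I +> \<zero>" using Q.cartier_zero[OF \<psi>] by simp
          then show ?case by (simp add: cartier_maps_def)
        next
          case (Cons u N)
          obtain c x where cx': "u = (c, x)" by (cases u)
          have cx: "c \<in> carrier R" "x \<in> carrier R" using Cons.prems cx' by auto
          let ?f = "\<lambda>z. lsum (\<lambda>(c, x). \<Phi> (c \<otimes> z) \<otimes> h x) N"
          let ?g = "\<lambda>z. lsum (\<lambda>(c, x). \<Phi> (c \<otimes> z) [^] ?q \<otimes> x) N"
          have f: "?f \<in> cartier_maps ?q" and g: "\<And>z. z \<in> carrier R \<Longrightarrow> ?g z \<in> carrier R"
            and fg: "\<And>z. z \<in> carrier R \<Longrightarrow> I +> ?f z = \<psi> (I +> ?g z)" using Cons by auto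
          have hx: "h x \<in> carrier R" using h cx by simp
          have \<Phi>cz: "\<Phi> (c \<otimes> z) \<in> carrier R" if "z \<in> carrier R" for z using \<Phi>c cx that by simp
          note pre = cartierD[OF cartier_premult[OF \<Phi> cx(1)]]
          have "(\<lambda>z. \<Phi> (c \<otimes> z) \<otimes> h x \<oplus> ?f z) \<in> cartier_maps ?q"
            unfolding cartier_maps_def
          proof (intro CollectI conjI ballI)
            show "(\<lambda>z. \<Phi> (c \<otimes> z) \<otimes> h x \<oplus> ?f z) \<in> carrier R \<rightarrow> carrier R"
              using \<Phi>cz hx cartierD(1)[OF f] by auto
            fix y z assume y: "y \<in> carrier R" and z: "z \<in> carrier R"
            have alg: "(u \<oplus> v) \<otimes> w \<oplus> (b \<oplus> d) = (u \<otimes> w \<oplus> b) \<oplus> (v \<otimes> w \<oplus> d)"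
              if "u \<in> carrier R" "v \<in> carrier R" "w \<in> carrier R" "b \<in> carrier R" "d \<in> carrier R" for u v w b d
              using that by algebra
            show "\<Phi> (c \<otimes> (y \<oplus> z)) \<otimes> h x \<oplus> ?f (y \<oplus> z) = (\<Phi> (c \<otimes> y) \<otimes> h x \<oplus> ?f y) \<oplus> (\<Phi> (c \<otimes> z) \<otimes> h x \<oplus> ?f z)"
              unfolding pre(2)[OF y z] cartierD(2)[OF f y z]
              by (rule alg[OF \<Phi>cz[OF y] \<Phi>cz[OF z] hx cartierD(1)[OF f y] cartierD(1)[OF f z]])
            show "\<Phi> (c \<otimes> (y [^] ?q \<otimes> z)) \<otimes> h x \<oplus> ?f (y [^] ?q \<otimes> z) = y \<otimes> (\<Phi> (c \<otimes> z) \<otimes> h x \<oplus> ?f z)"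
              unfolding pre(3)[OF y z] cartierD(3)[OF f y z] using \<Phi>cz[OF z] y hx cartierD(1)[OF f z]
              by (simp add: r_distr m_assoc)
          qed
          moreover have "I +> (\<Phi> (c \<otimes> z) \<otimes> h x \<oplus> ?f z) = \<psi> (I +> (\<Phi> (c \<otimes> z) [^] ?q \<otimes> x \<oplus> ?g z))"
            if z: "z \<in> carrier R" for z
          proof -
            have "I +> (\<Phi> (c \<otimes> z) \<otimes> h x \<oplus> ?f z) = ((I +> \<Phi> (c \<otimes> z)) \<otimes>\<^bsub>?Q\<^esub> \<psi> (I +> x)) \<oplus>\<^bsub>?Q\<^esub> \<psi> (I +> ?g z)"
              unfolding h(2)[OF cx(2)] fg[OF z, symmetric] using ops(1,2) \<Phi>cz[OF z] hx cartierD(1)[OF f z] by simp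
            also have "\<dots> = \<psi> ((I +> \<Phi> (c \<otimes> z)) [^]\<^bsub>?Q\<^esub> ?q \<otimes>\<^bsub>?Q\<^esub> (I +> x)) \<oplus>\<^bsub>?Q\<^esub> \<psi> (I +> ?g z)"
              using Q.cartierD(3)[OF \<psi> cos cos] \<Phi>cz[OF z] cx by simp
            also have "\<dots> = \<psi> (I +> (\<Phi> (c \<otimes> z) [^] ?q \<otimes> x)) \<oplus>\<^bsub>?Q\<^esub> \<psi> (I +> ?g z)"
              using cpow ops(1) \<Phi>cz[OF z] cx by simp
            also have "\<dots> = \<psi> ((I +> (\<Phi> (c \<otimes> z) [^] ?q \<otimes> x)) \<oplus>\<^bsub>?Q\<^esub> (I +> ?g z))"
              using Q.cartierD(2)[OF \<psi> cos cos] \<Phi>cz[OF z] cx g[OF z] by simp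
            also have "\<dots> = \<psi> (I +> (\<Phi> (c \<otimes> z) [^] ?q \<otimes> x \<oplus> ?g z))"
              using ops(2) \<Phi>cz[OF z] cx g[OF z] by simp
            finally show ?thesis .
          qed
          ultimately show ?case using g \<Phi>cz cx by (simp add: cx')
        qed
        have \<phi>: "\<phi> \<in> cartier_maps ?q" using main[OF M] unfolding \<phi>_def by blast
        have \<phi>\<psi>: "I +> \<phi> z = (I +> s) \<otimes>\<^bsub>?Q\<^esub> \<psi> (I +> z)" if z: "z \<in> carrier R" for z
        proof -
          have "I +> \<phi> z = \<psi> (I +> (s [^] ?q \<otimes> z))" using main[OF M] z eq[OF z] unfolding \<phi>_def by simp
          also have "\<dots> = \<psi> ((I +> s) [^]\<^bsub>?Q\<^esub> ?q \<otimes>\<^bsub>?Q\<^esub> (I +> z))" using cpow ops(1) sc z by simp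
          also have "\<dots> = (I +> s) \<otimes>\<^bsub>?Q\<^esub> \<psi> (I +> z)" using Q.cartierD(3)[OF \<psi> cos cos] sc z by simp
          finally show ?thesis .
        qed
        have "\<phi> ` I \<subseteq> I"
        proof
          fix v assume "v \<in> \<phi> ` I"
          then obtain i where i: "i \<in> I" "v = \<phi> i" by blast
          have z: "I +> \<zero> = \<zero>\<^bsub>?Q\<^esub>" using ring_hom_zero[OF ideal.rcos_ring_hom[OF I] ring_axioms Q.ring_axioms] .
          have "I +> i = I +> \<zero>" using ops(3)[OF Ic[OF i(1)] zero_closed] i(1) Ic[OF i(1)] by (simp add: a_minus_def)
          then have "I +> \<phi> i = (I +> s) \<otimes>\<^bsub>?Q\<^esub> \<zero>\<^bsub>?Q\<^esub>" using \<phi>\<psi>[OF Ic[OF i(1)]] Q.cartier_zero[OF \<psi>] z by simp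
          then have "I +> \<phi> i = I +> \<zero>" using z cos[OF sc] by simp
          then show "v \<in> I" using ops(3)[OF _ zero_closed] cartierD(1)[OF \<phi> Ic[OF i(1)]] i(2) by (simp add: a_minus_def)
        qed
        then have "\<phi> (a \<otimes> j) \<in> J" using Rh a(1) \<phi> j(1) by blast
        then have "I +> \<phi> (a \<otimes> j) \<in> quotient_ideal R I J" by (simp add: quotient_ideal_def)
        moreover have "I +> \<phi> (a \<otimes> j) = I +> (s \<otimes> h (a \<otimes> j))" using \<phi>\<psi> h ac jc sc ops(1) by simp
        ultimately have "s \<otimes> h (a \<otimes> j) \<in> J" using mem sc haj by simp
        then show "h (a \<otimes> j) \<in> loc P J" using locI[OF s haj] by blast
      qed
      then show "V \<in> quotient_ideal R I J" unfolding V' using h(2) ac jc by (simp add: quotient_ideal_def)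
    qed
  qed
qed

end

section \<open>Regular parameters from a regular localization\<close>

locale prime_localization = noetherian_cring +
  fixes P
  assumes P: "primeideal P R"
begin

abbreviation M :: "'a set" where "M \<equiv> carrier R - P"
abbreviation A :: "('a \<times> 'a) set ring" where "A \<equiv> localization R M"
abbreviation frac :: "'a \<Rightarrow> 'a \<Rightarrow> ('a \<times> 'a) set" where "frac \<equiv> fraction R M"

lemma P_ideal: "ideal P R" using P primeideal.axioms(1) by blast

lemma M_mult: "s \<in> M \<Longrightarrow> t \<in> M \<Longrightarrow> s \<otimes> t \<in> M" using prime_compl_mult[OF P] .
lemma M_one: "\<one> \<in> M" using prime_compl_one[OF P] .

lemma rel_iff: "((a, s), (b, t)) \<in> fraction_rel R M \<longleftrightarrow>
  a \<in> carrier R \<and> s \<in> M \<and> b \<in> carrier R \<and> t \<in> M \<and> (\<exists>u\<in>M. u \<otimes> (a \<otimes> t) = u \<otimes> (b \<otimes> s))"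
proof -
  have "u \<otimes> (a \<otimes> t \<ominus> b \<otimes> s) = \<zero> \<longleftrightarrow> u \<otimes> (a \<otimes> t) = u \<otimes> (b \<otimes> s)"
    if c: "u \<in> carrier R" "a \<in> carrier R" "t \<in> carrier R" "b \<in> carrier R" "s \<in> carrier R" for u
  proof -
    have "u \<otimes> (a \<otimes> t \<ominus> b \<otimes> s) = u \<otimes> (a \<otimes> t) \<ominus> u \<otimes> (b \<otimes> s)" using c by algebra
    then show ?thesis using c by simp
  qed
  then show ?thesis unfolding fraction_rel_def by auto
qed

lemma rel_equiv: "equiv (carrier R \<times> M) (fraction_rel R M)"
proof (rule equivI)
  show "fraction_rel R M \<subseteq> (carrier R \<times> M) \<times> (carrier R \<times> M)" by (auto simp: fraction_rel_def)
  show "refl_on (carrier R \<times> M) (fraction_rel R M)"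
    unfolding refl_on_def
  proof (intro ballI)
    fix x assume "x \<in> carrier R \<times> M"
    then show "(x, x) \<in> fraction_rel R M" using M_one by (cases x) (simp only: rel_iff, blast)
  qed
  show "sym (fraction_rel R M)"
  proof (rule symI)
    fix x y assume "(x, y) \<in> fraction_rel R M"
    then show "(y, x) \<in> fraction_rel R M" by (cases x; cases y) (simp only: rel_iff, metis)
  qed
  show "trans (fraction_rel R M)"
  proof (rule transI)
    fix x y z assume xy: "(x, y) \<in> fraction_rel R M" and yz: "(y, z) \<in> fraction_rel R M"
    obtain a s b t c r where e: "x = (a, s)" "y = (b, t)" "z = (c, r)" by (cases x; cases y; cases z)
    obtain u where u: "a \<in> carrier R" "s \<in> M" "b \<in> carrier R" "t \<in> M" "u \<in> M" "u \<otimes> (a \<otimes> t) = u \<otimes> (b \<otimes> s)"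
      using xy unfolding e rel_iff by blast
    obtain v where v: "c \<in> carrier R" "r \<in> M" "v \<in> M" "v \<otimes> (b \<otimes> r) = v \<otimes> (c \<otimes> t)"
      using yz unfolding e rel_iff by blast
    have cc: "u \<in> carrier R" "v \<in> carrier R" "s \<in> carrier R" "t \<in> carrier R" "r \<in> carrier R" using u v by auto
    have "(u \<otimes> v \<otimes> t) \<otimes> (a \<otimes> r) = v \<otimes> r \<otimes> (u \<otimes> (a \<otimes> t))" using cc u(1) by algebra
    also have "\<dots> = u \<otimes> s \<otimes> (v \<otimes> (b \<otimes> r))" unfolding u(6) using cc u(3) by algebra
    also have "\<dots> = (u \<otimes> v \<otimes> t) \<otimes> (c \<otimes> s)" unfolding v(4) using cc v(1) by algebra
    finally have "(u \<otimes> v \<otimes> t) \<otimes> (a \<otimes> r) = (u \<otimes> v \<otimes> t) \<otimes> (c \<otimes> s)" .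
    moreover have "u \<otimes> v \<otimes> t \<in> M" using M_mult[OF M_mult[OF u(5) v(3)] u(4)] .
    ultimately show "(x, z) \<in> fraction_rel R M" unfolding e rel_iff using u v by blast
  qed
qed

lemma frac_eq_iff:
  assumes "a \<in> carrier R" "s \<in> M" "b \<in> carrier R" "t \<in> M"
  shows "frac a s = frac b t \<longleftrightarrow> (\<exists>u\<in>M. u \<otimes> (a \<otimes> t) = u \<otimes> (b \<otimes> s))"
  unfolding fraction_def using eq_equiv_class_iff[OF rel_equiv, of "(a, s)" "(b, t)"] assms
  by (simp only: rel_iff mem_Sigma_iff simp_thms)

lemma carrierA: "carrier A = {frac a s | a s. a \<in> carrier R \<and> s \<in> M}"
  unfolding localization_def fraction_def quotient_def by auto

lemma frac_mem: "(a', s') \<in> frac a s \<longleftrightarrow> ((a, s), (a', s')) \<in> fraction_rel R M"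
  unfolding fraction_def by simp

text \<open>
  The operations of the localization are unions over all representatives; such a union is a single
  class as soon as the class does not depend on the representatives.
\<close>

lemma frac_union:
  assumes "a \<in> carrier R" "s \<in> M" "b \<in> carrier R" "t \<in> M"
    and G: "\<And>a' s' b' t'. a' \<in> carrier R \<Longrightarrow> s' \<in> M \<Longrightarrow> b' \<in> carrier R \<Longrightarrow> t' \<in> M \<Longrightarrow>
      frac a s = frac a' s' \<Longrightarrow> frac b t = frac b' t' \<Longrightarrow> G a' s' b' t' = C"
  shows "(\<Union>(a', s')\<in>frac a s. \<Union>(b', t')\<in>frac b t. G a' s' b' t') = C"
proof -
  have self: "(a, s) \<in> frac a s" "(b, t) \<in> frac b t"
    using assms(1-4) rel_equiv by (auto simp: fraction_def equiv_def refl_on_def)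
  have el: "a' \<in> carrier R \<and> s' \<in> M \<and> frac a s = frac a' s'" if "(a', s') \<in> frac a s" for a s a' s'
    using that equiv_class_eq[OF rel_equiv, of "(a, s)" "(a', s')"] unfolding frac_mem
    by (auto simp: fraction_def fraction_rel_def)
  have "G a' s' b' t' = C" if "(a', s') \<in> frac a s" "(b', t') \<in> frac b t" for a' s' b' t'
    using G el[OF that(1)] el[OF that(2)] by blast
  then have "(\<Union>(a', s')\<in>frac a s. \<Union>(b', t')\<in>frac b t. G a' s' b' t') = (\<Union>x\<in>frac a s. \<Union>y\<in>frac b t. C)"
    by (intro SUP_cong refl) (auto split: prod.split)
  then show ?thesis using self by auto
qed

lemma frac_mult:
  assumes "a \<in> carrier R" "s \<in> M" "b \<in> carrier R" "t \<in> M"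
  shows "frac a s \<otimes>\<^bsub>A\<^esub> frac b t = frac (a \<otimes> b) (s \<otimes> t)"
proof -
  have "(\<Union>(a', s')\<in>frac a s. \<Union>(b', t')\<in>frac b t. frac (a' \<otimes> b') (s' \<otimes> t')) = frac (a \<otimes> b) (s \<otimes> t)"
  proof (rule frac_union[OF assms])
    fix a' s' b' t' assume c: "a' \<in> carrier R" "s' \<in> M" "b' \<in> carrier R" "t' \<in> M"
      and e: "frac a s = frac a' s'" "frac b t = frac b' t'"
    obtain u where u: "u \<in> M" "u \<otimes> (a \<otimes> s') = u \<otimes> (a' \<otimes> s)" using e(1) frac_eq_iff[OF assms(1,2) c(1,2)] by blast
    obtain v where v: "v \<in> M" "v \<otimes> (b \<otimes> t') = v \<otimes> (b' \<otimes> t)" using e(2) frac_eq_iff[OF assms(3,4) c(3,4)] by blast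
    have cc: "u \<in> carrier R" "v \<in> carrier R" "s \<in> carrier R" "t \<in> carrier R" "s' \<in> carrier R" "t' \<in> carrier R"
      using u v c assms by auto
    have "(u \<otimes> v) \<otimes> ((a' \<otimes> b') \<otimes> (s \<otimes> t)) = (u \<otimes> (a' \<otimes> s)) \<otimes> (v \<otimes> (b' \<otimes> t))" using cc c(1,3) by algebra
    also have "\<dots> = (u \<otimes> v) \<otimes> ((a \<otimes> b) \<otimes> (s' \<otimes> t'))"
      unfolding u(2)[symmetric] v(2)[symmetric] using cc assms(1,3) by algebra
    finally show "frac (a' \<otimes> b') (s' \<otimes> t') = frac (a \<otimes> b) (s \<otimes> t)"
      using frac_eq_iff[of "a' \<otimes> b'" "s' \<otimes> t'" "a \<otimes> b" "s \<otimes> t"] M_mult[OF u(1) v(1)] M_mult[OF c(2,4)] M_mult[OF assms(2,4)]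
        c(1,3) assms(1,3) m_closed by metis
  qed
  then show ?thesis by (simp add: localization_def)
qed

lemma frac_add:
  assumes "a \<in> carrier R" "s \<in> M" "b \<in> carrier R" "t \<in> M"
  shows "frac a s \<oplus>\<^bsub>A\<^esub> frac b t = frac (a \<otimes> t \<oplus> b \<otimes> s) (s \<otimes> t)"
proof -
  have "(\<Union>(a', s')\<in>frac a s. \<Union>(b', t')\<in>frac b t. frac (a' \<otimes> t' \<oplus> b' \<otimes> s') (s' \<otimes> t')) = frac (a \<otimes> t \<oplus> b \<otimes> s) (s \<otimes> t)"
  proof (rule frac_union[OF assms])
    fix a' s' b' t' assume c: "a' \<in> carrier R" "s' \<in> M" "b' \<in> carrier R" "t' \<in> M"
      and e: "frac a s = frac a' s'" "frac b t = frac b' t'"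
    obtain u where u: "u \<in> M" "u \<otimes> (a \<otimes> s') = u \<otimes> (a' \<otimes> s)" using e(1) frac_eq_iff[OF assms(1,2) c(1,2)] by blast
    obtain v where v: "v \<in> M" "v \<otimes> (b \<otimes> t') = v \<otimes> (b' \<otimes> t)" using e(2) frac_eq_iff[OF assms(3,4) c(3,4)] by blast
    have cc: "u \<in> carrier R" "v \<in> carrier R" "s \<in> carrier R" "t \<in> carrier R" "s' \<in> carrier R" "t' \<in> carrier R"
      using u v c assms by auto
    have "(u \<otimes> v) \<otimes> ((a' \<otimes> t' \<oplus> b' \<otimes> s') \<otimes> (s \<otimes> t))
        = (u \<otimes> (a' \<otimes> s)) \<otimes> (v \<otimes> t \<otimes> t') \<oplus> (v \<otimes> (b' \<otimes> t)) \<otimes> (u \<otimes> s \<otimes> s')" using cc c(1,3) by algebra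
    also have "\<dots> = (u \<otimes> v) \<otimes> ((a \<otimes> t \<oplus> b \<otimes> s) \<otimes> (s' \<otimes> t'))"
      unfolding u(2)[symmetric] v(2)[symmetric] using cc assms(1,3) by algebra
    finally show "frac (a' \<otimes> t' \<oplus> b' \<otimes> s') (s' \<otimes> t') = frac (a \<otimes> t \<oplus> b \<otimes> s) (s \<otimes> t)"
      using frac_eq_iff[of "a' \<otimes> t' \<oplus> b' \<otimes> s'" "s' \<otimes> t'" "a \<otimes> t \<oplus> b \<otimes> s" "s \<otimes> t"]
        M_mult[OF u(1) v(1)] M_mult[OF c(2,4)] M_mult[OF assms(2,4)] cc c(1,3) assms(1,3) m_closed a_closed by metis
  qed
  then show ?thesis by (simp add: localization_def)
qed

lemma frac_one: "\<one>\<^bsub>A\<^esub> = frac \<one> \<one>" and frac_zero: "\<zero>\<^bsub>A\<^esub> = frac \<zero> \<one>"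
  by (simp_all add: localization_def)

definition to_loc :: "'a \<Rightarrow> ('a \<times> 'a) set" where "to_loc x = frac x \<one>"

lemma to_loc_hom: "to_loc \<in> ring_hom R A"
  using M_one by (intro ring_hom_memI)
    (auto simp: to_loc_def carrierA frac_mult frac_add frac_one)

lemma frac_as_quotient: "a \<in> carrier R \<Longrightarrow> s \<in> M \<Longrightarrow> to_loc s \<otimes>\<^bsub>A\<^esub> frac a s = to_loc a"
  unfolding to_loc_def using M_one by (simp add: frac_mult frac_eq_iff) (auto intro!: bexI[of _ \<one>] simp: m_comm)

lemma to_loc_inverse: "s \<in> M \<Longrightarrow> to_loc s \<otimes>\<^bsub>A\<^esub> frac \<one> s = \<one>\<^bsub>A\<^esub>"
  using frac_as_quotient[of \<one> s] by (simp add: frac_one to_loc_def)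

end

locale regular_localization = prime_localization +
  assumes regular: "regular_local_ring (localization R (carrier R - P))"
begin

sublocale A: noetherian_cring A
  using regular by (simp add: regular_local_ring_def noetherian_cring_def)

sublocale h: ring_hom_cring R A to_loc
  using to_loc_hom by (intro ring_hom_cringI) (auto intro: cring_axioms A.cring_axioms simp: ring_hom_def)

lemma contract_prime:
  assumes N: "primeideal N A"
  shows "primeideal {x \<in> carrier R. to_loc x \<in> N} R" "{x \<in> carrier R. to_loc x \<in> N} \<subseteq> P"
proof -
  let ?Q = "{x \<in> carrier R. to_loc x \<in> N}"
  have Ni: "ideal N A" using N primeideal.axioms(1) by blast
  have one: "\<one>\<^bsub>A\<^esub> \<notin> N" using A.prime_compl_one[OF N] by simp
  show "primeideal ?Q R"
  proof (rule primeidealI)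
    show "ideal ?Q R"
      using ring_hom_ring.ideal_vimage[OF _ Ni, of R to_loc] ring_hom_ringI2[OF ring_axioms A.ring_axioms to_loc_hom] by simp
    have "\<one> \<notin> ?Q" using one by simp
    then show "carrier R \<noteq> ?Q" using one_closed by blast
    fix a b assume "a \<in> carrier R" "b \<in> carrier R" "a \<otimes> b \<in> ?Q"
    then show "a \<in> ?Q \<or> b \<in> ?Q" using primeideal.I_prime[OF N, of "to_loc a" "to_loc b"] by simp
  qed (rule cring_axioms)
  show "?Q \<subseteq> P"
  proof
    fix x assume x: "x \<in> ?Q"
    show "x \<in> P"
    proof (rule ccontr)
      assume "x \<notin> P"
      then have xM: "x \<in> M" using x by simp
      have "frac \<one> x \<in> carrier A" using xM carrierA by auto
      then have "to_loc x \<otimes>\<^bsub>A\<^esub> frac \<one> x \<in> N" using x ideal.I_r_closed[OF Ni] by simp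
      then show False using to_loc_inverse[OF xM] one by simp
    qed
  qed
qed

text \<open>
  An ideal of the localization is determined by its contraction.
\<close>

lemma contract_strict:
  assumes N: "primeideal N A" and N': "primeideal N' A" and less: "N \<subset> N'"
  shows "{x \<in> carrier R. to_loc x \<in> N} \<subset> {x \<in> carrier R. to_loc x \<in> N'}"
proof -
  have Ni: "ideal N A" and N'i: "ideal N' A" using N N' primeideal.axioms(1) by auto
  obtain z where z: "z \<in> N'" "z \<notin> N" using less by blast
  have zc: "z \<in> carrier A" using ideal.Icarr[OF N'i z(1)] .
  then obtain a s where as: "z = frac a s" "a \<in> carrier R" "s \<in> M" unfolding carrierA by blast
  have sc: "s \<in> carrier R" "to_loc s \<in> carrier A" using as by auto
  have e: "to_loc s \<otimes>\<^bsub>A\<^esub> z = to_loc a" using frac_as_quotient as by simp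
  have "to_loc a \<in> N'" using ideal.I_l_closed[OF N'i z(1) sc(2)] e by simp
  moreover have "to_loc a \<notin> N"
  proof
    assume "to_loc a \<in> N"
    then have "to_loc s \<in> N" using primeideal.I_prime[OF N sc(2) zc] e z(2) by auto
    then have "s \<in> P" using contract_prime(2)[OF N] sc(1) by blast
    then show False using as(3) by simp
  qed
  ultimately show ?thesis using as(2) less by blast
qed

text \<open>
  If \<open>y \<in> P\<close>, then the image of \<open>y\<close> is not a unit, so it lies in some maximal ideal, and there is
  only one.
\<close>

lemma maximal_mem_iff:
  assumes N: "maximalideal N A" and y: "y \<in> carrier R"
  shows "to_loc y \<in> N \<longleftrightarrow> y \<in> P"
proof
  have Nm: "primeideal N A" using A.maximalideal_prime[OF N] .
  show "y \<in> P" if "to_loc y \<in> N" using contract_prime(2)[OF Nm] that y by blast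
  assume yP: "y \<in> P"
  show "to_loc y \<in> N"
  proof -
    let ?K = "PIdl\<^bsub>A\<^esub> (to_loc y)"
    have K: "ideal ?K A" using A.cgenideal_ideal y by simp
    have one: "\<one>\<^bsub>A\<^esub> \<notin> ?K"
    proof
      assume "\<one>\<^bsub>A\<^esub> \<in> ?K"
      then obtain z where z: "z \<in> carrier A" "\<one>\<^bsub>A\<^esub> = z \<otimes>\<^bsub>A\<^esub> to_loc y" unfolding cgenideal_def by blast
      then obtain b t where bt: "z = frac b t" "b \<in> carrier R" "t \<in> M" unfolding carrierA by blast
      have "frac \<one> \<one> = frac (b \<otimes> y) t" using z(2) bt y M_one frac_mult[of b t y \<one>] by (auto simp: frac_one to_loc_def)
      then obtain u where u: "u \<in> M" "u \<otimes> (\<one> \<otimes> t) = u \<otimes> ((b \<otimes> y) \<otimes> \<one>)"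
        using frac_eq_iff[of \<one> \<one> "b \<otimes> y" t] M_one bt y by auto
      have "u \<otimes> t = u \<otimes> (b \<otimes> y)" using u bt y by auto
      also have "\<dots> \<in> P" using ideal.I_l_closed[OF P_ideal] yP bt u by simp
      finally show False using M_mult[OF u(1) bt(3)] by simp
    qed
    define \<C> where "\<C> = {X. ideal X A \<and> ?K \<subseteq> X \<and> \<one>\<^bsub>A\<^esub> \<notin> X}"
    have ideals: "\<And>X. X \<in> \<C> \<Longrightarrow> ideal X A" by (simp add: \<C>_def)
    have "?K \<in> \<C>" using K one by (simp add: \<C>_def)
    then obtain W where W: "W \<in> \<C>" and Wmax: "\<forall>X\<in>\<C>. W \<subseteq> X \<longrightarrow> X = W"
      using A.exists_maximal_ideal_in[of \<C>, OF _ ideals] by blast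
    have Wi: "ideal W A" "?K \<subseteq> W" "\<one>\<^bsub>A\<^esub> \<notin> W" using W by (simp_all add: \<C>_def)
    have "maximalideal W A"
    proof (rule maximalidealI[OF Wi(1)])
      show "carrier A \<noteq> W" using Wi(3) A.one_closed by blast
      fix X assume X: "ideal X A" "W \<subseteq> X" "X \<subseteq> carrier A"
      show "X = W \<or> X = carrier A"
      proof (cases "\<one>\<^bsub>A\<^esub> \<in> X")
        case True then show ?thesis using ideal.one_imp_carrier[OF X(1)] by blast
      next
        case False
        then have "X \<in> \<C>" using X Wi(2) by (simp add: \<C>_def)
        then show ?thesis using Wmax X(2) by simp
      qed
    qed
    then have "W = N" using N regular unfolding regular_local_ring_def by blast
    moreover have "to_loc y \<in> ?K" using A.cgenideal_self y by simp
    ultimately show ?thesis using Wi(2) by blast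
  qed
qed

end

lemma Sup_enat_attained: "Sup S = enat d \<Longrightarrow> S \<noteq> {} \<Longrightarrow> enat d \<in> S"
  using Max_in[of S] by (cases "finite S") (simp_all add: Sup_enat_def)

context noetherian_cring
begin

lemma prime_chainI:
  assumes "\<And>i. i \<le> n \<Longrightarrow> primeideal (Q i) R" "\<And>i. i < n \<Longrightarrow> Q i \<subset> Q (Suc i)"
  shows "prime_chain n (Q 0) (Q n)"
  using assms
proof (induction n arbitrary: Q)
  case (Suc n)
  have "prime_chain n (Q (Suc 0)) (Q (Suc n))" using Suc.IH[of "\<lambda>i. Q (Suc i)"] Suc.prems by simp
  moreover have "primeideal (Q 0) R" "Q 0 \<subset> Q (Suc 0)" using Suc.prems by simp_all
  ultimately show ?case by auto
qed simp

lemma prime_chain_drop: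
  "prime_chain n Q P \<Longrightarrow> k < n \<Longrightarrow> \<exists>Q0 Q1. primeideal Q0 R \<and> Q0 \<subset> Q1 \<and> prime_chain k Q1 P"
proof (induction n arbitrary: Q)
  case (Suc n)
  then obtain Q' where Q': "primeideal Q R" "Q \<subset> Q'" "prime_chain n Q' P" by auto
  show ?case
  proof (cases "k = n")
    case True then show ?thesis using Q' by blast
  next
    case False then show ?thesis using Suc.IH[OF Q'(3)] Suc.prems by simp
  qed
qed simp

text \<open>
  With fewer than \<open>d\<close> generators, a proper end segment of the chain would already fit the number of
  generators, and its first prime would have to be the smallest prime contained in \<open>P\<close>; but there
  is a smaller one in the chain.
\<close>

lemma regular_parameters:
  assumes chain: "prime_chain d Q P" and X: "finite X" "X \<subseteq> P" "card X \<le> d" "P \<subseteq> loc P (Idl X)"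
  shows "regular_at_prime R P X"
proof -
  have P: "primeideal P R" using prime_chain_prime[OF chain] by blast
  have Xc: "X \<subseteq> carrier R" using X(2) ideal.Icarr[OF primeideal.axioms(1)[OF P]] by blast
  have zsub: "{\<zero>} \<subseteq> K" if "primeideal K R" for K using ideal_zero_closed primeideal.axioms(1) that by auto
  have gen: "P \<subseteq> loc P (adjoins {\<zero>} xs)" if "set xs = X" for xs
    using adjoins_zero[of xs] that Xc X(4) by simp
  have cardX: "card X = d"
  proof (rule ccontr)
    assume "card X \<noteq> d"
    then have "card X < d" using X(3) by simp
    then obtain Q0 Q1 where Q: "primeideal Q0 R" "Q0 \<subset> Q1" "prime_chain (card X) Q1 P"
      using prime_chain_drop[OF chain] by blast
    obtain xs where xs: "set xs = X" "distinct xs" using finite_distinct_list[OF X(1)] by blast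
    have Q1: "primeideal Q1 R" using prime_chain_prime[OF Q(3)] by blast
    have len: "length xs = card X" using xs distinct_card by metis
    have "loc P {\<zero>} = Q1"
      using regular_seq_if_chain[of xs Q1 P "{\<zero>}"] Q(3) zeroideal zsub[OF Q1] X(2) gen[OF xs(1)] xs(1) len by simp
    moreover have "loc P {\<zero>} \<subseteq> loc P Q0" using zsub[OF Q(1)] by (rule loc_mono)
    moreover have "Q0 \<subseteq> P" using Q(2) prime_chain_sub[OF Q(3)] by blast
    ultimately show False using loc_prime[OF _ P Q(1)] Q(2) by blast
  qed
  have Q0: "primeideal Q R" using prime_chain_prime[OF chain] by blast
  show ?thesis
  proof (intro regular_at_prime.intro regular_at_prime_axioms.intro noetherian_cring_axioms P X)
    fix xs assume xs: "set xs = X" "distinct xs"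
    have len: "length xs = d" using xs distinct_card cardX by metis
    show "regular_seq P {\<zero>} xs"
      using regular_seq_if_chain[of xs Q P "{\<zero>}"] chain zeroideal zsub[OF Q0] X(2) gen[OF xs(1)] xs(1) len by simp
  qed
qed

end

context regular_localization
begin

text \<open>
  The numerators of generators of the maximal ideal are parameters. The supremum that defines the
  dimension is finite and hence attained by a chain of primes, whose contractions form a chain of
  the same length below \<open>P\<close>. Numerators of distinct generators may coincide, so only an upper
  bound for their number is available at first.
\<close>

theorem exists_regular_parameters: "\<exists>X. regular_at_prime R P X"
proof -
  obtain N where N: "maximalideal N A" using regular unfolding regular_local_ring_def by blast
  obtain U where U: "U \<subseteq> carrier A" "finite U" "enat (card U) = krull_dim A" "N = Idl\<^bsub>A\<^esub> U"
    using regular N unfolding regular_local_ring_def by blast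
  have Np: "primeideal N A" using A.maximalideal_prime[OF N] .
  have Ni: "ideal N A" using Np primeideal.axioms(1) by blast
  let ?S = "{enat n | n. \<exists>Q :: nat \<Rightarrow> ('a \<times> 'a) set set. (\<forall>i\<le>n. primeideal (Q i) A) \<and> (\<forall>i<n. Q i \<subset> Q (Suc i))}"
  have "enat 0 \<in> ?S" using Np by (intro CollectI exI[of _ 0] conjI exI[of _ "\<lambda>_. N"]) auto
  then have ne: "?S \<noteq> {}" by blast
  have Sup: "Sup ?S = enat (card U)" using U(3) unfolding krull_dim_def by (rule sym)
  have "enat (card U) \<in> ?S" using Sup_enat_attained[OF Sup ne] .
  then obtain Q where Q: "\<And>i. i \<le> card U \<Longrightarrow> primeideal (Q i) A" "\<And>i. i < card U \<Longrightarrow> Q i \<subset> Q (Suc i)" by auto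
  define d where "d = card U"
  \<comment> \<open>the contraction of the last prime may be smaller than \<open>P\<close> and is replaced by \<open>P\<close>\<close>
  define B where "B i = (if i = d then P else {x \<in> carrier R. to_loc x \<in> Q i})" for i
  have "prime_chain d (B 0) (B d)"
  proof (rule prime_chainI)
    show "primeideal (B i) R" if "i \<le> d" for i
      using contract_prime(1)[OF Q(1)] P that by (auto simp: B_def d_def)
    show "B i \<subset> B (Suc i)" if i: "i < d" for i
    proof -
      have "{x \<in> carrier R. to_loc x \<in> Q i} \<subset> {x \<in> carrier R. to_loc x \<in> Q (Suc i)}"
        using contract_strict[OF Q(1) Q(1) Q(2)] i by (simp add: d_def)
      moreover have "{x \<in> carrier R. to_loc x \<in> Q (Suc i)} \<subseteq> P"
        using contract_prime(2)[OF Q(1)] i by (simp add: d_def)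
      ultimately show ?thesis using i by (auto simp: B_def)
    qed
  qed
  then have chain: "prime_chain d (B 0) P" by (simp add: B_def)
  have "\<forall>u\<in>U. \<exists>as. fst as \<in> carrier R \<and> snd as \<in> M \<and> u = frac (fst as) (snd as)"
  proof
    fix u assume "u \<in> U"
    then have "u \<in> carrier A" using U(1) by blast
    then obtain a s where "a \<in> carrier R" "s \<in> M" "u = frac a s" unfolding carrierA by blast
    then show "\<exists>as. fst as \<in> carrier R \<and> snd as \<in> M \<and> u = frac (fst as) (snd as)"
      by (intro exI[of _ "(a, s)"]) simp
  qed
  from bchoice[OF this] obtain f where f: "\<And>u. u \<in> U \<Longrightarrow> fst (f u) \<in> carrier R \<and> snd (f u) \<in> M \<and> u = frac (fst (f u)) (snd (f u))"
    by blast
  define X where "X = (\<lambda>u. fst (f u)) ` U"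
  have Xfin: "finite X" "card X \<le> d" using U(2) card_image_le by (auto simp: X_def d_def)
  have Xc: "X \<subseteq> carrier R" using f by (auto simp: X_def)
  have XP: "X \<subseteq> P"
  proof
    fix x assume "x \<in> X"
    then obtain u where u: "u \<in> U" "x = fst (f u)" by (auto simp: X_def)
    have fu: "x \<in> carrier R" "snd (f u) \<in> M" "u = frac x (snd (f u))" using f[OF u(1)] u(2) by auto
    have "u \<in> N" using U(1,4) A.genideal_self[OF U(1)] u(1) by blast
    then have "to_loc (snd (f u)) \<otimes>\<^bsub>A\<^esub> u \<in> N" using ideal.I_l_closed[OF Ni] fu(2) by simp
    then have "to_loc x \<in> N" using frac_as_quotient[OF fu(1,2)] fu(3) by simp
    then show "x \<in> P" using maximal_mem_iff[OF N fu(1)] by simp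
  qed
  have I: "ideal (Idl X) R" using genideal_ideal[OF Xc] .
  have Ic: "x \<in> carrier R" if "x \<in> Idl X" for x using ideal.Icarr[OF I that] .
  let ?E = "{frac a s | a s. a \<in> Idl X \<and> s \<in> M}"
  have E: "ideal ?E A"
  proof (rule A.idealI_closed)
    show "?E \<subseteq> carrier A" using Ic unfolding carrierA by blast
    show "\<zero>\<^bsub>A\<^esub> \<in> ?E" unfolding frac_zero using ideal_zero_closed[OF I] M_one by blast
    fix v w assume v: "v \<in> ?E"
    obtain a s where as: "v = frac a s" "a \<in> Idl X" "s \<in> M" using v by blast
    have sc: "s \<in> carrier R" using as by simp
    {
      assume w: "w \<in> ?E"
      obtain b t where bt: "w = frac b t" "b \<in> Idl X" "t \<in> M" using w by blast
      have tc: "t \<in> carrier R" using bt by simp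
      have "a \<otimes> t \<oplus> b \<otimes> s \<in> Idl X"
        using ideal_add_closed[OF I ideal.I_r_closed[OF I as(2) tc] ideal.I_r_closed[OF I bt(2) sc]] .
      then show "v \<oplus>\<^bsub>A\<^esub> w \<in> ?E" using frac_add[OF Ic[OF as(2)] as(3) Ic[OF bt(2)] bt(3)] M_mult[OF as(3) bt(3)] as(1) bt(1)
        by blast
    next
      assume w: "w \<in> carrier A"
      obtain b t where bt: "w = frac b t" "b \<in> carrier R" "t \<in> M" using w unfolding carrierA by blast
      have "b \<otimes> a \<in> Idl X" using ideal.I_l_closed[OF I as(2) bt(2)] .
      then show "w \<otimes>\<^bsub>A\<^esub> v \<in> ?E" using frac_mult[OF bt(2,3) Ic[OF as(2)] as(3)] M_mult[OF bt(3) as(3)] as(1) bt(1)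
        by blast
    }
  qed
  have "U \<subseteq> ?E"
  proof
    fix u assume u: "u \<in> U"
    have "fst (f u) \<in> Idl X" using genideal_self[OF Xc] u by (auto simp: X_def)
    then show "u \<in> ?E" using f[OF u] by blast
  qed
  then have NE: "N \<subseteq> ?E" unfolding U(4) using E by (intro A.genideal_minimal)
  have "P \<subseteq> loc P (Idl X)"
  proof
    fix y assume y: "y \<in> P"
    have yc: "y \<in> carrier R" using ideal.Icarr[OF P_ideal y] .
    have "to_loc y \<in> ?E" using maximal_mem_iff[OF N yc] y NE by blast
    then obtain a s where as: "frac y \<one> = frac a s" "a \<in> Idl X" "s \<in> M" unfolding to_loc_def by blast
    then obtain u where u: "u \<in> M" "u \<otimes> (y \<otimes> s) = u \<otimes> (a \<otimes> \<one>)"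
      using frac_eq_iff[OF yc M_one Ic[OF as(2)] as(3)] by blast
    have "(u \<otimes> s) \<otimes> y = u \<otimes> (y \<otimes> s)" using u as yc by (simp add: m_ac)
    also have "\<dots> = u \<otimes> a" unfolding u(2) using Ic[OF as(2)] by simp
    also have "\<dots> \<in> Idl X" using ideal.I_l_closed[OF I as(2)] u by simp
    finally show "y \<in> loc P (Idl X)" using locI[OF M_mult[OF u(1) as(3)] yc] by blast
  qed
  then show ?thesis using regular_parameters[OF chain Xfin(1) XP Xfin(2)] by blast
qed

end

section \<open>The equivalence\<close>

context noetherian_cring
begin

lemma ideal_colon_ideal:
  assumes "ideal K R" "L \<subseteq> carrier R" shows "ideal (ideal_colon R K L) R"
proof (rule idealI_closed)
  show "\<zero> \<in> ideal_colon R K L" using assms ideal_zero_closed[OF assms(1)] by (auto simp: ideal_colon_def)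
  show "a \<oplus> b \<in> ideal_colon R K L" if "a \<in> ideal_colon R K L" "b \<in> ideal_colon R K L" for a b
    using that assms(2) ideal_add_closed[OF assms(1)] by (auto simp: ideal_colon_def l_distr subset_iff)
  show "r \<otimes> a \<in> ideal_colon R K L" if "a \<in> ideal_colon R K L" "r \<in> carrier R" for a r
    using that assms(2) ideal.I_l_closed[OF assms(1)] by (auto simp: ideal_colon_def m_assoc subset_iff)
qed (auto simp: ideal_colon_def)

lemma ideal_prod_subset_iff:
  assumes "ideal K R" shows "A \<cdot> B \<subseteq> K \<longleftrightarrow> (\<forall>a\<in>A. \<forall>b\<in>B. a \<otimes> b \<in> K)"
proof
  assume L: "A \<cdot> B \<subseteq> K"
  show "\<forall>a\<in>A. \<forall>b\<in>B. a \<otimes> b \<in> K"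
  proof (intro ballI)
    fix a b assume "a \<in> A" "b \<in> B"
    then have "a \<otimes> b \<in> A \<cdot> B" by (rule ideal_prod.prod)
    then show "a \<otimes> b \<in> K" using L by blast
  qed
next
  assume Rh: "\<forall>a\<in>A. \<forall>b\<in>B. a \<otimes> b \<in> K"
  show "A \<cdot> B \<subseteq> K"
  proof
    fix x assume "x \<in> A \<cdot> B"
    then show "x \<in> K"
      by (induction rule: ideal_prod.induct) (use Rh ideal_add_closed[OF assms] in auto)
  qed
qed

lemma frobenius_power_0: assumes "ideal K R" shows "frobenius_power p 0 R K = K"
proof -
  have "(\<lambda>x. x [^] (p ^ 0)) ` K = K" using ideal.Icarr[OF assms] by force
  then have "frobenius_power p 0 R K = Idl K" by (simp add: frobenius_power_def)
  moreover have "Idl K \<subseteq> K" using genideal_minimal[OF assms] by blast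
  moreover have "K \<subseteq> Idl K" using genideal_self ideal.Icarr[OF assms] by blast
  ultimately show ?thesis by blast
qed

end

theorem proposition3p11:
  fixes S :: "('a, 'm) ring_scheme" and p :: nat
    and \<aa> :: "nat \<Rightarrow> 'a set" and I J :: "'a set"
  assumes "prime p" and "has_characteristic S p"
    and "regular_ring S" and "F_finite p S"
    and "ideal I S"
    and "graded_system S \<aa>"
    and "is_pair S \<aa>"
    and "is_pair (S Quot I) (\<lambda>i. extend_ideal S I (\<aa> i))"
    and "ideal J S" and "I \<subseteq> J"
  shows "(uniformly_compatible p (S Quot I) (\<lambda>i. extend_ideal S I (\<aa> i)) (quotient_ideal S I J)
            \<longleftrightarrow>
          (\<forall>e. \<forall>a\<in>\<aa> (p ^ e - 1).
             (\<lambda>x. a \<otimes>\<^bsub>S\<^esub> x) ` ideal_colon S (frobenius_power p e S I) I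
               \<subseteq> ideal_colon S (frobenius_power p e S J) J))
       \<and> (uniformly_compatible p (S Quot I) (\<lambda>i. extend_ideal S I (\<aa> i)) (quotient_ideal S I J)
            \<longleftrightarrow>
          (\<forall>e. \<aa> (p ^ e - 1) \<cdot>\<^bsub>S\<^esub> ideal_colon S (frobenius_power p e S I) I
                 \<subseteq> ideal_colon S (frobenius_power p e S J) J))"
proof -
  note I = \<open>ideal I S\<close> and J = \<open>ideal J S\<close> and IJ = \<open>I \<subseteq> J\<close>
  have nS: "noetherian_cring S"
    using \<open>regular_ring S\<close> by (simp add: regular_ring_def noetherian_cring_def)
  interpret noetherian_cring S by (rule nS)
  have fr: "frobenius_ring S p"
    using \<open>prime p\<close> \<open>has_characteristic S p\<close> nS
    by (intro frobenius_ring.intro frobenius_ring_axioms.intro) (auto simp: has_characteristic_def)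
  interpret frobenius_ring S p by (rule fr)
  have \<aa>: "ideal (\<aa> i) S" for i using \<open>graded_system S \<aa>\<close> by (simp add: graded_system_def)
  have traced: "locally_traced e" if "e > 0" for e
    unfolding locally_traced_def
  proof (intro allI impI)
    fix P assume P: "primeideal P S"
    have "regular_localization S P"
      using nS P \<open>regular_ring S\<close>
      by (intro regular_localization.intro prime_localization.intro prime_localization_axioms.intro
          regular_localization_axioms.intro) (auto simp: regular_ring_def)
    then obtain X where X: "regular_at_prime S P X" using regular_localization.exists_regular_parameters by blast
    have "frobenius_regular S p P X"
      using fr P X \<open>F_finite p S\<close>
      by (intro frobenius_regular.intro frobenius_at_prime.intro frobenius_at_prime_axioms.intro
          frobenius_regular_axioms.intro)
    then obtain s \<Phi> L where "s \<in> carrier S - P" "trace_basis p s \<Phi> L"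
      using frobenius_regular.exists_trace_basis by blast
    then show "\<exists>s\<in>carrier S - P. \<exists>\<Phi> L. trace_basis (p ^ e) s \<Phi> L"
      using trace_basis_iterate[OF P _ _ that] by blast
  qed
  define C where "C e \<longleftrightarrow> (\<forall>a\<in>\<aa> (p ^ e - 1). \<forall>c\<in>ideal_colon S (frobenius_power p e S I) I.
      a \<otimes>\<^bsub>S\<^esub> c \<in> ideal_colon S (frobenius_power p e S J) J)" for e
  have colon: "ideal (ideal_colon S (frobenius_power p e S J) J) S" for e
    using frobenius_power_ideal[OF J] ideal.Icarr[OF J] by (intro ideal_colon_ideal) auto
  \<comment> \<open>for \<open>e = 0\<close> both colon ideals are the whole ring\<close>
  have C0: "C 0"
    unfolding C_def frobenius_power_0[OF I] frobenius_power_0[OF J]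
    using ideal.Icarr[OF \<aa>] ideal.I_l_closed[OF J] by (auto simp: ideal_colon_def)
  have "uniformly_compatible p (S Quot I) (\<lambda>i. extend_ideal S I (\<aa> i)) (quotient_ideal S I J) \<longleftrightarrow> (\<forall>e>0. C e)"
  proof -
    have "ideal (quotient_ideal S I J) (S Quot I)"
      unfolding quotient_ideal_def using ring_ideal_imp_quot_ideal[OF I J] .
    moreover have "C e \<longleftrightarrow> (\<forall>a\<in>extend_ideal S I (\<aa> (p ^ e - 1)).
        \<forall>\<psi>\<in>linear_maps (S Quot I) (frobenius_pushforward p e (S Quot I) (self_module (S Quot I))) (self_module (S Quot I)).
         \<psi> ` ((\<lambda>x. a \<otimes>\<^bsub>S Quot I\<^esub> x) ` quotient_ideal S I J) \<subseteq> quotient_ideal S I J)" if e: "e > 0" for e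
      unfolding quotient_compatible_iff[OF traced[OF e] I J IJ \<aa>] C_def
    proof (intro ball_cong refl)
      fix a assume "a \<in> \<aa> (p ^ e - 1)"
      then have "a \<in> carrier S" by (rule ideal.Icarr[OF \<aa>])
      from fedder_criterion[OF traced[OF e] I J this]
      show "(\<forall>c\<in>ideal_colon S (frobenius_power p e S I) I. a \<otimes>\<^bsub>S\<^esub> c \<in> ideal_colon S (frobenius_power p e S J) J)
        \<longleftrightarrow> (\<forall>\<phi>\<in>cartier_maps (p ^ e). \<phi> ` I \<subseteq> I \<longrightarrow> (\<forall>j\<in>J. \<phi> (a \<otimes>\<^bsub>S\<^esub> j) \<in> J))" by simp
    qed
    ultimately show ?thesis unfolding uniformly_compatible_def by simp
  qed
  then have main: "uniformly_compatible p (S Quot I) (\<lambda>i. extend_ideal S I (\<aa> i)) (quotient_ideal S I J) \<longleftrightarrow> (\<forall>e. C e)"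
    using C0 by (metis gr0I)
  have elem: "C e \<longleftrightarrow> (\<forall>a\<in>\<aa> (p ^ e - 1). (\<lambda>x. a \<otimes>\<^bsub>S\<^esub> x) ` ideal_colon S (frobenius_power p e S I) I
               \<subseteq> ideal_colon S (frobenius_power p e S J) J)" for e
    unfolding C_def by blast
  have prod: "C e \<longleftrightarrow> \<aa> (p ^ e - 1) \<cdot>\<^bsub>S\<^esub> ideal_colon S (frobenius_power p e S I) I
                 \<subseteq> ideal_colon S (frobenius_power p e S J) J" for e
    unfolding C_def using ideal_prod_subset_iff[OF colon] by simp
  show ?thesis unfolding main by (simp only: elem[symmetric] prod[symmetric] simp_thms)
qed

end
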